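(* Let $\mathbb{U}=\{z\in\mathbb{C}:|z|<1\}$, let $0<\mu<1$, and let $D\subset\mathbb{C}$ be a Lyapunov domain with $C^{1,\mu}$ boundary. Suppose that $h:\mathbb{U}\to D$ is a harmonic quasiconformal homeomorphism of $\mathbb{U}$ onto $D$. Then $h$ is co-Lipschitz on $\mathbb{U}$, i.e. there is a constant $s>0$ such that $|h(z_1)-h(z_2)|\ge s\,|z_1-z_2|$ for all $z_1,z_2\in\mathbb{U}$.
   Context: Lyapunov domain: a rectifiable, differentiable planar curve $\gamma$ with arc-length parameterization $g:[0,l]\to\mathbb{C}$ is $C^{1,\mu}$ (also called $\mu$-Lyapunov) if $\sup_{t\ne s}\frac{|g'(t)-g'(s)|}{|t-s|^{\mu}}<\infty$. A $\mu$-Lyapunov domain is a bounded planar domain bounded by a (closed Jordan) $\mu$-Lyapunov curve; a Lyapunov domain is a $\mu$-Lyapunov domain for some $0<\mu<1$. Quasiconformal: a homeomorphism $h:D_1\to D_2$ between planar domains is $K$-quasiconformal ($K$-qc), $K\ge1$, if $h$ is absolutely continuous on a.e. horizontal and a.e. vertical line in $D_1$ and $|h_{\bar z}|\le k|h_z|$ a.e. on $D_1$, where $k=\frac{K-1}{K+1}$. It is quasiconformal (qc) if it is $K$-qc for some $K\ge 1$. "Harmonic quasiconformal" (hqc) means quasiconformal and (Euclidean) harmonic as a complex-valued function. *)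

theory Defs
  imports "HOL-Analysis.Analysis"
begin

section \<open>Lyapunov domains\<close>

definition curve_length :: "(real \<Rightarrow> complex) \<Rightarrow> real \<Rightarrow> real \<Rightarrow> ennreal" where
  "curve_length g a b =
     (SUP (n, p) \<in> {(n, p :: nat \<Rightarrow> real). mono_on {..n} p \<and> p 0 = a \<and> p n = b}.
        ennreal (\<Sum>i<n. dist (g (p i)) (g (p (Suc i)))))"

text \<open>Rectifiability is implied: the total length is the finite number \<open>l\<close>.\<close>

definition arc_length_parametrization :: "real \<Rightarrow> (real \<Rightarrow> complex) \<Rightarrow> bool" where
  "arc_length_parametrization l g \<longleftrightarrow>
     0 \<le> l \<and> (\<forall>t\<in>{0..l}. curve_length g 0 t = ennreal t)"

text \<open>
  The parametrization \<open>g\<close> lives on \<open>{0..l}\<close>; the closed Jordan condition is expressed for its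
  rescaling to the unit interval. Differentiability of a \<^emph>\<open>closed\<close> curve includes the point where
  it closes up: the one-sided derivatives at \<open>0\<close> and \<open>l\<close> have to agree (otherwise a curve with
  a corner or a cusp at that point would be admitted).
\<close>

definition closed_Jordan_Lyapunov_curve :: "real \<Rightarrow> real \<Rightarrow> (real \<Rightarrow> complex) \<Rightarrow> bool" where
  "closed_Jordan_Lyapunov_curve \<mu> l g \<longleftrightarrow>
     0 < l \<and>
     simple_path (\<lambda>x. g (l * x)) \<and> g l = g 0 \<and>
     arc_length_parametrization l g \<and>
     (\<exists>g'. (\<forall>t\<in>{0..l}. (g has_vector_derivative g' t) (at t within {0..l})) \<and>
           g' l = g' 0 \<and>
           bdd_above {norm (g' t - g' s) / \<bar>t - s\<bar> powr \<mu> | t s.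
                        t \<in> {0..l} \<and> s \<in> {0..l} \<and> t \<noteq> s})"

definition planar_domain :: "complex set \<Rightarrow> bool" where
  "planar_domain D \<longleftrightarrow> open D \<and> connected D \<and> D \<noteq> {}"

definition Lyapunov_domain :: "real \<Rightarrow> complex set \<Rightarrow> bool" where
  "Lyapunov_domain \<mu> D \<longleftrightarrow>
     planar_domain D \<and> bounded D \<and>
     (\<exists>l g. closed_Jordan_Lyapunov_curve \<mu> l g \<and> frontier D = g ` {0..l})"


section \<open>Partial derivatives and harmonic functions\<close>

definition partial_x :: "(complex \<Rightarrow> complex) \<Rightarrow> complex \<Rightarrow> complex" where
  "partial_x f z = vector_derivative (\<lambda>t. f (z + of_real t)) (at 0)"

definition partial_y :: "(complex \<Rightarrow> complex) \<Rightarrow> complex \<Rightarrow> complex" where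
  "partial_y f z = vector_derivative (\<lambda>t. f (z + \<i> * of_real t)) (at 0)"

text \<open>Here \<open>differentiable\<close> is real (Frechet) differentiability.\<close>

definition C1_on :: "complex set \<Rightarrow> (complex \<Rightarrow> complex) \<Rightarrow> bool" where
  "C1_on S f \<longleftrightarrow>
     (\<forall>z\<in>S. f differentiable (at z)) \<and>
     continuous_on S (partial_x f) \<and> continuous_on S (partial_y f)"

definition harmonic_on :: "complex set \<Rightarrow> (complex \<Rightarrow> complex) \<Rightarrow> bool" where
  "harmonic_on S f \<longleftrightarrow>
     open S \<and> C1_on S f \<and> C1_on S (partial_x f) \<and> C1_on S (partial_y f) \<and>
     (\<forall>z\<in>S. partial_x (partial_x f) z + partial_y (partial_y f) z = 0)"


section \<open>Quasiconformal homeomorphisms\<close>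

definition absolutely_continuous_fun_on :: "real \<Rightarrow> real \<Rightarrow> (real \<Rightarrow> complex) \<Rightarrow> bool" where
  "absolutely_continuous_fun_on c d f \<longleftrightarrow>
     (\<forall>\<epsilon>>0. \<exists>\<delta>>0. \<forall>(n::nat) a b.
        (\<forall>i<n. c \<le> a i \<and> a i \<le> b i \<and> b i \<le> d) \<and>
        disjoint_family_on (\<lambda>i. {a i<..<b i}) {..<n} \<and>
        (\<Sum>i<n. b i - a i) < \<delta>
        \<longrightarrow> (\<Sum>i<n. norm (f (b i) - f (a i))) < \<epsilon>)"

text \<open>
  Absolute continuity on a line means absolute continuity on every compact segment of that line
  contained in \<open>S\<close>. It makes the partial derivatives exist a.e. in \<open>S\<close>, so the Wirtinger
  derivatives below are meaningful a.e.
\<close>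

definition ACL_on :: "complex set \<Rightarrow> (complex \<Rightarrow> complex) \<Rightarrow> bool" where
  "ACL_on S f \<longleftrightarrow>
     (AE y in lebesgue. \<forall>a b. a \<le> b \<and> (\<forall>x\<in>{a..b}. Complex x y \<in> S)
        \<longrightarrow> absolutely_continuous_fun_on a b (\<lambda>x. f (Complex x y))) \<and>
     (AE x in lebesgue. \<forall>a b. a \<le> b \<and> (\<forall>y\<in>{a..b}. Complex x y \<in> S)
        \<longrightarrow> absolutely_continuous_fun_on a b (\<lambda>y. f (Complex x y)))"

definition deriv_z :: "(complex \<Rightarrow> complex) \<Rightarrow> complex \<Rightarrow> complex" where
  "deriv_z f z = (partial_x f z - \<i> * partial_y f z) / 2"

definition deriv_zbar :: "(complex \<Rightarrow> complex) \<Rightarrow> complex \<Rightarrow> complex" where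
  "deriv_zbar f z = (partial_x f z + \<i> * partial_y f z) / 2"

definition K_quasiconformal ::
    "real \<Rightarrow> complex set \<Rightarrow> complex set \<Rightarrow> (complex \<Rightarrow> complex) \<Rightarrow> bool" where
  "K_quasiconformal K D1 D2 h \<longleftrightarrow>
     1 \<le> K \<and> planar_domain D1 \<and> planar_domain D2 \<and>
     (\<exists>h'. homeomorphism D1 D2 h h') \<and> ACL_on D1 h \<and>
     (AE z in lebesgue. z \<in> D1 \<longrightarrow> norm (deriv_zbar h z) \<le> (K - 1) / (K + 1) * norm (deriv_z h z))"

definition quasiconformal :: "complex set \<Rightarrow> complex set \<Rightarrow> (complex \<Rightarrow> complex) \<Rightarrow> bool" where
  "quasiconformal D1 D2 h \<longleftrightarrow> (\<exists>K. K_quasiconformal K D1 D2 h)"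

definition co_Lipschitz_on :: "complex set \<Rightarrow> (complex \<Rightarrow> complex) \<Rightarrow> bool" where
  "co_Lipschitz_on S f \<longleftrightarrow>
     (\<exists>s>0. \<forall>z1\<in>S. \<forall>z2\<in>S. norm (f z1 - f z2) \<ge> s * norm (z1 - z2))"

end

theory Submission
  imports Defs "HOL-Complex_Analysis.Complex_Analysis"
begin

text \<open>
  Write \<open>h = f + cnj g\<close> with \<open>f\<close>, \<open>g\<close> holomorphic and \<open>|g'| \<le> k |f'|\<close>, \<open>k < 1\<close>. At every boundary point a region
  \<open>y > M |w|^(1 + \<mu>)\<close> lies inside \<open>D\<close> and its mirror image outside. Barriers built from powers \<open>1 + \<mu>\<close>
  of linear coordinates and of \<open>|w|\<close> become sub- and superharmonic after composition with \<open>h\<close>, because \<open>h\<close> is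
  quasiconformal, and comparing them with functions of \<open>|z|\<close> shows that the distance of \<open>h z\<close> to the boundary of
  \<open>D\<close> is comparable to \<open>1 - |z|\<close>. The gradient estimate for positive harmonic functions then bounds \<open>f'\<close> from
  above. Since \<open>h\<close> is injective, \<open>f'\<close> has no zeros, and Harnack's inequality for \<open>ln (C / |f'|)\<close> bounds \<open>f'\<close> from
  below. So the inverse of \<open>h\<close> has bounded derivative on \<open>D\<close>, and it is Lipschitz because \<open>D\<close> is locally
  quasiconvex.
\<close>

section \<open>Decomposition of planar harmonic maps\<close>

text \<open>The cusps that replace them force barriers of the same low regularity, whose Laplacians
  blow up like \<open>|w|^(\<mu> - 1)\<close> at the boundary point. After composition with
  \<open>h\<close>, the harmful and the helpful term both carry the factor \<open>|f'|^2\<close>; a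
  large coefficient therefore settles the sign with no information on the size of \<open>f'\<close>.
  The maximum principle relies on properness alone: images of points that tend to the unit circle
  accumulate only at \<open>frontier D\<close>. The first bound for \<open>f'\<close> is of order
  \<open>1 / (1 - |z|)\<close> and comes from boundedness of \<open>D\<close>. Flatness of order 1 +
  \<mu> improves it: the oscillation of \<open>h\<close> on a small disc reappears with a power
  above 1, so it can be absorbed. The lower distance bound enters only in the lower bound for
  \<open>f'\<close>. That \<open>f'\<close> has no zeros is a separate, interior fact, proved with
  winding numbers.\<close>

lemma has_vector_derivative_line:
  fixes f :: "'a::real_normed_vector \<Rightarrow> 'b::real_normed_vector"
  assumes "(f has_derivative F) (at (x + t *\<^sub>R a))"
  shows "((\<lambda>t. f (x + t *\<^sub>R a)) has_vector_derivative F a) (at t)"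
proof -
  have "((\<lambda>t. x + t *\<^sub>R a) has_derivative (\<lambda>r. r *\<^sub>R a)) (at t)"
    by (auto intro!: derivative_eq_intros)
  from diff_chain_at[OF this assms] show ?thesis
    using has_derivative_linear[OF assms]
    by (simp add: has_vector_derivative_def o_def linear_cmul)
qed

text \<open>The second difference is the increment over \<open>[0, s]\<close> of
  \<open>f (z + t a + s b) - f (z + t a)\<close> as a function of \<open>t\<close>. Its derivative
  is \<open>s P b\<close> up to \<open>e s\<close>, because \<open>\<lambda>w. F w a\<close> is
  differentiable at \<open>z\<close>; the mean value inequality does the rest, without continuity of
  second derivatives.\<close>

lemma second_difference_bound:
  fixes f :: "'a::real_normed_vector \<Rightarrow> 'b::real_normed_vector"
  assumes S: "open S" "z \<in> S"
    and f: "\<And>w. w \<in> S \<Longrightarrow> (f has_derivative F w) (at w)"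
    and P: "((\<lambda>w. F w a) has_derivative P) (at z)"
    and e: "e > 0"
  shows "\<exists>d>0. \<forall>s. 0 < s \<and> s < d \<longrightarrow>
    norm (f (z + s *\<^sub>R a + s *\<^sub>R b) - f (z + s *\<^sub>R a) - f (z + s *\<^sub>R b) + f z - s\<^sup>2 *\<^sub>R P b) \<le> e * s\<^sup>2"
proof -
  \<comment> \<open>Two first-order errors add up, for increments of size
    \<open>s (|a| + |b|)\<close> and \<open>s |a|\<close>; the extra 1 keeps \<open>N\<close>
    positive.\<close>
  define N where "N = 2 * norm a + norm b + 1"
  have N: "N > 0" by (simp add: N_def add_nonneg_pos)
  interpret P: bounded_linear P using P by (rule has_derivative_bounded_linear)
  have "e / N > 0" using e N by simp
  then obtain d1 where d1: "d1 > 0"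
    "\<And>w. norm (w - z) < d1 \<Longrightarrow> norm (F w a - F z a - P (w - z)) \<le> e / N * norm (w - z)"
    using P unfolding has_derivative_at_alt by blast
  obtain d2 where d2: "d2 > 0" "ball z d2 \<subseteq> S" using S open_contains_ball by blast
  define d where "d = min d1 d2 / N"
  have d: "d > 0" using d1(1) d2(1) N by (simp add: d_def)
  show ?thesis
  proof (intro exI[of _ d] conjI allI impI d)
    fix s :: real assume s: "0 < s \<and> s < d"
    have sN: "s * N < min d1 d2" using s N by (simp add: d_def pos_less_divide_eq)
    have small: "norm (t *\<^sub>R a + r *\<^sub>R b) < min d1 d2"
      if "0 \<le> t" "t \<le> s" "0 \<le> r" "r \<le> s" for t r
    proof -
      have "norm (t *\<^sub>R a + r *\<^sub>R b) \<le> t * norm a + r * norm b"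
        using norm_triangle_ineq[of "t *\<^sub>R a" "r *\<^sub>R b"] that by simp
      also have "\<dots> \<le> s * norm a + s * norm b"
        using that by (intro add_mono mult_right_mono) auto
      also have "\<dots> \<le> s * N" using s by (simp add: N_def algebra_simps)
      finally show ?thesis using sN by simp
    qed
    define \<phi> where "\<phi> t = f (z + t *\<^sub>R a + s *\<^sub>R b) - f (z + t *\<^sub>R a) - (t * s) *\<^sub>R P b" for t
    have der: "(\<phi> has_vector_derivative
        (F (z + t *\<^sub>R a + s *\<^sub>R b) a - F (z + t *\<^sub>R a) a - s *\<^sub>R P b)) (at t within {0..s})"
      if t: "t \<in> {0..s}" for t
    proof -
      have i1: "z + t *\<^sub>R a + s *\<^sub>R b \<in> S"
        using small[of t s] t s d2(2) by (auto simp: subset_iff dist_norm norm_minus_commute add.assoc)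
      have i2: "z + t *\<^sub>R a \<in> S"
        using small[of t 0] t s d2(2) by (auto simp: subset_iff dist_norm norm_minus_commute)
      have "((\<lambda>t. f ((z + s *\<^sub>R b) + t *\<^sub>R a)) has_vector_derivative F (z + t *\<^sub>R a + s *\<^sub>R b) a) (at t)"
        using f[OF i1] by (intro has_vector_derivative_line) (simp add: algebra_simps)
      then have "((\<lambda>t. f (z + t *\<^sub>R a + s *\<^sub>R b)) has_vector_derivative F (z + t *\<^sub>R a + s *\<^sub>R b) a) (at t)"
        by (simp add: algebra_simps)
      moreover have "((\<lambda>t. f (z + t *\<^sub>R a)) has_vector_derivative F (z + t *\<^sub>R a) a) (at t)"
        using f[OF i2] by (intro has_vector_derivative_line)
      moreover have "((\<lambda>t. (t * s) *\<^sub>R P b) has_vector_derivative s *\<^sub>R P b) (at t)"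
        by (auto intro!: derivative_eq_intros)
      ultimately show ?thesis
        unfolding \<phi>_def
        by (rule has_vector_derivative_at_within[OF has_vector_derivative_diff[OF has_vector_derivative_diff]])
    qed
    have bnd: "norm (F (z + t *\<^sub>R a + s *\<^sub>R b) a - F (z + t *\<^sub>R a) a - s *\<^sub>R P b) \<le> e * s"
      if t: "t \<in> {0..s}" for t
    proof -
      have st: "0 \<le> t" "t \<le> s" "0 \<le> s" using t s by simp_all
      have eN: "0 \<le> e / N" using e N by simp
      have P_bound: "norm (F (z + v) a - F z a - P v) \<le> e / N * c"
        if "norm v < min d1 d2" "norm v \<le> c" for v c
      proof -
        have "norm (F (z + v) a - F z a - P v) \<le> e / N * norm v"
          using d1(2)[of "z + v"] that(1) by simp
        also have "\<dots> \<le> e / N * c" using mult_left_mono[OF that(2) eN] .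
        finally show ?thesis .
      qed
      have ta: "norm (t *\<^sub>R a) \<le> s * norm a"
        using mult_right_mono[OF st(2) norm_ge_zero[of a]] st by simp
      have "norm (t *\<^sub>R a + s *\<^sub>R b) \<le> s * (norm a + norm b)"
        using norm_triangle_ineq[of "t *\<^sub>R a" "s *\<^sub>R b"] ta st by (simp add: algebra_simps)
      from P_bound[OF small[OF st(1,2,3) order_refl] this]
      have e1: "norm (F (z + t *\<^sub>R a + s *\<^sub>R b) a - F z a - P (t *\<^sub>R a + s *\<^sub>R b)) \<le> e / N * (s * (norm a + norm b))"
        by (simp add: add.assoc)
      have e2: "norm (F (z + t *\<^sub>R a) a - F z a - P (t *\<^sub>R a)) \<le> e / N * (s * norm a)"
        using P_bound[OF _ ta] small[of t 0] st by simp
      have "F (z + t *\<^sub>R a + s *\<^sub>R b) a - F (z + t *\<^sub>R a) a - s *\<^sub>R P b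
          = (F (z + t *\<^sub>R a + s *\<^sub>R b) a - F z a - P (t *\<^sub>R a + s *\<^sub>R b)) - (F (z + t *\<^sub>R a) a - F z a - P (t *\<^sub>R a))"
        by (simp add: P.add P.scaleR)
      also have "norm \<dots> \<le> e / N * (s * (norm a + norm b)) + e / N * (s * norm a)"
        using norm_triangle_ineq4 e1 e2 by (meson add_mono order_trans)
      also have "\<dots> = e / N * s * (2 * norm a + norm b)" by (simp add: algebra_simps)
      also have "\<dots> \<le> e / N * s * N"
        using mult_nonneg_nonneg[OF eN st(3)] by (rule mult_left_mono[rotated]) (simp add: N_def)
      also have "\<dots> = e * s" using N by simp
      finally show ?thesis .
    qed
    define \<psi> where "\<psi> t = F (z + t *\<^sub>R a + s *\<^sub>R b) a - F (z + t *\<^sub>R a) a - s *\<^sub>R P b" for t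
    have "norm (\<phi> s - \<phi> 0) \<le> e * s * norm (s - 0)"
    proof (rule differentiable_bound[where S="{0..s}" and f=\<phi> and x=s and y=0 and B="e * s" and f'="\<lambda>t r. r *\<^sub>R \<psi> t"])
      show "(\<phi> has_derivative (\<lambda>r. r *\<^sub>R \<psi> t)) (at t within {0..s})"
        if "t \<in> {0..s}" for t using der[OF that] by (simp add: has_vector_derivative_def \<psi>_def)
      show "onorm (\<lambda>r. r *\<^sub>R \<psi> t) \<le> e * s" if "t \<in> {0..s}" for t
      proof (rule onorm_bound)
        show "norm (r *\<^sub>R \<psi> t) \<le> e * s * norm r" for r :: real
          using mult_left_mono[OF bnd[OF that], of "norm r"] by (simp add: ac_simps \<psi>_def)
      qed (use e s in simp)
    qed (use s in simp_all)
    then show "norm (f (z + s *\<^sub>R a + s *\<^sub>R b) - f (z + s *\<^sub>R a) - f (z + s *\<^sub>R b) + f z - s\<^sup>2 *\<^sub>R P b) \<le> e * s\<^sup>2"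
      using s by (simp add: \<phi>_def power2_eq_square algebra_simps)
  qed
qed

text \<open>The second difference is symmetric in \<open>a\<close> and \<open>b\<close>, so both
  values approximate the same quantity. With \<open>e\<close> a third of the supposed gap, the two
  errors sum to less than the gap.\<close>

lemma second_derivatives_commute:
  fixes f :: "'a::real_normed_vector \<Rightarrow> 'b::real_normed_vector"
  assumes S: "open S" "z \<in> S"
    and f: "\<And>w. w \<in> S \<Longrightarrow> (f has_derivative F w) (at w)"
    and P: "((\<lambda>w. F w a) has_derivative P) (at z)"
    and Q: "((\<lambda>w. F w b) has_derivative Q) (at z)"
  shows "P b = Q a"
proof (rule ccontr)
  assume "P b \<noteq> Q a"
  define e where "e = norm (P b - Q a) / 3"
  have e: "e > 0" using \<open>P b \<noteq> Q a\<close> by (simp add: e_def)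
  obtain d1 where d1: "d1 > 0" "\<And>s. 0 < s \<Longrightarrow> s < d1 \<Longrightarrow>
    norm (f (z + s *\<^sub>R a + s *\<^sub>R b) - f (z + s *\<^sub>R a) - f (z + s *\<^sub>R b) + f z - s\<^sup>2 *\<^sub>R P b) \<le> e * s\<^sup>2"
    using second_difference_bound[OF S f P e, of b] by blast
  obtain d2 where d2: "d2 > 0" "\<And>s. 0 < s \<Longrightarrow> s < d2 \<Longrightarrow>
    norm (f (z + s *\<^sub>R b + s *\<^sub>R a) - f (z + s *\<^sub>R b) - f (z + s *\<^sub>R a) + f z - s\<^sup>2 *\<^sub>R Q a) \<le> e * s\<^sup>2"
    using second_difference_bound[OF S f Q e, of a] by blast
  define s where "s = min d1 d2 / 2"
  have s: "0 < s" "s < d1" "s < d2" using d1(1) d2(1) by (auto simp: s_def)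
  define X where "X = f (z + s *\<^sub>R a + s *\<^sub>R b) - f (z + s *\<^sub>R a) - f (z + s *\<^sub>R b) + f z"
  have b1: "norm (X - s\<^sup>2 *\<^sub>R P b) \<le> e * s\<^sup>2" using d1(2)[OF s(1,2)] by (simp add: X_def)
  have b2: "norm (X - s\<^sup>2 *\<^sub>R Q a) \<le> e * s\<^sup>2"
    using d2(2)[OF s(1,3)] by (simp add: X_def algebra_simps)
  have "s\<^sup>2 * norm (P b - Q a) = norm ((X - s\<^sup>2 *\<^sub>R Q a) - (X - s\<^sup>2 *\<^sub>R P b))"
    by (simp add: scaleR_diff_right[symmetric])
  also have "\<dots> \<le> e * s\<^sup>2 + e * s\<^sup>2"
    using norm_triangle_ineq4 b1 b2 by (meson add_mono order_trans)
  finally have "s\<^sup>2 * norm (P b - Q a) \<le> s\<^sup>2 * (2 * e)" by (simp add: algebra_simps)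
  then have "norm (P b - Q a) \<le> 2 * e" using s by simp
  then show False using e by (simp add: e_def)
qed

lemma partial_eq_has_derivative:
  assumes "(f has_derivative F) (at z)"
  shows "partial_x f z = F 1" "partial_y f z = F \<i>"
proof -
  have "((\<lambda>t. f (z + t *\<^sub>R 1)) has_vector_derivative F 1) (at 0)"
    using assms by (intro has_vector_derivative_line) simp
  then show "partial_x f z = F 1" unfolding partial_x_def
    by (intro vector_derivative_at) (simp add: scaleR_conv_of_real)
  have "((\<lambda>t. f (z + t *\<^sub>R \<i>)) has_vector_derivative F \<i>) (at 0)"
    using assms by (intro has_vector_derivative_line) simp
  then show "partial_y f z = F \<i>" unfolding partial_y_def
    by (intro vector_derivative_at) (simp add: scaleR_conv_of_real mult.commute)
qed

lemma has_derivative_partial: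
  assumes "f differentiable (at z)"
  shows "(f has_derivative (\<lambda>v. of_real (Re v) * partial_x f z + of_real (Im v) * partial_y f z)) (at z)"
proof -
  obtain F where F: "(f has_derivative F) (at z)" using assms unfolding differentiable_def by blast
  have l: "linear F" using F by (rule has_derivative_linear)
  have "F v = of_real (Re v) * F 1 + of_real (Im v) * F \<i>" for v
  proof -
    have "F v = F (Re v *\<^sub>R 1 + Im v *\<^sub>R \<i>)"
      by (rule arg_cong[of _ _ F]) (simp add: complex_eq_iff)
    also have "\<dots> = Re v *\<^sub>R F 1 + Im v *\<^sub>R F \<i>"
      by (simp add: linear_add[OF l] linear_cmul[OF l] del: scaleR_conv_of_real)
    finally show ?thesis by (simp add: scaleR_conv_of_real)
  qed
  then have "F = (\<lambda>v. of_real (Re v) * partial_x f z + of_real (Im v) * partial_y f z)"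
    unfolding partial_eq_has_derivative[OF F] by (intro ext)
  then show ?thesis using F by (simp only:)
qed

text \<open>Once the mixed partials commute, the Laplace equation is the Cauchy-Riemann system for
  \<open>deriv_z h\<close> and for the conjugate of \<open>deriv_zbar h\<close>. Convexity of
  \<open>S\<close> provides primitives of both.\<close>

lemma harmonic_on_decomposition:
  assumes h: "harmonic_on S h" and S: "convex S"
  obtains f g f' g' where "f holomorphic_on S" "g holomorphic_on S"
    "\<And>z. z \<in> S \<Longrightarrow> (f has_field_derivative f' z) (at z)"
    "\<And>z. z \<in> S \<Longrightarrow> (g has_field_derivative g' z) (at z)"
    "\<And>z. z \<in> S \<Longrightarrow> h z = f z + cnj (g z)"
    "\<And>z. z \<in> S \<Longrightarrow> f' z = deriv_z h z" "\<And>z. z \<in> S \<Longrightarrow> g' z = cnj (deriv_zbar h z)"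
proof -
  have op: "open S" and C1: "C1_on S h" and C1x: "C1_on S (partial_x h)" and C1y: "C1_on S (partial_y h)"
    and lap: "\<And>z. z \<in> S \<Longrightarrow> partial_x (partial_x h) z + partial_y (partial_y h) z = 0"
    using h unfolding harmonic_on_def by auto
  define H where "H w v = of_real (Re v) * partial_x h w + of_real (Im v) * partial_y h w" for w v
  have dh: "(h has_derivative H z) (at z)" if "z \<in> S" for z
    using has_derivative_partial[of h z] that C1 unfolding C1_on_def H_def by blast
  define X where "X z v = of_real (Re v) * partial_x (partial_x h) z + of_real (Im v) * partial_y (partial_x h) z" for z v
  have dx: "(partial_x h has_derivative X z) (at z)" if "z \<in> S" for z
    using has_derivative_partial[of "partial_x h" z] that C1x unfolding C1_on_def X_def by blast
  define Y where "Y z v = of_real (Re v) * partial_x (partial_y h) z + of_real (Im v) * partial_y (partial_y h) z" for z v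
  have dy: "(partial_y h has_derivative Y z) (at z)" if "z \<in> S" for z
    using has_derivative_partial[of "partial_y h" z] that C1y unfolding C1_on_def Y_def by blast
  have sym: "partial_y (partial_x h) z = partial_x (partial_y h) z" if z: "z \<in> S" for z
  proof -
    have "X z \<i> = Y z 1"
    proof (rule second_derivatives_commute[where f=h and F=H and a=1 and b=\<i> and P="X z" and Q="Y z", OF op z dh])
      show "((\<lambda>w. H w 1) has_derivative X z) (at z)" using dx[OF z] by (simp add: H_def)
      show "((\<lambda>w. H w \<i>) has_derivative Y z) (at z)" using dy[OF z] by (simp add: H_def)
    qed
    then show ?thesis by (simp add: X_def Y_def)
  qed
  have lap': "partial_y (partial_y h) z = - partial_x (partial_x h) z" if "z \<in> S" for z
    using lap[OF that] by (simp add: eq_neg_iff_add_eq_0 add.commute)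
  define f' where "f' = deriv_z h"
  define g' where "g' z = cnj (deriv_zbar h z)" for z
  have df': "(f' has_field_derivative (partial_x (partial_x h) z - \<i> * partial_x (partial_y h) z) / 2) (at z)"
    if z: "z \<in> S" for z
  proof -
    have "(f' has_derivative (\<lambda>v. (X z v - \<i> * Y z v) / 2)) (at z)"
      unfolding f'_def deriv_z_def[abs_def]
      by (intro bounded_linear.has_derivative[OF bounded_linear_divide] has_derivative_diff
          bounded_linear.has_derivative[OF bounded_linear_mult_right] dx dy z)
    moreover have "(\<lambda>v. (X z v - \<i> * Y z v) / 2) = (*) ((partial_x (partial_x h) z - \<i> * partial_x (partial_y h) z) / 2)"
    proof
      fix v :: complex
      obtain a b where v: "v = Complex a b" by (cases v)
      show "(X z v - \<i> * Y z v) / 2 = (partial_x (partial_x h) z - \<i> * partial_x (partial_y h) z) / 2 * v"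
        by (simp add: v X_def Y_def sym[OF z] lap'[OF z] Complex_eq algebra_simps)
    qed
    ultimately show ?thesis by (simp only: has_field_derivative_def)
  qed
  have dg': "(g' has_field_derivative cnj ((partial_x (partial_x h) z + \<i> * partial_x (partial_y h) z) / 2)) (at z)"
    if z: "z \<in> S" for z
  proof -
    have "(g' has_derivative (\<lambda>v. cnj ((X z v + \<i> * Y z v) / 2))) (at z)"
      unfolding g'_def[abs_def] deriv_zbar_def[abs_def]
      by (intro bounded_linear.has_derivative[OF bounded_linear_cnj] bounded_linear.has_derivative[OF bounded_linear_divide] has_derivative_add
          bounded_linear.has_derivative[OF bounded_linear_mult_right] dx dy z)
    moreover have "(\<lambda>v. cnj ((X z v + \<i> * Y z v) / 2)) = (*) (cnj ((partial_x (partial_x h) z + \<i> * partial_x (partial_y h) z) / 2))"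
    proof
      fix v :: complex
      obtain a b where v: "v = Complex a b" by (cases v)
      show "cnj ((X z v + \<i> * Y z v) / 2) = cnj ((partial_x (partial_x h) z + \<i> * partial_x (partial_y h) z) / 2) * v"
        by (simp add: v X_def Y_def sym[OF z] lap'[OF z] Complex_eq algebra_simps)
    qed
    ultimately show ?thesis by (simp only: has_field_derivative_def)
  qed
  have hol: "f' holomorphic_on S" "g' holomorphic_on S"
    unfolding holomorphic_on_open[OF op] using df' dg' by blast+
  obtain f0 where f0: "\<And>z. z \<in> S \<Longrightarrow> (f0 has_field_derivative f' z) (at z within S)"
    using holomorphic_convex_primitive'[OF S op hol(1)] by blast
  obtain g where g: "\<And>z. z \<in> S \<Longrightarrow> (g has_field_derivative g' z) (at z within S)"
    using holomorphic_convex_primitive'[OF S op hol(2)] by blast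
  have f0': "(f0 has_field_derivative f' z) (at z)" if "z \<in> S" for z
    using f0[OF that] unfolding at_within_open[OF that op] .
  have g0': "(g has_field_derivative g' z) (at z)" if "z \<in> S" for z
    using g[OF that] unfolding at_within_open[OF that op] .
  \<comment> \<open>The differential of \<open>h\<close> is
    \<open>deriv_z h * v + deriv_zbar h * cnj v\<close>, which the two primitives reproduce; the
    remaining constant is absorbed into \<open>f\<close>.\<close>
  have "\<exists>c. \<forall>z\<in>S. h z - f0 z - cnj (g z) = c"
  proof (rule has_derivative_zero_constant[OF S])
    fix z assume z: "z \<in> S"
    have "((\<lambda>z. h z - f0 z - cnj (g z)) has_derivative (\<lambda>v. H z v - f' z * v - cnj (g' z * v))) (at z)"
      by (intro has_derivative_diff has_derivative_cnj dh z f0'[unfolded has_field_derivative_def] g0'[unfolded has_field_derivative_def])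
    moreover have "H z v - f' z * v - cnj (g' z * v) = 0" for v
    proof -
      obtain a b where v: "v = Complex a b" by (cases v)
      show ?thesis
        by (simp add: v H_def f'_def g'_def deriv_z_def deriv_zbar_def Complex_eq field_simps)
    qed
    ultimately have "((\<lambda>z. h z - f0 z - cnj (g z)) has_derivative (\<lambda>v. 0)) (at z)"
      by simp
    then show "((\<lambda>z. h z - f0 z - cnj (g z)) has_derivative (\<lambda>v. 0)) (at z within S)"
      by (rule has_derivative_at_withinI)
  qed
  then obtain c where c: "\<And>z. z \<in> S \<Longrightarrow> h z - f0 z - cnj (g z) = c" by blast
  define f where "f z = f0 z + c" for z
  have df: "(f has_field_derivative f' z) (at z)" if "z \<in> S" for z
    using DERIV_add[OF f0'[OF that] DERIV_const[of c]] by (simp add: f_def[abs_def])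
  show thesis
  proof (rule that[of f g f' g'])
    show "f holomorphic_on S" "g holomorphic_on S" 
      unfolding holomorphic_on_open[OF op] using df g0' by blast+
    show "h z = f z + cnj (g z)" if "z \<in> S" for z using c[OF that] by (simp add: f_def algebra_simps)
  qed (use df g0' in \<open>simp_all add: f'_def g'_def\<close>)
qed

text \<open>The exceptional set is open, and an open null set is empty. This makes the almost
  everywhere dilatation condition valid at every point.\<close>

lemma AE_lebesgue_imp_everywhere_le:
  fixes u v :: "'a::euclidean_space \<Rightarrow> real"
  assumes S: "open S" and u: "continuous_on S u" and v: "continuous_on S v"
    and ae: "AE z in lebesgue. z \<in> S \<longrightarrow> u z \<le> v z" and z: "z \<in> S"
  shows "u z \<le> v z"
proof (rule ccontr)
  assume less: "\<not> u z \<le> v z"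
  define E where "E = {z \<in> S. v z < u z}"
  obtain A where "open A" "A \<inter> S = E"
    using open_Collect_less_Int[OF v u] by (auto simp: E_def)
  then have "open E" using S by blast
  have "AE z in lebesgue. z \<notin> E"
    using ae by eventually_elim (auto simp: E_def)
  then have "E \<in> null_sets lebesgue"
    using \<open>open E\<close> by (subst AE_iff_null_sets) auto
  then show False
    using open_not_negligible[OF \<open>open E\<close>] less z
    by (metis (mono_tags, lifting) E_def empty_iff mem_Collect_eq negligible_iff_null_sets not_le)
qed

section \<open>Boundary regularity of Lyapunov domains\<close>

text \<open>Inserting \<open>a\<close> into a partition, through \<open>min a\<close> and
  \<open>max a\<close>, splits its sum into a part bounded by the length up to \<open>a\<close> and
  a part bounded by the Lipschitz constant \<open>q\<close>.\<close>

lemma curve_length_le_insert: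
  assumes ab: "0 \<le> a" "a \<le> b" and q: "0 \<le> q"
    and len: "curve_length g 0 a = ennreal a"
    and lip: "\<And>x y. a \<le> x \<Longrightarrow> x \<le> y \<Longrightarrow> y \<le> b \<Longrightarrow> dist (g x) (g y) \<le> q * (y - x)"
  shows "curve_length g 0 b \<le> ennreal (a + q * (b - a))"
  unfolding curve_length_def
proof (rule SUP_least)
  fix np :: "nat \<times> (nat \<Rightarrow> real)"
  assume np: "np \<in> {(n, p). mono_on {..n} p \<and> p 0 = 0 \<and> p n = b}"
  obtain n p where np_eq: "np = (n, p)" by (cases np)
  have mono: "mono_on {..n} p" and p0: "0 = p 0" and pn: "b = p n" using np np_eq by auto
  have pin: "p 0 \<le> p i" "p i \<le> p n" if "i \<le> n" for i
    using that by (auto intro!: mono_onD[OF mono])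
  have step: "dist (g (p i)) (g (p (Suc i)))
      \<le> dist (g (min a (p i))) (g (min a (p (Suc i)))) + q * (max a (p (Suc i)) - max a (p i))"
    if i: "i < n" for i
  proof -
    have xy: "p i \<le> p (Suc i)" using i by (intro mono_onD[OF mono]) auto
    have yb: "p (Suc i) \<le> b" using pin(2)[of "Suc i"] i pn by simp
    consider "p (Suc i) \<le> a" | "a \<le> p i" | "p i \<le> a" "a \<le> p (Suc i)" by linarith
    then show ?thesis
    proof cases
      case 1
      then show ?thesis using xy by (simp add: min_absorb2 max_absorb1)
    next
      case 2
      then show ?thesis using xy yb lip[of "p i" "p (Suc i)"] by (simp add: min_absorb1 max_absorb2)
    next
      case 3
      then show ?thesis using dist_triangle[of "g (p i)" "g (p (Suc i))" "g a"] lip[of a "p (Suc i)"] yb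
        by (simp add: min_absorb1 min_absorb2 max_absorb1 max_absorb2)
    qed
  qed
  have "ennreal (\<Sum>i<n. dist (g (min a (p i))) (g (min a (p (Suc i))))) \<le> curve_length g 0 a"
    unfolding curve_length_def
  proof (rule SUP_upper2[of "(n, \<lambda>i. min a (p i))"])
    show "(n, \<lambda>i. min a (p i)) \<in> {(n, p). mono_on {..n} p \<and> p 0 = 0 \<and> p n = a}"
      using mono p0 pn ab by (auto simp: mono_on_def min_le_iff_disj)
  qed simp
  then have s1: "(\<Sum>i<n. dist (g (min a (p i))) (g (min a (p (Suc i))))) \<le> a"
    using len ab by (simp add: sum_nonneg)
  have "(\<Sum>i<n. q * (max a (p (Suc i)) - max a (p i))) = q * (max a (p n) - max a (p 0))"
    by (simp add: sum_distrib_left[symmetric] sum_lessThan_telescope[of "\<lambda>i. max a (p i)" n])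
  also have "\<dots> = q * (b - a)" using ab p0[symmetric] pn[symmetric] by (simp add: max_absorb1 max_absorb2)
  finally have s2: "(\<Sum>i<n. q * (max a (p (Suc i)) - max a (p i))) = q * (b - a)" .
  have "(\<Sum>i<n. dist (g (p i)) (g (p (Suc i))))
      \<le> (\<Sum>i<n. dist (g (min a (p i))) (g (min a (p (Suc i)))) + q * (max a (p (Suc i)) - max a (p i)))"
    by (rule sum_mono) (use step in simp)
  also have "\<dots> \<le> a + q * (b - a)" using s1 s2 by (simp add: sum.distrib)
  finally show "(case np of (n, p) \<Rightarrow> ennreal (\<Sum>i<n. dist (g (p i)) (g (p (Suc i))))) \<le> ennreal (a + q * (b - a))"
    by (simp add: np_eq ennreal_leI)
qed

text \<open>Near a zero of \<open>g'\<close> the speed is at most 1/2, and \<open>g\<close> would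
  gather too little length there to be parametrized by arc length.\<close>

lemma arc_length_parametrization_deriv_nonzero:
  assumes l: "0 < l" and arc: "arc_length_parametrization l g"
    and g': "\<And>t. t \<in> {0..l} \<Longrightarrow> (g has_vector_derivative g' t) (at t within {0..l})"
    and cont: "continuous_on {0..l} g'" and t: "t \<in> {0..l}"
  shows "g' t \<noteq> 0"
proof
  assume zero: "g' t = 0"
  obtain d where d: "d > 0" "\<And>s. s \<in> {0..l} \<Longrightarrow> dist s t < d \<Longrightarrow> dist (g' s) (g' t) < 1/2"
    using cont t unfolding continuous_on_iff by (metis half_gt_zero_iff zero_less_one)
  define a where "a = max 0 (t - d/2)"
  define b where "b = min l (t + d/2)"
  have ab: "0 \<le> a" "a < b" "b \<le> l" using d(1) t l by (auto simp: a_def b_def)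
  have sub: "{a..b} \<subseteq> {0..l}" using ab by auto
  have small: "norm (g' s) \<le> 1/2" if "s \<in> {a..b}" for s
  proof -
    have "dist s t < d" using that d(1) by (auto simp: a_def b_def dist_real_def)
    then show ?thesis using d(2)[of s] that sub zero by (auto simp: subset_iff)
  qed
  have "curve_length g 0 b \<le> ennreal (a + 1/2 * (b - a))"
  proof (rule curve_length_le_insert)
    show "curve_length g 0 a = ennreal a" using arc ab by (auto simp: arc_length_parametrization_def)
    fix x y assume xy: "a \<le> x" "x \<le> y" "y \<le> b"
    have "norm (g y - g x) \<le> 1/2 * norm (y - x)"
    proof (rule differentiable_bound[where S="{a..b}" and f=g and f'="\<lambda>s r. r *\<^sub>R g' s"])
      show "(g has_derivative (\<lambda>r. r *\<^sub>R g' s)) (at s within {a..b})" if "s \<in> {a..b}" for s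
        using has_derivative_subset[OF g'[of s, unfolded has_vector_derivative_def] sub] that sub by blast
      show "onorm (\<lambda>r. r *\<^sub>R g' s) \<le> 1/2" if "s \<in> {a..b}" for s
      proof (rule onorm_bound)
        show "norm (r *\<^sub>R g' s) \<le> 1/2 * norm r" for r :: real
          using mult_left_mono[OF small[OF that], of "norm r"] by (simp add: ac_simps)
      qed simp
    qed (use xy in auto)
    then show "dist (g x) (g y) \<le> 1/2 * (y - x)" using xy by (simp add: dist_norm norm_minus_commute)
  qed (use ab in auto)
  moreover have "curve_length g 0 b = ennreal b" using arc ab by (auto simp: arc_length_parametrization_def)
  ultimately have "ennreal b \<le> ennreal (a + 1/2 * (b - a))" by metis
  then have "b \<le> a + 1/2 * (b - a)" by (subst (asm) ennreal_le_iff) (use ab in auto)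
  then show False using ab by (simp add: field_simps)
qed

text \<open>\<open>n\<close> plays the role of the inner unit normal of \<open>D\<close> at the boundary point \<open>p\<close>. The first bound is global:
  away from \<open>p\<close> it holds trivially once \<open>M \<ge> r powr - \<mu>\<close>.\<close>

definition Holder_flat :: "real \<Rightarrow> real \<Rightarrow> real \<Rightarrow> complex set \<Rightarrow> complex \<Rightarrow> complex \<Rightarrow> bool" where
  "Holder_flat \<mu> M r D p n \<longleftrightarrow> norm n = 1 \<and>
     (\<forall>w\<in>D. - M * norm (w - p) powr (1 + \<mu>) \<le> Re (cnj n * (w - p))) \<and>
     (\<forall>w. norm (w - p) < r \<and> M * norm (w - p) powr (1 + \<mu>) < Re (cnj n * (w - p)) \<longrightarrow> w \<in> D)"

section \<open>Cusps on the two sides of the boundary\<close>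

lemma powr_convex_comb:
  fixes a b u v q :: real
  assumes "0 \<le> a" "0 \<le> b" "0 \<le> u" "0 \<le> v" "u + v = 1" "1 \<le> q"
  shows "(u * a + v * b) powr q \<le> u * a powr q + v * b powr q"
proof (cases "a = 0 \<or> b = 0")
  case False
  then show ?thesis
    using convex_onD[OF powr_convex[OF \<open>1 \<le> q\<close>], of v a b] assms by (simp add: eq_diff_eq[symmetric])
next
  case True
  have *: "(w * c) powr q \<le> w * c powr q" if "0 \<le> w" "w \<le> 1" "0 \<le> c" for w c :: real
  proof -
    have "w powr q \<le> w powr 1" if "w > 0"
      using \<open>w \<le> 1\<close> that assms(6) by (simp add: powr_le_one_le)
    then have "w powr q \<le> w" using \<open>0 \<le> w\<close> by (cases "w = 0") auto
    then show ?thesis using that by (simp add: powr_mult mult_right_mono)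
  qed
  show ?thesis using True *[of v b] *[of u a] assms by auto
qed

text \<open>The power 1 + \<mu> of a norm is convex. What matters is connectedness: a cusp that
  misses \<open>frontier D\<close> lies in \<open>D\<close> or off \<open>closure D\<close>.\<close>

lemma convex_cusp_region:
  fixes n p :: complex
  assumes "M \<ge> 0" "\<mu> \<ge> 0"
  shows "convex {w. norm (w - p) < r \<and> M * norm (w - p) powr (1 + \<mu>) < Re (cnj n * (w - p))}"
proof (rule convexI)
  fix x y :: complex and u v :: real
  assume x: "x \<in> {w. norm (w - p) < r \<and> M * norm (w - p) powr (1 + \<mu>) < Re (cnj n * (w - p))}"
    and y: "y \<in> {w. norm (w - p) < r \<and> M * norm (w - p) powr (1 + \<mu>) < Re (cnj n * (w - p))}"
    and uv: "0 \<le> u" "0 \<le> v" "u + v = 1"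
  define N where "N = (u *\<^sub>R x + v *\<^sub>R y) - p"
  have N: "N = u *\<^sub>R (x - p) + v *\<^sub>R (y - p)"
  proof -
    have "p = (u + v) *\<^sub>R p" using uv by simp
    then show ?thesis unfolding N_def by (simp add: algebra_simps del: scaleR_conv_of_real)
  qed
  have nN: "norm N \<le> u * norm (x - p) + v * norm (y - p)"
    unfolding N using norm_triangle_ineq[of "u *\<^sub>R (x - p)" "v *\<^sub>R (y - p)"] uv by simp
  have 1: "norm N < r"
    using convex_bound_lt[of "norm (x-p)" r "norm (y-p)" u v] x y uv nN by auto
  have "norm N powr (1 + \<mu>) \<le> (u * norm (x - p) + v * norm (y - p)) powr (1 + \<mu>)"
    using nN assms by (intro powr_mono2) auto
  also have "\<dots> \<le> u * norm (x - p) powr (1 + \<mu>) + v * norm (y - p) powr (1 + \<mu>)"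
    using assms uv by (intro powr_convex_comb) auto
  finally have "M * norm N powr (1 + \<mu>) \<le> u * (M * norm (x - p) powr (1 + \<mu>)) + v * (M * norm (y - p) powr (1 + \<mu>))"
    using mult_left_mono[OF _ assms(1)] by (fastforce simp: algebra_simps)
  also have "\<dots> < u * Re (cnj n * (x - p)) + v * Re (cnj n * (y - p))"
  proof (cases "u = 0")
    case True
    then show ?thesis using y uv by simp
  next
    case False
    then show ?thesis using x y uv
      by (intro add_less_le_mono mult_strict_left_mono mult_left_mono) auto
  qed
  also have "\<dots> = Re (cnj n * N)" unfolding N by (simp add: algebra_simps)
  finally show "u *\<^sub>R x + v *\<^sub>R y \<in> {w. norm (w - p) < r \<and> M * norm (w - p) powr (1 + \<mu>) < Re (cnj n * (w - p))}"
    using 1 by (simp add: N_def)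
qed

lemma connected_disjoint_frontier:
  assumes "connected C" "C \<inter> frontier D = {}" "C \<inter> D \<noteq> {}"
  shows "C \<subseteq> D"
  using connected_Int_frontier[OF assms(1,3)] assms(2) by blast

text \<open>The two opposite cusps at \<open>p\<close> miss \<open>frontier D\<close> by
  \<open>flat\<close>, so each is inside or outside. Points of \<open>D\<close> and points off
  \<open>closure D\<close> both occur arbitrarily near \<open>p\<close>, and both can be pushed into
  a cusp without crossing the boundary. Hence one cusp is inside, the other outside, and the axis of
  the former is \<open>n\<close>.\<close>

lemma Holder_flat_if_graph:
  fixes \<tau> :: complex
  assumes D: "open D" and \<mu>: "0 < \<mu>" and M: "M \<ge> 0" and r: "0 < r" and Mr: "M * r powr \<mu> \<le> 1/4"
    and p: "p \<in> frontier D" and \<tau>: "norm \<tau> = 1"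
    and flat: "\<And>w. w \<in> frontier D \<Longrightarrow> norm (w - p) < r \<Longrightarrow> \<bar>Re (cnj (\<i> * \<tau>) * (w - p))\<bar> \<le> M * norm (w - p) powr (1 + \<mu>)"
    and graph: "\<And>w1 w2. w1 \<in> frontier D \<Longrightarrow> w2 \<in> frontier D \<Longrightarrow> norm (w1 - p) < r \<Longrightarrow> norm (w2 - p) < r
        \<Longrightarrow> Re (cnj \<tau> * (w1 - w2)) = 0 \<Longrightarrow> w1 = w2"
    and out: "\<And>e. e > 0 \<Longrightarrow> \<exists>w. norm (w - p) < e \<and> w \<notin> closure D"
  shows "\<exists>n. Holder_flat \<mu> (max M (r powr - \<mu>)) r D p n"
proof -
  define R where "R n = {w. norm (w - p) < r \<and> M * norm (w - p) powr (1 + \<mu>) < Re (cnj n * (w - p))}" for n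
  define n0 where "n0 = \<i> * \<tau>"
  have n0: "norm n0 = 1" using \<tau> by (simp add: n0_def norm_mult)
  have dich: "R n \<subseteq> D \<or> R n \<inter> closure D = {}" if n: "n = n0 \<or> n = - n0" for n
  proof -
    have conn: "connected (R n)" unfolding R_def
      using convex_cusp_region[of M \<mu>] M \<mu> by (intro convex_connected) auto
    have disj: "R n \<inter> frontier D = {}"
      using flat n by (force simp: R_def n0_def)
    show ?thesis
    proof (cases "R n \<inter> D = {}")
      case True
      then show ?thesis using disj D by (auto simp: frontier_def interior_open)
    next
      case False
      then show ?thesis using connected_disjoint_frontier[OF conn disj] by blast
    qed
  qed
  \<comment> \<open>If the segments from \<open>w\<close> in both normal directions met the
    boundary, the two hits would lie on one normal line and agree by \<open>graph\<close>, so
    \<open>w\<close> itself would be a boundary point. Length \<open>r / 2\<close> lifts the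
    endpoint to height at least \<open>3 r / 8\<close>, which exceeds
    \<open>M r^(1 + \<mu>) \<le> r / 4\<close>.\<close>
  have reach: "\<exists>n\<in>{n0, -n0}. \<exists>S. connected S \<and> w \<in> S \<and> S \<inter> frontier D = {} \<and> S \<inter> R n \<noteq> {}"
    if w: "w \<notin> frontier D" "norm (w - p) < r / 8" for w
  proof -
    define S where "S n = closed_segment w (w + (r / 2) *\<^sub>R n)" for n
    have inS: "\<exists>t. 0 \<le> t \<and> t \<le> r / 2 \<and> q = w + t *\<^sub>R n" if "q \<in> S n" for q n
    proof -
      obtain u where u: "0 \<le> u" "u \<le> 1" "q = (1 - u) *\<^sub>R w + u *\<^sub>R (w + (r / 2) *\<^sub>R n)"
        using \<open>q \<in> S n\<close> unfolding S_def closed_segment_def by blast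
      then show ?thesis using r
        by (intro exI[of _ "u * (r/2)"]) (auto simp: scaleR_add_right scaleR_diff_left mult_left_le_one_le)
    qed
    have near: "norm (w + t *\<^sub>R n - p) < r" if "\<bar>t\<bar> \<le> r / 2" "norm n = 1" for t n
      using norm_triangle_ineq[of "w - p" "t *\<^sub>R n"] that w(2) by (simp add: algebra_simps)
    have "S n0 \<inter> frontier D = {} \<or> S (-n0) \<inter> frontier D = {}"
    proof (rule ccontr)
      assume "\<not> ?thesis"
      then obtain q1 q2 where q: "q1 \<in> S n0" "q1 \<in> frontier D" "q2 \<in> S (-n0)" "q2 \<in> frontier D" by blast
      obtain t1 where t1: "0 \<le> t1" "t1 \<le> r/2" "q1 = w + t1 *\<^sub>R n0" using inS[OF q(1)] by blast
      obtain t2 where t2: "0 \<le> t2" "t2 \<le> r/2" "q2 = w + t2 *\<^sub>R (-n0)" using inS[OF q(3)] by blast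
      have "cnj \<tau> * n0 = \<i>" unfolding n0_def using \<tau> complex_norm_square[of \<tau>] by (simp add: mult.commute)
      then have "Re (cnj \<tau> * (q1 - q2)) = 0"
      proof -
        have "cnj \<tau> * (q1 - q2) = of_real (t1 + t2) * (cnj \<tau> * n0)"
          by (simp add: t1(3) t2(3) scaleR_conv_of_real algebra_simps)
        also have "\<dots> = of_real (t1 + t2) * \<i>" using \<open>cnj \<tau> * n0 = \<i>\<close> by simp
        finally show ?thesis by simp
      qed
      then have "q1 = q2"
        using graph[OF q(2,4)] near[of t1 n0] near[of t2 "-n0"] t1 t2 n0 by auto
      then have "(t1 + t2) *\<^sub>R n0 = 0" using t1(3) t2(3) by (simp add: algebra_simps)
      then have "t1 = 0" using n0 t1(1) t2(1) by auto
      then show False using t1(3) q(2) w(1) by simp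
    qed
    then obtain n where n: "n = n0 \<or> n = -n0" "S n \<inter> frontier D = {}" by blast
    have nn: "norm n = 1" using n(1) n0 by auto
    define e where "e = w + (r / 2) *\<^sub>R n"
    have e1: "norm (e - p) < r" using near[of "r/2" n] r nn by (simp add: e_def)
    have "norm (e - p) powr (1 + \<mu>) \<le> r powr (1 + \<mu>)" using e1 \<mu> by (intro powr_mono2) auto
    then have "M * norm (e - p) powr (1 + \<mu>) \<le> M * r powr (1 + \<mu>)" using M by (rule mult_left_mono)
    also have "\<dots> = r * (M * r powr \<mu>)" using r by (simp add: powr_add)
    also have "\<dots> \<le> r * (1/4)" using Mr r by (intro mult_left_mono) auto
    also have "\<dots> < r / 2 - r / 8" using r by simp
    also have "\<dots> < Re (cnj n * (e - p))"
    proof -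
      have "cnj n * n = 1" using nn complex_norm_square[of n] by (simp add: mult.commute)
      then have "cnj n * (e - p) = cnj n * (w - p) + of_real (r/2)"
        by (simp add: e_def scaleR_conv_of_real algebra_simps)
      moreover have "\<bar>Re (cnj n * (w - p))\<bar> \<le> norm (w - p)"
        using abs_Re_le_cmod[of "cnj n * (w - p)"] nn by (simp add: norm_mult)
      ultimately show ?thesis using w(2) by simp
    qed
    finally have "e \<in> R n" using e1 by (simp add: R_def)
    then have "S n \<inter> R n \<noteq> {}" by (auto simp: S_def e_def)
    moreover have "w \<in> S n" "connected (S n)" by (auto simp: S_def)
    ultimately show ?thesis using n by blast
  qed
  have "p \<in> closure D" using p by (simp add: frontier_def)
  then obtain w where w: "w \<in> D" "norm (w - p) < r / 8"
    using r unfolding closure_approachable by (metis dist_norm divide_pos_pos zero_less_numeral)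
  have "w \<notin> frontier D" using w D by (auto simp: frontier_def interior_open)
  then obtain n S where nS: "n = n0 \<or> n = - n0" "connected S" "w \<in> S" "S \<inter> frontier D = {}" "S \<inter> R n \<noteq> {}"
    using reach[of w] w by blast
  have "S \<subseteq> D" using connected_disjoint_frontier[OF nS(2,4)] nS(3) w(1) by blast
  then have RD: "R n \<subseteq> D" using dich[OF nS(1)] nS(5) closure_subset by blast
  obtain v where v: "v \<notin> closure D" "norm (v - p) < r / 8" using out[of "r/8"] r by auto
  have "v \<notin> frontier D" using v by (auto simp: frontier_def)
  then obtain m T where mT: "m = n0 \<or> m = - n0" "connected T" "v \<in> T" "T \<inter> frontier D = {}" "T \<inter> R m \<noteq> {}"
    using reach[of v] v by blast
  have "T \<inter> D = {}"
    using connected_disjoint_frontier[OF mT(2,4)] mT(3) v(1) closure_subset by blast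
  then have Rm: "R m \<inter> closure D = {}" using dich[OF mT(1)] mT(5) by blast
  have "R n \<noteq> {}" "n \<noteq> m" using RD Rm nS(5) closure_subset by blast+
  then have mn: "m = - n" using nS(1) mT(1) by auto
  have nn: "norm n = 1" using nS(1) n0 by auto
  have "Holder_flat \<mu> (max M (r powr - \<mu>)) r D p n"
    unfolding Holder_flat_def
  proof (intro conjI ballI allI impI nn)
    fix x assume x: "x \<in> D"
    have Re_le: "\<bar>Re (cnj n * (x - p))\<bar> \<le> norm (x - p)"
      using abs_Re_le_cmod[of "cnj n * (x - p)"] nn by (simp add: norm_mult)
    show "- max M (r powr - \<mu>) * norm (x - p) powr (1 + \<mu>) \<le> Re (cnj n * (x - p))"
    proof (cases "norm (x - p) < r")
      case True
      have "x \<notin> R m" using Rm x closure_subset by blast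
      then have "- (M * norm (x - p) powr (1 + \<mu>)) \<le> Re (cnj n * (x - p))"
        using True by (simp add: R_def mn not_less)
      moreover have "M * norm (x - p) powr (1 + \<mu>) \<le> max M (r powr - \<mu>) * norm (x - p) powr (1 + \<mu>)"
        by (intro mult_right_mono) auto
      ultimately show ?thesis by simp
    next
      case False
      then have pos: "norm (x - p) > 0" using r by linarith
      have "norm (x - p) = norm (x - p) powr (- \<mu>) * norm (x - p) powr (1 + \<mu>)"
        using pos by (simp flip: powr_add)
      also have "\<dots> \<le> max M (r powr - \<mu>) * norm (x - p) powr (1 + \<mu>)"
        using False r \<mu> powr_mono2'[of "-\<mu>" r "norm (x - p)"] by (intro mult_right_mono) auto
      finally show ?thesis using Re_le by linarith
    qed
  next
    fix x assume x: "norm (x - p) < r \<and> max M (r powr - \<mu>) * norm (x - p) powr (1 + \<mu>) < Re (cnj n * (x - p))"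
    have "M * norm (x - p) powr (1 + \<mu>) \<le> max M (r powr - \<mu>) * norm (x - p) powr (1 + \<mu>)"
      by (intro mult_right_mono) auto
    then have "x \<in> R n" using x by (simp add: R_def)
    then show "x \<in> D" using RD by blast
  qed
  then show ?thesis by blast
qed

section \<open>First-order expansion of the closed curve\<close>

lemma Holder_linear_approx:
  fixes g g' :: "real \<Rightarrow> complex"
  assumes g': "\<And>t. t \<in> {0..l} \<Longrightarrow> (g has_vector_derivative g' t) (at t within {0..l})"
    and holder: "\<And>s t. s \<in> {0..l} \<Longrightarrow> t \<in> {0..l} \<Longrightarrow> norm (g' t - g' s) \<le> C * \<bar>t - s\<bar> powr \<mu>"
    and C: "0 \<le> C" and \<mu>: "0 < \<mu>" and u: "u \<in> {0..l}" and v: "v \<in> {0..l}"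
  shows "norm (g v - g u - (v - u) *\<^sub>R g' u) \<le> C * \<bar>v - u\<bar> powr (1 + \<mu>)"
proof -
  have sub: "closed_segment u v \<subseteq> {0..l}" using u v by (auto simp: closed_segment_eq_real_ivl split: if_splits)
  have "norm (g v - g u - (v - u) *\<^sub>R g' u) \<le> norm (v - u) * (C * \<bar>v - u\<bar> powr \<mu>)"
  proof (rule vector_differentiable_bound_linearization[where S="closed_segment u v"])
    show "(g has_vector_derivative g' x) (at x within closed_segment u v)" if "x \<in> closed_segment u v" for x
      using has_vector_derivative_within_subset[OF g'[of x] sub] that sub by blast
    show "norm (g' x - g' u) \<le> C * \<bar>v - u\<bar> powr \<mu>" if x: "x \<in> closed_segment u v" for x
    proof -
      have "norm (g' x - g' u) \<le> C * \<bar>x - u\<bar> powr \<mu>" using holder[of u x] u x sub by blast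
      also have "\<dots> \<le> C * \<bar>v - u\<bar> powr \<mu>"
        using x C \<mu> by (intro mult_left_mono powr_mono2) (auto simp: closed_segment_eq_real_ivl split: if_splits)
      finally show ?thesis .
    qed
  qed auto
  also have "\<dots> = C * \<bar>v - u\<bar> powr (1 + \<mu>)"
    by (cases "v = u") (simp_all add: powr_add)
  finally show ?thesis .
qed

text \<open>Agreement of \<open>g\<close> and \<open>g'\<close> at both ends carries the estimates
  across the closing point, so that no boundary point is special later. The two estimates serve in
  place of a derivative statement for \<open>G\<close>.\<close>

lemma periodic_Holder_extension:
  fixes g g' :: "real \<Rightarrow> complex"
  assumes g': "\<And>t. t \<in> {0..l} \<Longrightarrow> (g has_vector_derivative g' t) (at t within {0..l})"
    and holder: "\<And>s t. s \<in> {0..l} \<Longrightarrow> t \<in> {0..l} \<Longrightarrow> norm (g' t - g' s) \<le> C * \<bar>t - s\<bar> powr \<mu>"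
    and C: "0 \<le> C" and \<mu>: "0 < \<mu>" and l: "0 < l" and closed: "g l = g 0" "g' l = g' 0"
  obtains G G' where "\<And>t. t \<in> {0..l} \<Longrightarrow> G t = g t" "\<And>t. t \<in> {0..l} \<Longrightarrow> G' t = g' t"
    "\<And>t k. G (t + l * of_int k) = G t" "\<And>t. G t \<in> g ` {0..l}"
    "\<And>u v. \<bar>v - u\<bar> \<le> l \<Longrightarrow> norm (G' v - G' u) \<le> 2 * C * \<bar>v - u\<bar> powr \<mu>"
    "\<And>u v. \<bar>v - u\<bar> \<le> l \<Longrightarrow> norm (G v - G u - (v - u) *\<^sub>R G' u) \<le> 5 * C * \<bar>v - u\<bar> powr (1 + \<mu>)"
proof -
  define G where "G t = g (l * frac (t / l))" for t
  define G' where "G' t = g' (l * frac (t / l))" for t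
  have per: "l * frac ((t + l * of_int k) / l) = l * frac (t / l)" for t and k :: int
    using l by (simp add: add_divide_distrib frac_def)
  have G_eq: "G t = g t" "G' t = g' t" if t: "t \<in> {0..l}" for t
  proof -
    have "G t = g t \<and> G' t = g' t"
    proof (cases "t = l")
      case True
      then show ?thesis using closed l by (simp add: G_def G'_def)
    next
      case False
      then have "frac (t / l) = t / l" using t l by (simp add: frac_eq)
      then show ?thesis using l by (simp add: G_def G'_def)
    qed
    then show "G t = g t" "G' t = g' t" by auto
  qed
  note lin = Holder_linear_approx[OF g' holder C \<mu>]
  have ordered: "norm (G' v - G' u) \<le> 2 * C * (v - u) powr \<mu> \<and>
      norm (G v - G u - (v - u) *\<^sub>R G' u) \<le> 3 * C * (v - u) powr (1 + \<mu>)"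
    if uv: "u \<le> v" "v \<le> u + l" for u v
  proof -
    \<comment> \<open>Whole periods move \<open>u\<close> into \<open>[0, l)\<close>; the shifted
      \<open>v\<close> then stays below \<open>2 l\<close> and crosses the closing point at most
      once.\<close>
    define k where "k = - \<lfloor>u / l\<rfloor>"
    define u0 where "u0 = u + l * of_int k"
    define v0 where "v0 = v + l * of_int k"
    have u0: "0 \<le> u0" "u0 < l"
    proof -
      have "u0 = l * frac (u / l)" using l by (simp add: u0_def k_def frac_def field_simps)
      then show "0 \<le> u0" "u0 < l" using l frac_lt_1[of "u/l"] by simp_all
    qed
    have v0: "u0 \<le> v0" "v0 \<le> u0 + l" "v0 - u0 = v - u" using uv by (auto simp: u0_def v0_def)
    have GG: "G u = G u0" "G' u = G' u0" "G v = G v0" "G' v = G' v0"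
      by (simp_all add: G_def G'_def u0_def v0_def per)
    show ?thesis
    proof (cases "v0 \<le> l")
      case True
      have "norm (G' v - G' u) \<le> C * (v - u) powr \<mu>"
        using holder[of u0 v0] u0 v0 True by (simp add: GG G_eq)
      moreover have "norm (G v - G u - (v - u) *\<^sub>R G' u) \<le> C * (v - u) powr (1 + \<mu>)"
        using lin[of u0 v0] u0 v0 True by (simp add: GG G_eq)
      moreover have "0 \<le> C * (v - u) powr \<mu>" "0 \<le> C * (v - u) powr (1 + \<mu>)" using C by simp_all
      ultimately show ?thesis by linarith
    next
      case False
      \<comment> \<open>The interval is cut at the closing point. Both pieces are expanded from
        their left ends, and replacing the slope \<open>g' l\<close> by \<open>g' u0\<close> on the
        second piece costs a third term of the same order.\<close>
      define v1 where "v1 = v0 - l"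
      have v1: "0 \<le> v1" "v1 \<le> u0" "v1 + (l - u0) = v - u" using False v0 by (auto simp: v1_def)
      have GG1: "G v = G v1" "G' v = G' v1"
      proof -
        have "v0 = v1 + l * of_int 1" by (simp add: v1_def)
        then have "G v0 = G v1" "G' v0 = G' v1" by (simp_all only: G_def G'_def per)
        then show "G v = G v1" "G' v = G' v1" using GG(3,4) by simp_all
      qed
      have e1: "norm (g' v1 - g' 0) \<le> C * v1 powr \<mu>" using holder[of 0 v1] v1 u0 by simp
      have e2: "norm (g' l - g' u0) \<le> C * (l - u0) powr \<mu>" using holder[of u0 l] l u0 by simp
      have e3: "norm (g v1 - g 0 - v1 *\<^sub>R g' 0) \<le> C * v1 powr (1 + \<mu>)" using lin[of 0 v1] v1 u0 by simp
      have e4: "norm (g l - g u0 - (l - u0) *\<^sub>R g' u0) \<le> C * (l - u0) powr (1 + \<mu>)" using lin[of u0 l] l u0 by simp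
      have m1: "C * v1 powr q \<le> C * (v - u) powr q" "C * (l - u0) powr q \<le> C * (v - u) powr q" if "q \<ge> 0" for q
        using that v1 u0 C by (auto intro!: mult_left_mono powr_mono2)
      have "norm (G' v - G' u) = norm ((g' v1 - g' 0) + (g' l - g' u0))"
        using v1 u0 closed by (simp add: GG1 GG(1,2) G_eq)
      also have "\<dots> \<le> C * v1 powr \<mu> + C * (l - u0) powr \<mu>"
        using norm_triangle_ineq e1 e2 by (meson add_mono order_trans)
      also have "\<dots> \<le> 2 * C * (v - u) powr \<mu>" using m1[of \<mu>] \<mu> by simp
      finally have r1: "norm (G' v - G' u) \<le> 2 * C * (v - u) powr \<mu>" .
      have e5: "norm (v1 *\<^sub>R (g' l - g' u0)) \<le> C * (v - u) powr (1 + \<mu>)"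
      proof -
        have "norm (v1 *\<^sub>R (g' l - g' u0)) \<le> v1 * (C * (l - u0) powr \<mu>)"
          using e2 v1 by (simp add: mult_left_mono)
        also have "\<dots> \<le> (v - u) * (C * (v - u) powr \<mu>)"
          using v1 u0 \<mu> C by (intro mult_mono m1(2)) auto
        also have "\<dots> = C * (v - u) powr (1 + \<mu>)"
          using uv by (cases "v = u") (simp_all add: powr_add)
        finally show ?thesis .
      qed
      have "G v - G u - (v - u) *\<^sub>R G' u
          = (g v1 - g 0 - v1 *\<^sub>R g' 0) + (g l - g u0 - (l - u0) *\<^sub>R g' u0) + v1 *\<^sub>R (g' l - g' u0)"
      proof -
        have "G v - G u - (v - u) *\<^sub>R G' u = g v1 - g u0 - (v1 + (l - u0)) *\<^sub>R g' u0"
          using v1 u0 by (simp add: GG1 GG(1,2) G_eq)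
        also have "\<dots> = (g v1 - g 0 - v1 *\<^sub>R g' 0) + (g l - g u0 - (l - u0) *\<^sub>R g' u0) + v1 *\<^sub>R (g' l - g' u0)"
          unfolding closed by (simp add: scaleR_diff_left scaleR_diff_right scaleR_add_left)
        finally show ?thesis .
      qed
      also have "norm \<dots> \<le> C * v1 powr (1 + \<mu>) + C * (l - u0) powr (1 + \<mu>) + C * (v - u) powr (1 + \<mu>)"
        using norm_triangle_ineq e3 e4 e5 by (meson add_mono order_trans)
      also have "\<dots> \<le> 3 * C * (v - u) powr (1 + \<mu>)" using m1[of "1 + \<mu>"] \<mu> by simp
      finally show ?thesis using r1 by blast
    qed
  qed
  show thesis
  proof (rule that[of G G'])
    show "G (t + l * of_int k) = G t" for t k by (simp add: G_def per)
    show "G t \<in> g ` {0..l}" for t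
      unfolding G_def using l frac_lt_1[of "t/l"] by (intro imageI) (auto simp: less_imp_le mult_left_le)
    show "norm (G' v - G' u) \<le> 2 * C * \<bar>v - u\<bar> powr \<mu>" if "\<bar>v - u\<bar> \<le> l" for u v
      using ordered[of u v] ordered[of v u] that by (cases "u \<le> v") (auto simp: norm_minus_commute)
    show "norm (G v - G u - (v - u) *\<^sub>R G' u) \<le> 5 * C * \<bar>v - u\<bar> powr (1 + \<mu>)" if "\<bar>v - u\<bar> \<le> l" for u v
    proof (cases "u \<le> v")
      case True
      then show ?thesis using ordered[of u v] that C by (smt (verit) mult_nonneg_nonneg powr_ge_zero mult_right_mono abs_of_nonneg)
    next
      case False
      \<comment> \<open>The ordered estimate is based at the left point. Moving the base to
        \<open>u\<close> adds the error \<open>(u - v) (G' u - G' v)\<close>, which turns 3 C into 5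
        C.\<close>
      then have o: "norm (G' u - G' v) \<le> 2 * C * (u - v) powr \<mu>"
        "norm (G u - G v - (u - v) *\<^sub>R G' v) \<le> 3 * C * (u - v) powr (1 + \<mu>)"
        using ordered[of v u] that by auto
      have "norm ((u - v) *\<^sub>R (G' u - G' v)) \<le> (u - v) * (2 * C * (u - v) powr \<mu>)"
        using o(1) False by (simp add: mult_left_mono)
      also have "\<dots> = 2 * C * (u - v) powr (1 + \<mu>)" using False by (simp add: powr_add)
      finally have o3: "norm ((u - v) *\<^sub>R (G' u - G' v)) \<le> 2 * C * (u - v) powr (1 + \<mu>)" .
      have "G v - G u - (v - u) *\<^sub>R G' u = (u - v) *\<^sub>R (G' u - G' v) - (G u - G v - (u - v) *\<^sub>R G' v)"
        by (simp add: scaleR_diff_left scaleR_diff_right)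
      also have "norm \<dots> \<le> 2 * C * (u - v) powr (1 + \<mu>) + 3 * C * (u - v) powr (1 + \<mu>)"
        using norm_triangle_ineq4 o3 o(2) by (meson add_mono order_trans)
      finally show ?thesis using False by simp
    qed
  qed (use G_eq in auto)
qed

lemma exists_small_powr:
  fixes \<mu> c :: real
  assumes "0 < \<mu>" "0 < c" "0 < b"
  shows "\<exists>\<delta>. 0 < \<delta> \<and> \<delta> \<le> b \<and> (\<forall>x. 0 \<le> x \<longrightarrow> x \<le> \<delta> \<longrightarrow> x powr \<mu> \<le> c)"
proof (intro exI conjI allI impI)
  show "0 < min b (c powr (1 / \<mu>))" "min b (c powr (1 / \<mu>)) \<le> b" using assms by auto
  fix x assume "0 \<le> x" "x \<le> min b (c powr (1 / \<mu>))"
  then have "x powr \<mu> \<le> (c powr (1 / \<mu>)) powr \<mu>" using assms by (intro powr_mono2) auto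
  then show "x powr \<mu> \<le> c" using assms by (simp add: powr_powr)
qed

text \<open>The outside of the Jordan curve is connected and unbounded, so it cannot meet the
  bounded set \<open>D\<close> without meeting \<open>frontier D\<close>; its own frontier is the
  whole curve. Thus \<open>D\<close> does not lie on both sides of its boundary.\<close>

lemma Jordan_frontier_exterior_approach:
  fixes c :: "real \<Rightarrow> complex"
  assumes "simple_path c" "pathfinish c = pathstart c" and fr: "frontier D = path_image c"
    and "bounded D" "p \<in> frontier D" "0 < e"
  shows "\<exists>w. norm (w - p) < e \<and> w \<notin> closure D"
proof -
  define V where "V = outside (path_image c)"
  have V: "open V" "connected V" "\<not> bounded V" "frontier V = path_image c"
    using Jordan_inside_outside[OF assms(1,2)] by (auto simp: V_def)
  have V_fr: "V \<inter> frontier D = {}" using outside_no_overlap[of "path_image c"] by (auto simp: V_def fr)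
  have "V \<inter> D = {}"
  proof (rule ccontr)
    assume "V \<inter> D \<noteq> {}"
    then have "V \<subseteq> D" by (rule connected_disjoint_frontier[OF V(2) V_fr])
    then show False using V(3) \<open>bounded D\<close> bounded_subset by metis
  qed
  then have disj: "V \<inter> closure D = {}" using open_Int_closure_eq_empty[OF V(1)] by blast
  have "p \<in> closure V" using \<open>p \<in> frontier D\<close> fr V(4) by (auto simp: frontier_def)
  then obtain w where "w \<in> V" "dist w p < e" using \<open>0 < e\<close> closure_approachable by blast
  then show ?thesis using disj by (auto simp: dist_norm)
qed

text \<open>In the tangent frame at \<open>p\<close> the expansion of the curve gives flatness, and
  almost parallel tangents make the nearby boundary a graph. Injectivity, made uniform by
  compactness, keeps all other pieces of the curve away. All constants come from \<open>C\<close>,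
  \<open>c\<close> and \<open>\<eta>\<close>, hence are independent of \<open>p\<close>.\<close>

theorem Lyapunov_domain_Holder_flat:
  assumes \<mu>: "0 < \<mu>" and D: "Lyapunov_domain \<mu> D"
  obtains M r where "0 < M" "0 < r" "\<And>p. p \<in> frontier D \<Longrightarrow> \<exists>n. Holder_flat \<mu> M r D p n"
proof -
  obtain l g where curve: "closed_Jordan_Lyapunov_curve \<mu> l g" and fr: "frontier D = g ` {0..l}"
    and op: "open D" and bd: "bounded D"
    using D by (auto simp: Lyapunov_domain_def planar_domain_def)
  have l: "0 < l" and simple: "simple_path (\<lambda>x. g (l * x))" and closed: "g l = g 0"
    and arc: "arc_length_parametrization l g"
    using curve by (auto simp: closed_Jordan_Lyapunov_curve_def)
  obtain g' where g': "\<And>t. t \<in> {0..l} \<Longrightarrow> (g has_vector_derivative g' t) (at t within {0..l})"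
    and closed': "g' l = g' 0"
    and bdd: "bdd_above {norm (g' t - g' s) / \<bar>t - s\<bar> powr \<mu> | t s. t \<in> {0..l} \<and> s \<in> {0..l} \<and> t \<noteq> s}"
    using curve unfolding closed_Jordan_Lyapunov_curve_def by blast
  obtain B where B: "\<And>t s. t \<in> {0..l} \<Longrightarrow> s \<in> {0..l} \<Longrightarrow> t \<noteq> s \<Longrightarrow> norm (g' t - g' s) / \<bar>t - s\<bar> powr \<mu> \<le> B"
    using bdd unfolding bdd_above_def by blast
  define C where "C = max 1 B"
  have C: "0 < C" by (simp add: C_def)
  have holder: "norm (g' t - g' s) \<le> C * \<bar>t - s\<bar> powr \<mu>" if "s \<in> {0..l}" "t \<in> {0..l}" for s t
  proof (cases "t = s")
    case False
    then have "norm (g' t - g' s) / \<bar>t - s\<bar> powr \<mu> \<le> C" using B[of t s] that by (simp add: C_def)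
    then show ?thesis using False by (simp add: divide_le_eq)
  qed simp
  have cont': "continuous_on {0..l} g'"
  proof (rule continuous_onI)
    fix s e :: real assume s: "s \<in> {0..l}" and e: "0 < e"
    obtain \<delta> where \<delta>: "0 < \<delta>" "\<And>x. 0 \<le> x \<Longrightarrow> x \<le> \<delta> \<Longrightarrow> x powr \<mu> \<le> e / C"
      using exists_small_powr[OF \<mu>, of "e / C" 1] e C by auto
    show "\<exists>d>0. \<forall>x'\<in>{0..l}. dist x' s < d \<longrightarrow> dist (g' x') (g' s) \<le> e"
    proof (intro exI[of _ \<delta>] conjI ballI impI \<delta>(1))
      fix t assume t: "t \<in> {0..l}" "dist t s < \<delta>"
      have "norm (g' t - g' s) \<le> C * \<bar>t - s\<bar> powr \<mu>" using holder s t by blast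
      also have "\<dots> \<le> C * (e / C)" using \<delta>(2)[of "\<bar>t - s\<bar>"] t C by (intro mult_left_mono) (auto simp: dist_real_def)
      finally show "dist (g' t) (g' s) \<le> e" using C by (simp add: dist_norm)
    qed
  qed
  have contg: "continuous_on {0..l} g"
    using g' by (meson continuous_on_eq_continuous_within has_vector_derivative_continuous)
  have "\<exists>t0\<in>{0..l}. \<forall>t\<in>{0..l}. norm (g' t0) \<le> norm (g' t)"
    using l by (intro continuous_attains_inf continuous_intros cont') auto
  then obtain t0 where t0: "t0 \<in> {0..l}" "\<And>t. t \<in> {0..l} \<Longrightarrow> norm (g' t0) \<le> norm (g' t)" by blast
  define c where "c = norm (g' t0)"
  have c: "0 < c" using arc_length_parametrization_deriv_nonzero[OF l arc g' cont' t0(1)] by (simp add: c_def)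
  have inj: "s = t \<or> (s = 0 \<and> t = l) \<or> (s = l \<and> t = 0)" if "s \<in> {0..l}" "t \<in> {0..l}" "g s = g t" for s t
  proof -
    have "s / l \<in> {0..1}" "t / l \<in> {0..1}" "g (l * (s / l)) = g (l * (t / l))" using that l by auto
    then have "s / l = t / l \<or> (s / l = 0 \<and> t / l = 1) \<or> (s / l = 1 \<and> t / l = 0)"
      using simple unfolding simple_path_def loop_free_def by blast
    then show ?thesis using l by auto
  qed
  obtain G G' where G: "\<And>t. t \<in> {0..l} \<Longrightarrow> G t = g t" "\<And>t. t \<in> {0..l} \<Longrightarrow> G' t = g' t"
    "\<And>t k. G (t + l * of_int k) = G t" "\<And>t. G t \<in> g ` {0..l}"
    and GH: "\<And>u v. \<bar>v - u\<bar> \<le> l \<Longrightarrow> norm (G' v - G' u) \<le> 2 * C * \<bar>v - u\<bar> powr \<mu>"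
    and GT: "\<And>u v. \<bar>v - u\<bar> \<le> l \<Longrightarrow> norm (G v - G u - (v - u) *\<^sub>R G' u) \<le> 5 * C * \<bar>v - u\<bar> powr (1 + \<mu>)"
    by (rule periodic_Holder_extension[of l g g' C \<mu>], erule g', erule (1) holder, rule less_imp_le[OF C],
        rule \<mu>, rule l, rule closed, rule closed', (rule that; assumption))
  \<comment> \<open>This choice makes the expansion error \<open>5 C x^\<mu>\<close> at most
    \<open>c / 4\<close> per unit of parameter, and the turning of the tangent at most
    \<open>c / 4\<close>.\<close>
  obtain \<delta>2 where \<delta>2: "0 < \<delta>2" "\<delta>2 \<le> l" "\<And>x. 0 \<le> x \<Longrightarrow> x \<le> \<delta>2 \<Longrightarrow> x powr \<mu> \<le> c / (20 * C)"
    using exists_small_powr[OF \<mu>, of "c / (20 * C)" l] c C l by auto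
  \<comment> \<open>Halved so that two parameters within \<open>\<delta>\<close> of the same
    \<open>s\<close> are within \<open>\<delta>2\<close> of each other.\<close>
  define \<delta> where "\<delta> = \<delta>2 / 2"
  have GT': "norm (G v - G u - (v - u) *\<^sub>R G' u) \<le> \<bar>v - u\<bar> * (c / 4)" if uv: "\<bar>v - u\<bar> \<le> \<delta>2" for u v
  proof -
    have "norm (G v - G u - (v - u) *\<^sub>R G' u) \<le> 5 * C * \<bar>v - u\<bar> powr (1 + \<mu>)"
      using GT uv \<delta>2(2) by simp
    also have "\<dots> = \<bar>v - u\<bar> * (5 * C * \<bar>v - u\<bar> powr \<mu>)" by (cases "u = v") (simp_all add: powr_add)
    also have "\<dots> \<le> \<bar>v - u\<bar> * (5 * C * (c / (20 * C)))"
      using \<delta>2(3)[of "\<bar>v - u\<bar>"] uv C by (intro mult_left_mono) auto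
    also have "\<dots> = \<bar>v - u\<bar> * (c / 4)" using C by simp
    finally show ?thesis .
  qed
  have GH': "norm (G' v - G' u) \<le> c / 4" if uv: "\<bar>v - u\<bar> \<le> \<delta>2" for u v
  proof -
    have "norm (G' v - G' u) \<le> 2 * C * \<bar>v - u\<bar> powr \<mu>" using GH uv \<delta>2(2) by simp
    also have "\<dots> \<le> 2 * C * (c / (20 * C))" using \<delta>2(3)[of "\<bar>v - u\<bar>"] uv C by (intro mult_left_mono) auto
    also have "\<dots> \<le> c / 4" using C c by simp
    finally show ?thesis .
  qed
  \<comment> \<open>Parameter pairs that are far apart on the circle of length \<open>l\<close> form
    a compact set on which the chord length has a positive minimum. The alternative
    \<open>l - \<delta> < ...\<close> is closeness through the closing point.\<close>
  have "\<exists>\<eta>>0. \<forall>s\<in>{0..l}. \<forall>t\<in>{0..l}. norm (g s - g t) < \<eta> \<longrightarrow> \<bar>s - t\<bar> < \<delta> \<or> l - \<delta> < \<bar>s - t\<bar>"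
  proof -
    define P where "P = ({0..l} \<times> {0..l}) \<inter> {x. \<delta> \<le> \<bar>fst x - snd x\<bar> \<and> \<bar>fst x - snd x\<bar> \<le> l - \<delta>}"
    have "compact P" unfolding P_def
      by (intro compact_Int_closed compact_Times compact_Icc closed_Collect_conj closed_Collect_le continuous_intros)
    have contP: "continuous_on P (\<lambda>x. norm (g (fst x) - g (snd x)))"
      by (intro continuous_intros continuous_on_compose2[OF contg]) (auto simp: P_def)
    show ?thesis
    proof (cases "P = {}")
      case True
      then show ?thesis by (intro exI[of _ 1]) (force simp: P_def)
    next
      case False
      then obtain x where x: "x \<in> P" "\<And>y. y \<in> P \<Longrightarrow> norm (g (fst x) - g (snd x)) \<le> norm (g (fst y) - g (snd y))"
        using continuous_attains_inf[OF \<open>compact P\<close> _ contP] by blast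
      have "g (fst x) \<noteq> g (snd x)"
        using inj[of "fst x" "snd x"] x(1) \<delta>2(1) by (auto simp: P_def \<delta>_def)
      then have "0 < norm (g (fst x) - g (snd x))" by simp
      moreover have "\<bar>s - t\<bar> < \<delta> \<or> l - \<delta> < \<bar>s - t\<bar>"
        if "s \<in> {0..l}" "t \<in> {0..l}" "norm (g s - g t) < norm (g (fst x) - g (snd x))" for s t
        using x(2)[of "(s, t)"] that by (force simp: P_def)
      ultimately show ?thesis by blast
    qed
  qed
  then obtain \<eta> where \<eta>: "0 < \<eta>" "\<And>s t. s \<in> {0..l} \<Longrightarrow> t \<in> {0..l} \<Longrightarrow> norm (g s - g t) < \<eta> \<Longrightarrow> \<bar>s - t\<bar> < \<delta> \<or> l - \<delta> < \<bar>s - t\<bar>"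
    by metis
  \<comment> \<open>Since \<open>|t - s| \<le> (2 / c) |w - p|\<close> near \<open>p\<close>, the
    error \<open>5 C |t - s|^(1 + \<mu>)\<close> becomes
    \<open>M |w - p|^(1 + \<mu>)\<close>.\<close>
  define M where "M = 5 * C * (2 / c) powr (1 + \<mu>)"
  have M: "0 < M" using C c by (simp add: M_def)
  obtain r where r: "0 < r" "r \<le> \<eta>" "\<And>x. 0 \<le> x \<Longrightarrow> x \<le> r \<Longrightarrow> x powr \<mu> \<le> 1 / (4 * M)"
    using exists_small_powr[OF \<mu>, of "1 / (4 * M)" \<eta>] M \<eta>(1) by auto
  have Mr: "M * r powr \<mu> \<le> 1 / 4"
    using mult_left_mono[OF r(3)[of r], of M] r(1) M by simp
  show thesis
  proof (rule that[of "max M (r powr - \<mu>)" r])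
    show "0 < max M (r powr - \<mu>)" using M by simp
    fix p assume p: "p \<in> frontier D"
    then obtain s where s: "s \<in> {0..l}" "p = G s" using fr G(1) by auto
    define L where "L = norm (G' s)"
    have L: "c \<le> L" using t0(2)[OF s(1)] G(2)[OF s(1)] by (simp add: L_def c_def)
    define \<tau> where "\<tau> = sgn (G' s)"
    have "G' s \<noteq> 0" using L c by (auto simp: L_def)
    then have \<tau>: "norm \<tau> = 1" "G' s = of_real L * \<tau>"
      by (simp_all add: \<tau>_def L_def norm_sgn) (simp add: sgn_div_norm scaleR_conv_of_real)
    have \<tau>\<tau>: "cnj \<tau> * \<tau> = 1" using \<tau>(1) complex_norm_square[of \<tau>] by (simp add: mult.commute)
    have near: "\<exists>t. \<bar>t - s\<bar> < \<delta> \<and> w = G t" if w: "w \<in> frontier D" "norm (w - p) < r" for w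
    proof -
      obtain t where t: "t \<in> {0..l}" "w = g t" using w(1) fr by auto
      have "\<bar>s - t\<bar> < \<delta> \<or> l - \<delta> < \<bar>s - t\<bar>"
        using \<eta>(2)[OF s(1) t(1)] w(2) t(2) s G(1) r(2) by (simp add: norm_minus_commute)
      then consider "\<bar>t - s\<bar> < \<delta>" | "l - \<delta> < t - s" | "l - \<delta> < s - t" by linarith
      then show ?thesis
      proof cases
        case 1
        then show ?thesis using t G(1) by auto
      next
        case 2
        have "G (t - l) = w" using G(3)[of t "-1"] G(1)[OF t(1)] t(2) by simp
        then show ?thesis using 2 s(1) t(1) by (intro exI[of _ "t - l"]) auto
      next
        case 3
        have "G (t + l) = w" using G(3)[of t 1] G(1)[OF t(1)] t(2) by simp
        then show ?thesis using 3 s(1) t(1) by (intro exI[of _ "t + l"]) auto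
      qed
    qed
    have "\<exists>n. Holder_flat \<mu> (max M (r powr - \<mu>)) r D p n"
    proof (rule Holder_flat_if_graph[OF op \<mu> _ r(1) Mr p \<tau>(1)])
      show "0 \<le> M" using M by simp
      show "\<exists>w. norm (w - p) < e \<and> w \<notin> closure D" if "e > 0" for e
      proof (rule Jordan_frontier_exterior_approach[OF simple _ _ bd p that])
        show "pathfinish (\<lambda>x. g (l * x)) = pathstart (\<lambda>x. g (l * x))"
          using closed by (simp add: pathfinish_def pathstart_def)
        have "{0..l} = (\<lambda>x. l * x) ` {0..1}" using l by simp
        then show "frontier D = path_image (\<lambda>x. g (l * x))"
          unfolding fr path_image_def by (simp only: image_image)
      qed
    next
      fix w assume w: "w \<in> frontier D" "norm (w - p) < r"
      obtain t where t: "\<bar>t - s\<bar> < \<delta>" "w = G t" using near[OF w] by blast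
      define E where "E = G t - G s - (t - s) *\<^sub>R G' s"
      have wp: "w - p = of_real ((t - s) * L) * \<tau> + E"
        by (simp add: E_def t s \<tau>(2) scaleR_conv_of_real)
      have t2: "\<bar>t - s\<bar> \<le> \<delta>2" using t(1) \<delta>2(1) by (simp add: \<delta>_def)
      have E1: "norm E \<le> \<bar>t - s\<bar> * (c / 4)" using GT'[OF t2] by (simp add: E_def)
      have E2: "norm E \<le> 5 * C * \<bar>t - s\<bar> powr (1 + \<mu>)" using GT[of t s] t2 \<delta>2(2) by (simp add: E_def)
      have "\<bar>t - s\<bar> * c \<le> \<bar>t - s\<bar> * L" using L by (intro mult_left_mono) auto
      also have "\<dots> = norm ((w - p) - E)" using L c \<tau>(1) by (simp add: wp norm_mult abs_mult del: of_real_mult of_real_diff)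
      also have "\<dots> \<le> norm (w - p) + norm E" by (rule norm_triangle_ineq4)
      finally have "\<bar>t - s\<bar> * c \<le> norm (w - p) + \<bar>t - s\<bar> * (c / 4)" using E1 by simp
      moreover have "0 \<le> \<bar>t - s\<bar> * c" using c by simp
      ultimately have "\<bar>t - s\<bar> * c \<le> 2 * norm (w - p)" by simp
      then have ts: "\<bar>t - s\<bar> \<le> 2 / c * norm (w - p)" using c by (simp add: field_simps)
      have "cnj (\<i> * \<tau>) * (w - p) = cnj (\<i> * \<tau>) * E - \<i> * of_real ((t - s) * L) * (cnj \<tau> * \<tau>)"
        by (simp add: wp algebra_simps)
      then have "Re (cnj (\<i> * \<tau>) * (w - p)) = Re (cnj (\<i> * \<tau>) * E)" unfolding \<tau>\<tau> by simp
      then have "\<bar>Re (cnj (\<i> * \<tau>) * (w - p))\<bar> \<le> norm E"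
        using abs_Re_le_cmod[of "cnj (\<i> * \<tau>) * E"] \<tau>(1) by (simp add: norm_mult)
      also have "\<dots> \<le> 5 * C * (2 / c * norm (w - p)) powr (1 + \<mu>)"
        by (rule order_trans[OF E2]) (use ts C \<mu> in \<open>auto intro!: mult_left_mono powr_mono2\<close>)
      also have "\<dots> = M * norm (w - p) powr (1 + \<mu>)"
        unfolding M_def using c by (subst powr_mult) auto
      finally show "\<bar>Re (cnj (\<i> * \<tau>) * (w - p))\<bar> \<le> M * norm (w - p) powr (1 + \<mu>)" .
    next
      fix w1 w2 assume w: "w1 \<in> frontier D" "w2 \<in> frontier D" "norm (w1 - p) < r" "norm (w2 - p) < r"
        and vert: "Re (cnj \<tau> * (w1 - w2)) = 0"
      obtain t1 where t1: "\<bar>t1 - s\<bar> < \<delta>" "w1 = G t1" using near[OF w(1,3)] by blast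
      obtain t2 where t2: "\<bar>t2 - s\<bar> < \<delta>" "w2 = G t2" using near[OF w(2,4)] by blast
      define E where "E = G t1 - G t2 - (t1 - t2) *\<^sub>R G' t2"
      have t12: "\<bar>t1 - t2\<bar> \<le> \<delta>2" using t1(1) t2(1) unfolding \<delta>_def by linarith
      have E: "norm E \<le> \<bar>t1 - t2\<bar> * (c / 4)" using GT'[OF t12] by (simp add: E_def)
      have t2s: "\<bar>t2 - s\<bar> \<le> \<delta>2" using t2(1) \<delta>2(1) by (simp add: \<delta>_def)
      have d: "norm (G' t2 - G' s) \<le> c / 4" by (rule GH'[OF t2s])
      \<comment> \<open>The tangential speed is at least \<open>3 c / 4\<close> and the expansion
        error at most \<open>c / 4\<close>, so equal tangential coordinates force equal
        parameters.\<close>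
      have "cnj \<tau> * G' t2 = of_real L * (cnj \<tau> * \<tau>) + cnj \<tau> * (G' t2 - G' s)"
        unfolding \<tau>(2) by (simp add: algebra_simps)
      then have "Re (cnj \<tau> * G' t2) = L + Re (cnj \<tau> * (G' t2 - G' s))" unfolding \<tau>\<tau> by simp
      moreover have "\<bar>Re (cnj \<tau> * (G' t2 - G' s))\<bar> \<le> c / 4"
        using abs_Re_le_cmod[of "cnj \<tau> * (G' t2 - G' s)"] d \<tau>(1) by (simp add: norm_mult)
      ultimately have low: "3 * c / 4 \<le> Re (cnj \<tau> * G' t2)" using L by linarith
      have "cnj \<tau> * (w1 - w2) = of_real (t1 - t2) * (cnj \<tau> * G' t2) + cnj \<tau> * E"
        by (simp add: E_def t1(2) t2(2) scaleR_conv_of_real algebra_simps)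
      then have "(t1 - t2) * Re (cnj \<tau> * G' t2) = - Re (cnj \<tau> * E)" using vert by simp
      then have "\<bar>t1 - t2\<bar> * \<bar>Re (cnj \<tau> * G' t2)\<bar> \<le> norm E"
        using abs_Re_le_cmod[of "cnj \<tau> * E"] \<tau>(1) by (simp add: norm_mult flip: abs_mult)
      moreover have "\<bar>t1 - t2\<bar> * (3 * c / 4) \<le> \<bar>t1 - t2\<bar> * \<bar>Re (cnj \<tau> * G' t2)\<bar>"
        using order_trans[OF low abs_ge_self] by (intro mult_left_mono) simp_all
      ultimately have "\<bar>t1 - t2\<bar> * (c / 2) \<le> 0" using E by (simp add: field_simps)
      then have "t1 = t2" using c by (simp add: mult_le_0_iff)
      then show "w1 = w2" using t1 t2 by simp
    qed
    then show "\<exists>n. Holder_flat \<mu> (max M (r powr - \<mu>)) r D p n" .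
  qed (rule r(1))
qed

section \<open>The inner normal: uniqueness and continuity\<close>

lemma Holder_flat_closure:
  assumes "Holder_flat \<mu> M r D p n" "0 < \<mu>" "w \<in> closure D"
  shows "- M * norm (w - p) powr (1 + \<mu>) \<le> Re (cnj n * (w - p))"
proof -
  have "closed {w. - M * norm (w - p) powr (1 + \<mu>) \<le> Re (cnj n * (w - p))}"
    using assms(2) by (intro closed_Collect_le continuous_intros continuous_on_powr') auto
  moreover have "D \<subseteq> {w. - M * norm (w - p) powr (1 + \<mu>) \<le> Re (cnj n * (w - p))}"
    using assms(1) by (auto simp: Holder_flat_def)
  ultimately show ?thesis using assms(3) closure_minimal by blast
qed

lemma Holder_flat_frontier:
  assumes "Holder_flat \<mu> M r D p n" "open D" "w \<in> frontier D" "norm (w - p) < r"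
  shows "Re (cnj n * (w - p)) \<le> M * norm (w - p) powr (1 + \<mu>)"
  using assms by (force simp: Holder_flat_def frontier_def interior_open)

lemma Re_cnj_mult_self: "Re (cnj n * n) = (norm n)\<^sup>2"
  by (simp only: cmod_power2) (simp add: power2_eq_square)

lemma norm_diff_power2: "(norm (a - b))\<^sup>2 = (norm a)\<^sup>2 + (norm b)\<^sup>2 - 2 * Re (cnj a * b)"
  for a b :: complex
  by (simp only: cmod_power2) (simp add: power2_eq_square algebra_simps)

lemma abs_Re_cnj_mult_le: "\<bar>Re (cnj n * w)\<bar> \<le> norm n * norm w"
  using abs_Re_le_cmod[of "cnj n * w"] by (simp add: norm_mult)

lemma unit_eq_if_Re_ge_1:
  assumes "norm a = 1" "norm b = 1" "1 \<le> Re (cnj a * b)"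
  shows "a = b"
proof -
  have "(norm (a - b))\<^sup>2 \<le> 0" using assms unfolding norm_diff_power2 by simp
  then show ?thesis by simp
qed

text \<open>If \<open>n\<close> differed from \<open>e\<close>, the direction \<open>e - n\<close>
  would enter the tangent disc at \<open>p\<close> while descending linearly below the tangent line
  of \<open>n\<close>; close to \<open>p\<close> this beats the allowance
  \<open>M |w - p|^(1 + \<mu>)\<close>.\<close>

lemma Holder_flat_normal_unique:
  assumes flat: "Holder_flat \<mu> M r D p n" and \<mu>: "0 < \<mu>" and M: "0 < M"
    and e: "norm e = 1" and d: "0 < d" and ball: "ball (p + d *\<^sub>R e) d \<subseteq> D"
  shows "n = e"
proof (rule ccontr)
  assume ne: "n \<noteq> e"
  have n: "norm n = 1" using flat by (simp add: Holder_flat_def)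
  define c where "c = 1 - Re (cnj n * e)"
  have c: "0 < c" using unit_eq_if_Re_ge_1[OF n e] ne by (force simp: c_def)
  define w where "w = e - n"
  have w0: "w \<noteq> 0" using ne by (simp add: w_def)
  have wn: "Re (cnj n * w) = - c"
    using n Re_cnj_mult_self[of n] by (simp add: w_def c_def right_diff_distrib)
  have we: "Re (cnj e * w) = c"
  proof -
    have "Re (cnj e * n) = Re (cnj n * e)" by simp
    then show ?thesis using e Re_cnj_mult_self[of e] by (simp add: w_def c_def right_diff_distrib)
  qed
  obtain \<delta> where \<delta>: "0 < \<delta>" "\<And>x. 0 \<le> x \<Longrightarrow> x \<le> \<delta> \<Longrightarrow> x powr \<mu> \<le> c / (2 * M * norm w)"
    using exists_small_powr[OF \<mu>, of "c / (2 * M * norm w)" 1] c M w0 by auto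
  \<comment> \<open>The first bound makes the allowance at most half of the descent
    \<open>t c\<close>; the second keeps \<open>p + t w\<close> inside the disc.\<close>
  define t where "t = min (\<delta> / norm w) (d * c / (norm w)\<^sup>2)"
  have t: "0 < t" using \<delta>(1) d c w0 by (simp add: t_def)
  have tw: "t * norm w \<le> \<delta>" using w0 by (simp add: t_def min_def field_simps)
  have "t \<le> d * c / (norm w)\<^sup>2" by (simp add: t_def)
  then have "t * (norm w)\<^sup>2 \<le> d * c" using w0 by (subst (asm) pos_le_divide_eq) simp_all
  have "Re (cnj (t *\<^sub>R w) * (d *\<^sub>R e)) = t * d * Re (cnj e * w)" by (simp add: algebra_simps)
  then have "(norm (t *\<^sub>R w - d *\<^sub>R e))\<^sup>2 = t\<^sup>2 * (norm w)\<^sup>2 + d\<^sup>2 * (norm e)\<^sup>2 - 2 * t * d * Re (cnj e * w)"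
    unfolding norm_diff_power2 by (simp add: power_mult_distrib)
  also have "\<dots> = t * (t * (norm w)\<^sup>2) + d\<^sup>2 - 2 * t * (d * c)" using we e by (simp add: power2_eq_square)
  also have "\<dots> \<le> t * (d * c) + d\<^sup>2 - 2 * t * (d * c)"
    using mult_left_mono[OF \<open>t * (norm w)\<^sup>2 \<le> d * c\<close>, of t] t by linarith
  also have "\<dots> < d\<^sup>2" using t d c by simp
  finally have "norm (t *\<^sub>R w - d *\<^sub>R e) < d" using d by (simp add: power_less_imp_less_base)
  then have "p + t *\<^sub>R w \<in> ball (p + d *\<^sub>R e) d" by (simp add: dist_norm norm_minus_commute)
  then have "p + t *\<^sub>R w \<in> D" using ball by blast
  then have "- M * norm (p + t *\<^sub>R w - p) powr (1 + \<mu>) \<le> Re (cnj n * (p + t *\<^sub>R w - p))"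
    using flat unfolding Holder_flat_def by blast
  then have "- M * norm (t *\<^sub>R w) powr (1 + \<mu>) \<le> Re (cnj n * (t *\<^sub>R w))"
    by (simp only: add_diff_cancel_left')
  also have "Re (cnj n * (t *\<^sub>R w)) = t * Re (cnj n * w)" by (simp add: algebra_simps)
  also have "\<dots> = - t * c" using wn by simp
  finally have "t * c \<le> M * (t * norm w) powr (1 + \<mu>)" using t by simp
  also have "\<dots> = (t * norm w) * (M * (t * norm w) powr \<mu>)" using t w0 by (simp add: powr_add)
  also have "\<dots> \<le> (t * norm w) * (M * (c / (2 * M * norm w)))"
    using \<delta>(2)[of "t * norm w"] tw t M by (intro mult_left_mono) auto
  also have "\<dots> = t * c / 2" using M w0 by (simp add: field_simps)
  finally show False using t c by (simp add: field_simps)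
qed

text \<open>A step of length \<open>s\<close> from \<open>p\<close> in the direction
  \<open>n - m\<close> stays in the cusp of \<open>n\<close>, hence in \<open>D\<close>. If the
  normals differed much, it would sink further below \<open>q\<close> than flatness at
  \<open>q\<close> allows.\<close>

lemma Holder_flat_normals_close:
  assumes flat_p: "Holder_flat \<mu> M r D p n" and flat_q: "Holder_flat \<mu> M r D q m"
    and \<mu>: "0 < \<mu>" and M: "0 < M" and s: "0 < s" "2 * s \<le> r" and Ms: "M * (2 * s) powr \<mu> \<le> 1/16"
    and pq: "norm (p - q) \<le> s / 4"
  shows "1/2 \<le> Re (cnj m * n)"
proof (rule ccontr)
  assume less: "\<not> 1/2 \<le> Re (cnj m * n)"
  have n: "norm n = 1" "norm m = 1" using flat_p flat_q by (simp_all add: Holder_flat_def)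
  define N where "N = norm (n - m)"
  have sq: "N\<^sup>2 = 2 - 2 * Re (cnj m * n)"
    unfolding N_def norm_minus_commute[of n m] norm_diff_power2 using n by simp
  have N: "1 \<le> N"
    using less sq by (intro power2_le_imp_le[of 1 N]) (auto simp: N_def)
  define e where "e = (n - m) /\<^sub>R N"
  have "norm e = norm (n - m) / N" using N by (simp add: e_def divide_inverse mult.commute)
  then have e: "norm e = 1" using N by (simp add: N_def[symmetric])
  have ne: "Re (cnj n * (n - m)) = N\<^sup>2 / 2"
    using Re_cnj_mult_self[of n] n sq by (simp add: right_diff_distrib algebra_simps)
  have me: "Re (cnj m * (n - m)) = - N\<^sup>2 / 2"
    using Re_cnj_mult_self[of m] n sq by (simp add: right_diff_distrib algebra_simps)
  have ne': "Re (cnj n * (s *\<^sub>R e)) = s * (N / 2)"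
  proof -
    have "Re (cnj n * (s *\<^sub>R e)) = s / N * Re (cnj n * (n - m))"
      unfolding e_def by (simp add: divide_inverse algebra_simps)
    then show ?thesis unfolding ne using N by (simp add: power2_eq_square)
  qed
  have me': "Re (cnj m * (s *\<^sub>R e)) = - s * (N / 2)"
  proof -
    have "Re (cnj m * (s *\<^sub>R e)) = s / N * Re (cnj m * (n - m))"
      unfolding e_def by (simp add: divide_inverse algebra_simps)
    then show ?thesis unfolding me using N by (simp add: power2_eq_square)
  qed
  have sN: "s / 2 \<le> s * (N / 2)" using N s by simp
  \<comment> \<open>The balance: the descent is at least \<open>s / 2\<close>, the offset
    \<open>p - q\<close> gives back at most \<open>s / 4\<close>, and the cusp allowances are at
    most \<open>s / 8\<close>.\<close>
  have small: "M * x powr (1 + \<mu>) \<le> s / 8" if "0 \<le> x" "x \<le> 2 * s" for x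
  proof -
    have "M * x powr (1 + \<mu>) = x * (M * x powr \<mu>)" using that by (cases "x = 0") (simp_all add: powr_add)
    also have "\<dots> \<le> (2 * s) * (M * (2 * s) powr \<mu>)"
      using that M \<mu> s by (intro mult_mono powr_mono2) auto
    also have "\<dots> \<le> (2 * s) * (1/16)" using Ms s by (intro mult_left_mono) auto
    finally show ?thesis by simp
  qed
  define w where "w = p + s *\<^sub>R e"
  have wp: "norm (w - p) = s" using e s by (simp add: w_def)
  have "Re (cnj n * (w - p)) = s * (N / 2)" using ne' by (simp only: w_def add_diff_cancel_left')
  then have "M * norm (w - p) powr (1 + \<mu>) < Re (cnj n * (w - p))"
    using small[of s] s sN unfolding wp by linarith
  then have "w \<in> D" using flat_p wp s by (simp add: Holder_flat_def)
  then have "- M * norm (w - q) powr (1 + \<mu>) \<le> Re (cnj m * (w - q))"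
    using flat_q by (simp add: Holder_flat_def)
  moreover have "Re (cnj m * (w - q)) = - s * (N / 2) + Re (cnj m * (p - q))"
    unfolding me'[symmetric] by (simp add: w_def algebra_simps)
  moreover have "\<bar>Re (cnj m * (p - q))\<bar> \<le> s / 4" using abs_Re_cnj_mult_le[of m "p - q"] n pq by simp
  moreover have "norm (w - q) \<le> s + s / 4"
    using norm_triangle_ineq[of "w - p" "p - q"] wp pq by simp
  then have "M * norm (w - q) powr (1 + \<mu>) \<le> s / 8" using s by (intro small) auto
  ultimately show False using sN s by simp
qed

section \<open>Second-order tests and a comparison principle\<close>

text \<open>The derivative is required near 0 so that the second one makes sense at 0. Laplacians
  appear as the sum of the second entries along 1 and \<i>, which keeps all second-order calculus on
  real lines.\<close>

definition jet2 :: "(real \<Rightarrow> real) \<Rightarrow> real \<Rightarrow> real \<Rightarrow> bool" where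
  "jet2 \<phi> d s \<longleftrightarrow> (\<exists>\<phi>'. (\<forall>\<^sub>F t in nhds 0. (\<phi> has_real_derivative \<phi>' t) (at t)) \<and> \<phi>' 0 = d
     \<and> (\<phi>' has_real_derivative s) (at 0))"

lemma jet2_DERIV: "jet2 \<phi> d s \<Longrightarrow> (\<phi> has_real_derivative d) (at 0)"
  unfolding jet2_def by (auto dest: eventually_nhds_x_imp_x)

lemma jet2_const: "jet2 (\<lambda>t. c) 0 0"
  unfolding jet2_def by (rule exI[of _ "\<lambda>t. 0"]) auto

lemma jet2_add:
  assumes "jet2 \<phi> d s" "jet2 \<psi> d' s'" shows "jet2 (\<lambda>t. \<phi> t + \<psi> t) (d + d') (s + s')"
proof -
  obtain \<phi>' where 1: "\<forall>\<^sub>F t in nhds 0. (\<phi> has_real_derivative \<phi>' t) (at t)" "\<phi>' 0 = d" "(\<phi>' has_real_derivative s) (at 0)"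
    using assms(1) unfolding jet2_def by blast
  obtain \<psi>' where 2: "\<forall>\<^sub>F t in nhds 0. (\<psi> has_real_derivative \<psi>' t) (at t)" "\<psi>' 0 = d'" "(\<psi>' has_real_derivative s') (at 0)"
    using assms(2) unfolding jet2_def by blast
  have "\<forall>\<^sub>F t in nhds 0. ((\<lambda>t. \<phi> t + \<psi> t) has_real_derivative \<phi>' t + \<psi>' t) (at t)"
    using 1(1) 2(1) by eventually_elim (rule DERIV_add)
  then show ?thesis unfolding jet2_def
    using 1 2 DERIV_add[OF 1(3) 2(3)] by (intro exI[of _ "\<lambda>t. \<phi>' t + \<psi>' t"]) auto
qed

lemma jet2_cmult:
  assumes "jet2 \<phi> d s" shows "jet2 (\<lambda>t. c * \<phi> t) (c * d) (c * s)"
proof -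
  obtain \<phi>' where 1: "\<forall>\<^sub>F t in nhds 0. (\<phi> has_real_derivative \<phi>' t) (at t)" "\<phi>' 0 = d" "(\<phi>' has_real_derivative s) (at 0)"
    using assms(1) unfolding jet2_def by blast
  have "\<forall>\<^sub>F t in nhds 0. ((\<lambda>t. c * \<phi> t) has_real_derivative c * \<phi>' t) (at t)"
    using 1(1) by eventually_elim (rule DERIV_cmult)
  then show ?thesis unfolding jet2_def
    using 1 DERIV_cmult[OF 1(3)] by (intro exI[of _ "\<lambda>t. c * \<phi>' t"]) auto
qed

lemma jet2_power2:
  assumes "jet2 \<phi> d s" shows "jet2 (\<lambda>t. (\<phi> t)\<^sup>2) (2 * \<phi> 0 * d) (2 * d\<^sup>2 + 2 * \<phi> 0 * s)"
proof -
  obtain \<phi>' where 1: "\<forall>\<^sub>F t in nhds 0. (\<phi> has_real_derivative \<phi>' t) (at t)" "\<phi>' 0 = d" "(\<phi>' has_real_derivative s) (at 0)"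
    using assms(1) unfolding jet2_def by blast
  have "\<forall>\<^sub>F t in nhds 0. ((\<lambda>t. (\<phi> t)\<^sup>2) has_real_derivative 2 * \<phi> t * \<phi>' t) (at t)"
    using 1(1) by eventually_elim (auto intro!: derivative_eq_intros)
  moreover have "((\<lambda>t. 2 * \<phi> t * \<phi>' t) has_real_derivative 2 * d\<^sup>2 + 2 * \<phi> 0 * s) (at 0)"
    using DERIV_mult[OF DERIV_cmult[OF jet2_DERIV[OF assms], of 2] 1(3)] 1(2)
    by (simp add: power2_eq_square algebra_simps)
  ultimately show ?thesis unfolding jet2_def
    using 1 by (intro exI[of _ "\<lambda>t. 2 * \<phi> t * \<phi>' t"]) auto
qed

lemma jet2_powr:
  assumes "jet2 \<phi> d s" and pos: "\<phi> 0 > 0"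
  shows "jet2 (\<lambda>t. \<phi> t powr q) (q * \<phi> 0 powr (q - 1) * d)
    (q * \<phi> 0 powr (q - 1) * s + q * (q - 1) * \<phi> 0 powr (q - 2) * d\<^sup>2)"
proof -
  obtain \<phi>' where 1: "\<forall>\<^sub>F t in nhds 0. (\<phi> has_real_derivative \<phi>' t) (at t)" "\<phi>' 0 = d" "(\<phi>' has_real_derivative s) (at 0)"
    using assms(1) unfolding jet2_def by blast
  have "(\<phi> \<longlongrightarrow> \<phi> 0) (nhds 0)"
    using DERIV_isCont[OF jet2_DERIV[OF assms(1)]] by (simp add: isCont_def tendsto_at_iff_tendsto_nhds)
  then have "\<forall>\<^sub>F t in nhds 0. \<phi> t > 0" using pos by (rule order_tendstoD(1))
  with 1(1) have "\<forall>\<^sub>F t in nhds 0. ((\<lambda>t. \<phi> t powr q) has_real_derivative q * \<phi> t powr (q - 1) * \<phi>' t) (at t)"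
    by eventually_elim (rule DERIV_chain2[OF has_real_derivative_powr])
  moreover have "((\<lambda>t. q * \<phi> t powr (q - 1) * \<phi>' t) has_real_derivative
      (q * \<phi> 0 powr (q - 1) * s + q * (q - 1) * \<phi> 0 powr (q - 2) * d\<^sup>2)) (at 0)"
  proof -
    have "((\<lambda>t. \<phi> t powr (q - 1)) has_real_derivative (q - 1) * \<phi> 0 powr (q - 2) * d) (at 0)"
      using DERIV_chain2[OF has_real_derivative_powr[OF pos, of "q - 1"] jet2_DERIV[OF assms(1)]] by simp
    from DERIV_mult[OF DERIV_cmult[OF this, of q] 1(3)] show ?thesis
      using 1(2) by (simp add: power2_eq_square algebra_simps)
  qed
  ultimately show ?thesis unfolding jet2_def
    using 1 by (intro exI[of _ "\<lambda>t. q * \<phi> t powr (q - 1) * \<phi>' t"]) auto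
qed

lemma jet2_local_max:
  assumes "jet2 \<phi> d s" and max: "\<forall>\<^sub>F t in nhds 0. \<phi> t \<le> \<phi> 0"
  shows "s \<le> 0"
proof (rule ccontr)
  assume s: "\<not> s \<le> 0"
  obtain \<phi>' where 1: "\<forall>\<^sub>F t in nhds 0. (\<phi> has_real_derivative \<phi>' t) (at t)" "\<phi>' 0 = d" "(\<phi>' has_real_derivative s) (at 0)"
    using assms(1) unfolding jet2_def by blast
  obtain e where e: "e > 0" "\<And>t. \<bar>t\<bar> < e \<Longrightarrow> (\<phi> has_real_derivative \<phi>' t) (at t) \<and> \<phi> t \<le> \<phi> 0"
    using eventually_conj[OF 1(1) max] unfolding eventually_nhds_metric by (auto simp: dist_real_def)
  have "d = 0" using DERIV_local_max[OF jet2_DERIV[OF assms(1)] e(1)] e(2) by auto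
  obtain \<delta> where \<delta>: "\<delta> > 0" "\<And>t. 0 < t \<Longrightarrow> t < \<delta> \<Longrightarrow> \<phi>' t > \<phi>' 0"
    using DERIV_pos_inc_right[OF 1(3)] s by auto
  define t where "t = min e \<delta> / 2"
  have t: "0 < t" "t < e" "t < \<delta>" using e(1) \<delta>(1) by (auto simp: t_def)
  have "\<exists>z>0. z < t \<and> \<phi> t - \<phi> 0 = (t - 0) * \<phi>' z"
    using t e(2) by (intro MVT2) auto
  then obtain z where "0 < z" "z < t" "\<phi> t - \<phi> 0 = t * \<phi>' z" by auto
  moreover have "\<phi>' z > 0" using \<delta>(2)[of z] \<open>d = 0\<close> 1(2) t calculation by simp
  ultimately have "\<phi> t > \<phi> 0" using t by (smt (verit) mult_pos_pos)
  then show False using e(2)[of t] t by auto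
qed

text \<open>The second entry is quadratic in \<open>v\<close>, so the entries for 1 and \<i> cancel:
  this is harmonicity in the form that the barriers use.\<close>

lemma jet2_Re_holomorphic:
  assumes F: "\<forall>\<^sub>F w in nhds z. (F has_field_derivative F' w) (at w)"
    and F': "(F' has_field_derivative F'') (at z)"
  shows "jet2 (\<lambda>t. Re (F (z + of_real t * v))) (Re (F' z * v)) (Re (F'' * v\<^sup>2))"
proof -
  have lim: "((\<lambda>t. z + of_real t * v) \<longlongrightarrow> z) (nhds (0::real))"
  proof -
    have "isCont (\<lambda>t::real. z + of_real t * v) 0" by (intro continuous_intros)
    then show ?thesis by (metis (mono_tags, lifting) add.right_neutral continuous_at mult_zero_left of_real_0 tendsto_at_iff_tendsto_nhds)
  qed
  have comp: "((\<lambda>t. Re (K (z + of_real t * v))) has_real_derivative Re (k * v)) (at t)"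
    if "(K has_field_derivative k) (at (z + of_real t * v))" for K k and t :: real
  proof -
    have "((\<lambda>t::real. z + of_real t * v) has_vector_derivative v) (at t)"
      by (auto intro!: derivative_eq_intros)
    from field_vector_diff_chain_at[OF this that]
    have "((\<lambda>t. K (z + of_real t * v)) has_vector_derivative v * k) (at t)" by (simp add: o_def)
    from bounded_linear.has_vector_derivative[OF bounded_linear_Re this]
    show ?thesis by (simp add: has_real_derivative_iff_has_vector_derivative mult.commute)
  qed
  have "\<forall>\<^sub>F t in nhds 0. ((\<lambda>t. Re (F (z + of_real t * v))) has_real_derivative Re (F' (z + of_real t * v) * v)) (at t)"
    using eventually_compose_filterlim[OF F lim] by eventually_elim (rule comp)
  moreover have "((\<lambda>t. Re (F' (z + of_real t * v) * v)) has_real_derivative Re (F'' * v\<^sup>2)) (at 0)"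
    using comp[of "\<lambda>w. F' w * v" "F'' * v" 0] F' by (simp add: DERIV_cmult_right power2_eq_square mult.assoc)
  ultimately show ?thesis unfolding jet2_def
    by (intro exI[of _ "\<lambda>t. Re (F' (z + of_real t * v) * v)"]) auto
qed

section \<open>The analytic setting and a maximum principle along \<open>h\<close>\<close>

locale planar_hqc =
  fixes f g f' g' h hinv :: "complex \<Rightarrow> complex" and k :: real and D :: "complex set"
  assumes f_deriv: "\<And>z. norm z < 1 \<Longrightarrow> (f has_field_derivative f' z) (at z)"
    and g_deriv: "\<And>z. norm z < 1 \<Longrightarrow> (g has_field_derivative g' z) (at z)"
    and h_eq: "\<And>z. norm z < 1 \<Longrightarrow> h z = f z + cnj (g z)"
    and k: "0 \<le> k" "k < 1"
    and dil: "\<And>z. norm z < 1 \<Longrightarrow> norm (g' z) \<le> k * norm (f' z)"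
    and homeo: "homeomorphism (ball 0 1) D h hinv"
    and D: "open D" "bounded D"
begin

abbreviation bdist :: "complex \<Rightarrow> real" where
  "bdist w \<equiv> infdist w (frontier D)"

text \<open>Conjugating the second summand of \<open>cnj a * h\<close> preserves real parts, so a
  linear coordinate of \<open>h\<close> is the real part of a holomorphic function.\<close>

definition lin :: "complex \<Rightarrow> complex \<Rightarrow> complex" where
  "lin a z = cnj a * f z + a * g z"

definition lin' :: "complex \<Rightarrow> complex \<Rightarrow> complex" where
  "lin' a z = cnj a * f' z + a * g' z"

lemma Re_lin: "norm z < 1 \<Longrightarrow> Re (cnj a * h z) = Re (lin a z)"
  by (simp add: h_eq lin_def algebra_simps)

lemma lin_deriv: "norm z < 1 \<Longrightarrow> (lin a has_field_derivative lin' a z) (at z)"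
  unfolding lin_def[abs_def] lin'_def by (intro DERIV_add DERIV_cmult f_deriv g_deriv)

text \<open>Every linear coordinate of \<open>h\<close> has a gradient comparable to
  \<open>|f'|\<close>. This is how quasiconformality enters the barriers and the gradient
  bound.\<close>

lemma norm_lin'_ge:
  assumes "norm z < 1" shows "norm a * (1 - k) * norm (f' z) \<le> norm (lin' a z)"
proof -
  have "norm a * norm (g' z) \<le> norm a * (k * norm (f' z))" using dil[OF assms] by (intro mult_left_mono) auto
  moreover have "norm (cnj a * f' z) - norm (a * g' z) \<le> norm (lin' a z)"
    unfolding lin'_def by (metis add_diff_cancel_right' norm_triangle_ineq2 diff_minus_eq_add norm_minus_cancel)
  ultimately show ?thesis by (simp add: norm_mult algebra_simps)
qed

lemma derivs_holomorphic: "f' holomorphic_on ball 0 1" "g' holomorphic_on ball 0 1"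
proof -
  have "f holomorphic_on ball 0 1" "g holomorphic_on ball 0 1"
    unfolding holomorphic_on_open[OF open_ball] by (metis f_deriv mem_ball_0, metis g_deriv mem_ball_0)
  from this[THEN holomorphic_deriv] have "deriv f holomorphic_on ball 0 1" "deriv g holomorphic_on ball 0 1"
    by auto
  moreover have "deriv f z = f' z" "deriv g z = g' z" if "z \<in> ball 0 1" for z
    using f_deriv[of z] g_deriv[of z] that by (auto intro: DERIV_imp_deriv)
  ultimately show "f' holomorphic_on ball 0 1" "g' holomorphic_on ball 0 1"
    by (metis holomorphic_transform)+
qed

lemma lin'_deriv:
  assumes "norm z < 1" obtains c where "\<And>a. (lin' a has_field_derivative cnj a * fst c + a * snd c) (at z)"
proof -
  obtain c1 where c1: "(f' has_field_derivative c1) (at z)"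
    using derivs_holomorphic(1) assms unfolding holomorphic_on_open[OF open_ball] by (metis mem_ball_0)
  obtain c2 where c2: "(g' has_field_derivative c2) (at z)"
    using derivs_holomorphic(2) assms unfolding holomorphic_on_open[OF open_ball] by (metis mem_ball_0)
  show thesis
    by (rule that[of "(c1, c2)"]) (unfold lin'_def[abs_def], auto intro!: DERIV_add DERIV_cmult c1 c2)
qed

lemma h_in_D: "norm z < 1 \<Longrightarrow> h z \<in> D"
  using homeo unfolding homeomorphism_def by auto

lemma hinv_h: "norm z < 1 \<Longrightarrow> hinv (h z) = z"
  using homeo unfolding homeomorphism_def by auto

lemma h_hinv: "w \<in> D \<Longrightarrow> h (hinv w) = w" "w \<in> D \<Longrightarrow> norm (hinv w) < 1"
  using homeo unfolding homeomorphism_def by auto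

lemma h_continuous: "continuous_on (ball 0 1) h"
  using homeo unfolding homeomorphism_def by auto

lemma hinv_continuous: "continuous_on D hinv"
  using homeo unfolding homeomorphism_def by auto

text \<open>A maximum principle for \<open>\<Phi> \<circ> h - b\<close> on the part of the annulus
  that \<open>h\<close> maps into \<open>W\<close>. As \<open>h\<close> need not extend to the unit
  circle, \<open>fr\<close> compares every boundary point \<open>q\<close> of \<open>D\<close> near
  \<open>W\<close> with every \<open>x\<close> on the circle; \<open>side\<close> covers the inner
  circle and the boundary of \<open>W\<close> inside \<open>D\<close>.\<close>

lemma comparison_principle:
  fixes \<Phi> b :: "complex \<Rightarrow> real"
  assumes \<Phi>: "continuous_on UNIV \<Phi>" and b: "continuous_on {z. R \<le> norm z \<and> norm z \<le> 1} b" and W: "open W"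
    and fr: "\<And>q x. q \<in> frontier D \<Longrightarrow> q \<in> closure W \<Longrightarrow> norm x = 1 \<Longrightarrow> \<Phi> q \<le> b x"
    and side: "\<And>x. norm x < 1 \<Longrightarrow> R \<le> norm x \<Longrightarrow> h x \<in> closure W \<Longrightarrow> norm x = R \<or> h x \<notin> W \<Longrightarrow> \<Phi> (h x) \<le> b x"
    and nomax: "\<And>x. norm x < 1 \<Longrightarrow> R < norm x \<Longrightarrow> h x \<in> W \<Longrightarrow>
        \<not> (\<forall>\<^sub>F y in nhds x. \<Phi> (h y) - b y \<le> \<Phi> (h x) - b x)"
    and z: "norm z < 1" "R < norm z" "h z \<in> W"
  shows "\<Phi> (h z) \<le> b z"
proof (rule ccontr)
  assume "\<not> \<Phi> (h z) \<le> b z"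
  define e where "e = \<Phi> (h z) - b z"
  have e: "e > 0" using \<open>\<not> \<Phi> (h z) \<le> b z\<close> by (simp add: e_def)
  define m where "m x = \<Phi> (h x) - b x" for x
  define \<Omega> where "\<Omega> = (ball 0 1 \<inter> h -` W) \<inter> {x. R < norm x}"
  have "open \<Omega>" unfolding \<Omega>_def
    using h_continuous W by (intro open_Int continuous_open_preimage open_Collect_less continuous_intros) auto
  have mem: "x \<in> \<Omega> \<longleftrightarrow> norm x < 1 \<and> R < norm x \<and> h x \<in> W" for x by (auto simp: \<Omega>_def)
  have cont_m: "continuous_on \<Omega> m" unfolding m_def
    by (intro continuous_on_diff continuous_on_subset[OF b] continuous_on_compose2[OF \<Phi>] continuous_on_subset[OF h_continuous])
      (auto simp: mem)
  \<comment> \<open>A superlevel set at a positive height avoids all parts of the boundary, so it is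
    compact and the maximum over it is an interior local maximum.\<close>
  define Q where "Q = {x \<in> \<Omega>. e \<le> m x}"
  have "closed Q"
    unfolding closed_sequential_limits
  proof (intro allI impI, elim conjE)
    fix Z x assume Z: "\<forall>n. Z n \<in> Q" and lim: "Z \<longlonglongrightarrow> x"
    have Zn: "norm (Z n) < 1" "R < norm (Z n)" "h (Z n) \<in> W" "e \<le> m (Z n)" for n
      using Z by (auto simp: Q_def mem)
    have "bounded (range (h \<circ> Z))"
      by (rule bounded_subset[OF D(2)]) (use Zn h_in_D in auto)
    then obtain q \<rho> where \<rho>: "strict_mono \<rho>" "((h \<circ> Z) \<circ> \<rho>) \<longlonglongrightarrow> q"
      using bounded_imp_convergent_subsequence by blast
    have lim': "(Z \<circ> \<rho>) \<longlonglongrightarrow> x" using lim \<rho>(1) by (rule LIMSEQ_subseq_LIMSEQ)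
    have limh: "(\<lambda>n. h (Z (\<rho> n))) \<longlonglongrightarrow> q" using \<rho>(2) by (simp add: o_def)
    have nx: "norm x \<le> 1" "R \<le> norm x"
      using LIMSEQ_le_const2[OF tendsto_norm[OF lim], of 1] LIMSEQ_le_const[OF tendsto_norm[OF lim], of R] Zn(1,2)
      by (auto intro: less_imp_le)
    have qW: "q \<in> closure W" "q \<in> closure D"
      unfolding closure_sequential
      using Zn(1,3) h_in_D limh by (intro exI[of _ "\<lambda>n. h (Z (\<rho> n))"] conjI allI; simp)+
    have "(\<lambda>n. \<Phi> (h (Z (\<rho> n)))) \<longlonglongrightarrow> \<Phi> q"
      by (rule continuous_on_tendsto_compose[OF \<Phi> limh]) simp_all
    moreover have "(\<lambda>n. b (Z (\<rho> n))) \<longlonglongrightarrow> b x"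
      by (rule continuous_on_tendsto_compose[OF b])
        (use lim' nx Zn in \<open>auto simp: o_def less_imp_le\<close>)
    ultimately have "(\<lambda>n. m (Z (\<rho> n))) \<longlonglongrightarrow> \<Phi> q - b x" unfolding m_def by (rule tendsto_diff)
    then have ge: "e \<le> \<Phi> q - b x" by (rule LIMSEQ_le_const) (use Zn(4) in auto)
    show "x \<in> Q"
    proof (cases "norm x = 1")
      case True
      \<comment> \<open>Properness: if the images converged in \<open>D\<close>, continuity of
        \<open>hinv\<close> would make the points converge inside the open disc.\<close>
      have "q \<notin> D"
      proof
        assume q: "q \<in> D"
        have "(\<lambda>n. hinv (h (Z (\<rho> n)))) \<longlonglongrightarrow> hinv q"
          by (rule continuous_on_tendsto_compose[OF hinv_continuous limh q]) (use Zn(1) h_in_D in auto)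
        then have "(Z \<circ> \<rho>) \<longlonglongrightarrow> hinv q" using Zn(1) by (simp add: hinv_h o_def)
        then have "x = hinv q" using lim' LIMSEQ_unique by blast
        then show False using h_hinv(2)[OF q] True by simp
      qed
      then have "q \<in> frontier D" using qW(2) interior_subset by (auto simp: frontier_def)
      then show ?thesis using fr[of q x] qW(1) True ge e by simp
    next
      case False
      then have x1: "norm x < 1" using nx by simp
      have "(\<lambda>n. h (Z (\<rho> n))) \<longlonglongrightarrow> h x"
        by (rule continuous_on_tendsto_compose[OF h_continuous]) (use lim' x1 Zn(1) in \<open>auto simp: o_def\<close>)
      then have qx: "q = h x" using limh LIMSEQ_unique by blast
      have "x \<in> \<Omega>"
        using side[of x] x1 nx qW(1) ge e qx by (force simp: mem)
      then show ?thesis using ge qx by (simp add: Q_def m_def)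
    qed
  qed
  moreover have "bounded Q" by (rule bounded_subset[of "ball 0 1"]) (auto simp: Q_def mem)
  ultimately have "compact Q" by (simp add: compact_eq_bounded_closed)
  moreover have "z \<in> Q" using z by (simp add: Q_def mem m_def e_def)
  moreover have "continuous_on Q m" by (rule continuous_on_subset[OF cont_m]) (auto simp: Q_def)
  ultimately obtain x where x: "x \<in> Q" "\<And>y. y \<in> Q \<Longrightarrow> m y \<le> m x"
    using continuous_attains_sup[of Q m] by blast
  have "m y \<le> m x" if "y \<in> \<Omega>" for y
    using x(1) x(2)[of y] that by (cases "e \<le> m y") (auto simp: Q_def)
  moreover have "\<forall>\<^sub>F y in nhds x. y \<in> \<Omega>" using x(1) \<open>open \<Omega>\<close> by (auto simp: Q_def intro: eventually_nhds_in_open)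
  ultimately have "\<forall>\<^sub>F y in nhds x. m y \<le> m x" by (auto elim: eventually_mono)
  then show False using nomax[of x] x(1) by (auto simp: Q_def mem m_def)
qed

end

section \<open>Barriers and the distance to the boundary\<close>

lemma jet2_norm_power2:
  fixes z v :: complex
  shows "jet2 (\<lambda>t. (norm (z + of_real t * v))\<^sup>2) (2 * Re (cnj z * v)) (2 * (norm v)\<^sup>2)"
proof -
  have eq: "(norm (z + of_real t * v))\<^sup>2 = (norm z)\<^sup>2 + 2 * t * Re (cnj z * v) + t\<^sup>2 * (norm v)\<^sup>2" for t
    by (simp only: cmod_power2) (simp add: power2_eq_square algebra_simps)
  show ?thesis unfolding jet2_def eq
    by (rule exI[of _ "\<lambda>t. 2 * Re (cnj z * v) + 2 * t * (norm v)\<^sup>2"])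
      (auto intro!: derivative_eq_intros always_eventually)
qed

lemma sum_Re_power2: "(Re w)\<^sup>2 + (Re (w * \<i>))\<^sup>2 = (norm w)\<^sup>2"
  by (simp add: cmod_power2)

lemma norm_powr_eq: "norm w powr q = ((Re w)\<^sup>2 + (Im w)\<^sup>2) powr (q / 2)"
  by (simp add: cmod_def powr_half_sqrt[symmetric] powr_powr)

context planar_hqc
begin

text \<open>The Laplacians of both powers are of order \<open>norm (h y - p) powr (\<mu> - 1) * (norm (f' y))\<^sup>2\<close>.
  Since \<open>h\<close> is quasiconformal, no linear coordinate of \<open>h\<close> has a degenerate gradient, so that the second
  power wins as soon as \<open>A\<close> is large.\<close>

lemma barrier_no_local_max:
  assumes z: "norm z < 1" and \<mu>: "0 < \<mu>" "\<mu> < 1" and a: "1 \<le> norm a" "norm a \<le> 2"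
    and KA: "0 \<le> K" "16 * K \<le> A * \<mu> * (1 - k)\<^sup>2" and A: "0 \<le> A"
    and pos: "0 < Re (cnj a * (h z - p))"
    and b1: "jet2 (\<lambda>t. b (z + of_real t * 1)) d1 s1"
    and b2: "jet2 (\<lambda>t. b (z + of_real t * \<i>)) d2 s2" and s12: "0 < s1 + s2"
  shows "\<not> (\<forall>\<^sub>F y in nhds z. Re (cnj e * (h y - p)) - K * norm (h y - p) powr (1 + \<mu>)
        + A * (max 0 (Re (cnj a * (h y - p)))) powr (1 + \<mu>) + b y
      \<le> Re (cnj e * (h z - p)) - K * norm (h z - p) powr (1 + \<mu>)
        + A * (max 0 (Re (cnj a * (h z - p)))) powr (1 + \<mu>) + b z)"
    (is "\<not> (\<forall>\<^sub>F y in nhds z. ?m y \<le> ?m z)")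
proof
  assume max: "\<forall>\<^sub>F y in nhds z. ?m y \<le> ?m z"
  define q where "q = (1 + \<mu>) / 2"
  define X where "X y = Re (lin 1 y) + (- Re p)" for y
  define Y where "Y y = Re (lin \<i> y) + (- Im p)" for y
  define S where "S y = Re (lin a y) + (- Re (cnj a * p))" for y
  define E where "E y = Re (lin e y) + (- Re (cnj e * p))" for y
  define m where "m y = E y + (- K) * ((X y)\<^sup>2 + (Y y)\<^sup>2) powr q + A * (S y) powr (1 + \<mu>) + b y" for y
  have coords: "X y = Re (h y - p)" "Y y = Im (h y - p)" "S y = Re (cnj a * (h y - p))" "E y = Re (cnj e * (h y - p))"
    if "norm y < 1" for y
    using Re_lin[OF that, of 1] Re_lin[OF that, of \<i>] Re_lin[OF that, of a] Re_lin[OF that, of e]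
    by (simp_all add: X_def Y_def S_def E_def right_diff_distrib)
  have S0: "S z > 0" using pos coords(3)[OF z] by simp
  \<comment> \<open>\<open>S\<close> is positive near \<open>z\<close>, so the truncation by
    \<open>max\<close> disappears and the jet calculus applies to \<open>m\<close>.\<close>
  have m_eq: "?m y = m y" if "norm y < 1" "S y > 0" for y
    using that coords[OF that(1)] by (simp add: m_def q_def norm_powr_eq[of "h y - p"] max_absorb2)
  have ev1: "\<forall>\<^sub>F y in nhds z. y \<in> ball 0 1" using z by (intro eventually_nhds_in_open) auto
  have contS: "isCont S z"
    unfolding S_def
    by (rule isCont_add[OF bounded_linear.isCont[OF bounded_linear_Re DERIV_isCont[OF lin_deriv[OF z]]] continuous_const])
  have "(S \<longlongrightarrow> S z) (nhds z)" using contS by (simp add: isCont_def tendsto_at_iff_tendsto_nhds)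
  then have ev2: "\<forall>\<^sub>F y in nhds z. S y > 0" using S0 by (rule order_tendstoD(1))
  have max': "\<forall>\<^sub>F y in nhds z. m y \<le> m z"
    using max ev1 ev2 by eventually_elim (use m_eq z S0 in simp)
  obtain c where c: "\<And>a. (lin' a has_field_derivative cnj a * fst c + a * snd c) (at z)"
    using lin'_deriv[OF z] by blast
  define l2 where "l2 a = cnj a * fst c + a * snd c" for a
  have ev_lin: "\<forall>\<^sub>F y in nhds z. (lin a has_field_derivative lin' a y) (at y)" for a
    using ev1 by eventually_elim (simp add: lin_deriv)
  have jet_lin: "jet2 (\<lambda>t. Re (lin a (z + of_real t * v)) + C) (Re (lin' a z * v) + 0) (Re (l2 a * v\<^sup>2) + 0)" for a v C
    unfolding l2_def by (intro jet2_add jet2_Re_holomorphic ev_lin c jet2_const)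
  define R where "R = (X z)\<^sup>2 + (Y z)\<^sup>2"
  define r where "r = norm (h z - p)"
  have "h z \<noteq> p" using pos by auto
  then have r: "r > 0" by (simp add: r_def)
  have Rr: "R = r\<^sup>2" using coords[OF z] by (simp add: R_def r_def cmod_power2)
  then have R: "R > 0" using r by simp
  \<comment> \<open>\<open>H v\<close> and \<open>G v\<close> are the first and second derivatives
    of \<open>|h - p|^2\<close> at \<open>z\<close> along \<open>v\<close>.\<close>
  define G where "G v = 2 * (Re (lin' 1 z * v))\<^sup>2 + 2 * X z * Re (l2 1 * v\<^sup>2)
      + (2 * (Re (lin' \<i> z * v))\<^sup>2 + 2 * Y z * Re (l2 \<i> * v\<^sup>2))" for v
  define H where "H v = 2 * X z * Re (lin' 1 z * v) + 2 * Y z * Re (lin' \<i> z * v)" for v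
  have second: "Re (l2 e * v\<^sup>2) + (- K) * (q * R powr (q - 1) * G v + q * (q - 1) * R powr (q - 2) * (H v)\<^sup>2)
      + A * ((1 + \<mu>) * S z powr \<mu> * Re (l2 a * v\<^sup>2) + (1 + \<mu>) * \<mu> * S z powr (\<mu> - 1) * (Re (lin' a z * v))\<^sup>2) + s \<le> 0"
    if b: "jet2 (\<lambda>t. b (z + of_real t * v)) d s" for v d s
  proof -
    have jX: "jet2 (\<lambda>t. X (z + of_real t * v)) (Re (lin' 1 z * v)) (Re (l2 1 * v\<^sup>2))"
      using jet_lin[of 1 v "- Re p"] by (simp add: X_def)
    have jY: "jet2 (\<lambda>t. Y (z + of_real t * v)) (Re (lin' \<i> z * v)) (Re (l2 \<i> * v\<^sup>2))"
      using jet_lin[of \<i> v "- Im p"] unfolding Y_def by simp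
    have jS: "jet2 (\<lambda>t. S (z + of_real t * v)) (Re (lin' a z * v)) (Re (l2 a * v\<^sup>2))"
      using jet_lin[of a v "- Re (cnj a * p)"] unfolding S_def by simp
    have jE: "jet2 (\<lambda>t. E (z + of_real t * v)) (Re (lin' e z * v)) (Re (l2 e * v\<^sup>2))"
      using jet_lin[of e v "- Re (cnj e * p)"] unfolding E_def by simp
    have jR: "jet2 (\<lambda>t. (X (z + of_real t * v))\<^sup>2 + (Y (z + of_real t * v))\<^sup>2) (H v) (G v)"
      using jet2_add[OF jet2_power2[OF jX] jet2_power2[OF jY]] by (simp add: G_def H_def)
    have jRq: "jet2 (\<lambda>t. ((X (z + of_real t * v))\<^sup>2 + (Y (z + of_real t * v))\<^sup>2) powr q) (q * R powr (q - 1) * H v)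
        (q * R powr (q - 1) * G v + q * (q - 1) * R powr (q - 2) * (H v)\<^sup>2)"
      using jet2_powr[OF jR, of q] R by (simp add: R_def)
    have jSq: "jet2 (\<lambda>t. S (z + of_real t * v) powr (1 + \<mu>)) ((1 + \<mu>) * S z powr \<mu> * Re (lin' a z * v))
        ((1 + \<mu>) * S z powr \<mu> * Re (l2 a * v\<^sup>2) + (1 + \<mu>) * \<mu> * S z powr (\<mu> - 1) * (Re (lin' a z * v))\<^sup>2)"
      using jet2_powr[OF jS, of "1 + \<mu>"] S0 by (simp add: algebra_simps)
    note jm = jet2_add[OF jet2_add[OF jet2_add[OF jE jet2_cmult[OF jRq, of "-K"]] jet2_cmult[OF jSq, of A]] b]
    have lim: "((\<lambda>t. z + of_real t * v) \<longlongrightarrow> z) (nhds (0::real))"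
    proof -
      have "isCont (\<lambda>t::real. z + of_real t * v) 0" by (intro continuous_intros)
      then show ?thesis by (metis (mono_tags, lifting) add.right_neutral continuous_at mult_zero_left of_real_0 tendsto_at_iff_tendsto_nhds)
    qed
    have "\<forall>\<^sub>F t in nhds 0. m (z + of_real t * v) \<le> m (z + of_real 0 * v)"
      using eventually_compose_filterlim[OF max' lim] by simp
    then show ?thesis using jet2_local_max[OF jm] by (simp add: m_def)
  qed
  \<comment> \<open>The \<open>l2\<close> terms carry the factors \<open>1^2\<close> and
    \<open>\<i>^2\<close> and cancel, here as well as in \<open>T\<close>.\<close>
  have sumG: "G 1 + G \<i> = 2 * ((norm (lin' 1 z))\<^sup>2 + (norm (lin' \<i> z))\<^sup>2)"
    unfolding G_def using sum_Re_power2[of "lin' 1 z"] sum_Re_power2[of "lin' \<i> z"]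
    by (simp add: algebra_simps)
  have sumS: "(Re (lin' a z * 1))\<^sup>2 + (Re (lin' a z * \<i>))\<^sup>2 = (norm (lin' a z))\<^sup>2"
    using sum_Re_power2[of "lin' a z"] by simp
  define T where "T = - K * (q * R powr (q - 1) * (G 1 + G \<i>) + q * (q - 1) * R powr (q - 2) * ((H 1)\<^sup>2 + (H \<i>)\<^sup>2))
      + A * ((1 + \<mu>) * \<mu> * S z powr (\<mu> - 1) * (norm (lin' a z))\<^sup>2) + (s1 + s2)"
  have "T \<le> 0"
  proof -
    have "T = (Re (l2 e * 1\<^sup>2) + (- K) * (q * R powr (q - 1) * G 1 + q * (q - 1) * R powr (q - 2) * (H 1)\<^sup>2)
        + A * ((1 + \<mu>) * S z powr \<mu> * Re (l2 a * 1\<^sup>2) + (1 + \<mu>) * \<mu> * S z powr (\<mu> - 1) * (Re (lin' a z * 1))\<^sup>2) + s1)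
      + (Re (l2 e * \<i>\<^sup>2) + (- K) * (q * R powr (q - 1) * G \<i> + q * (q - 1) * R powr (q - 2) * (H \<i>)\<^sup>2)
        + A * ((1 + \<mu>) * S z powr \<mu> * Re (l2 a * \<i>\<^sup>2) + (1 + \<mu>) * \<mu> * S z powr (\<mu> - 1) * (Re (lin' a z * \<i>))\<^sup>2) + s2)"
      unfolding T_def sumS[symmetric] by (simp add: algebra_simps)
    then show ?thesis using second[OF b1] second[OF b2] by linarith
  qed
  define F where "F = norm (f' z)"
  have lin_le: "(norm (lin' u z))\<^sup>2 \<le> 4 * F\<^sup>2" if "norm u = 1" for u
  proof -
    have "norm (lin' u z) \<le> norm (f' z) + norm (g' z)"
      unfolding lin'_def using norm_triangle_ineq[of "cnj u * f' z" "u * g' z"] that by (simp add: norm_mult)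
    moreover have "norm (g' z) \<le> 1 * F"
      using order_trans[OF dil[OF z] mult_right_mono[of k 1 "norm (f' z)"]] k by (simp add: F_def)
    ultimately have "norm (lin' u z) \<le> 2 * F" by (simp add: F_def)
    then have "(norm (lin' u z))\<^sup>2 \<le> (2 * F)\<^sup>2" by (intro power_mono) auto
    then show ?thesis by (simp add: power_mult_distrib)
  qed
  \<comment> \<open>This 16 is the constant in \<open>KA\<close>; it comes from
    \<open>|g'| \<le> |f'|\<close> for the two coordinates of \<open>h\<close>.\<close>
  have G_le: "G 1 + G \<i> \<le> 16 * F\<^sup>2" unfolding sumG using lin_le[of 1] lin_le[of \<i>] by simp
  have lin_ge: "(1 - k)\<^sup>2 * F\<^sup>2 \<le> (norm (lin' a z))\<^sup>2"
  proof -
    have "1 * (1 - k) * F \<le> norm a * (1 - k) * F" using a k by (intro mult_right_mono) (auto simp: F_def)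
    also have "\<dots> \<le> norm (lin' a z)" using norm_lin'_ge[OF z] by (simp add: F_def)
    finally have "((1 - k) * F)\<^sup>2 \<le> (norm (lin' a z))\<^sup>2"
      using k by (intro power_mono) (auto simp: F_def)
    then show ?thesis by (simp add: power_mult_distrib)
  qed
  have Rq: "R powr (q - 1) = r powr (\<mu> - 1)"
  proof -
    have "R powr (q - 1) = (r powr 2) powr (q - 1)" using r by (simp add: Rr powr_numeral)
    also have "\<dots> = r powr (2 * (q - 1))" by (rule powr_powr)
    also have "2 * (q - 1) = \<mu> - 1" by (simp add: q_def field_simps)
    finally show ?thesis .
  qed
  \<comment> \<open>The exponent \<mu> - 1 is negative, so the upper bound
    \<open>S z \<le> 2 r\<close> gives a lower bound for the power.\<close>
  have S_le: "r powr (\<mu> - 1) / 2 \<le> S z powr (\<mu> - 1)"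
  proof -
    have "S z \<le> norm a * norm (h z - p)"
      using abs_Re_cnj_mult_le[of a "h z - p"] coords(3)[OF z] by simp
    also have "\<dots> \<le> 2 * r" using a by (simp add: r_def mult_right_mono)
    finally have "(2 * r) powr (\<mu> - 1) \<le> S z powr (\<mu> - 1)" using S0 \<mu> by (intro powr_mono2') auto
    moreover have "(2 * r) powr (\<mu> - 1) = 2 powr (\<mu> - 1) * r powr (\<mu> - 1)" using r by (simp add: powr_mult)
    moreover have "1 / 2 * r powr (\<mu> - 1) \<le> 2 powr (\<mu> - 1) * r powr (\<mu> - 1)"
    proof (rule mult_right_mono)
      have "2 powr (-1) \<le> (2::real) powr (\<mu> - 1)" using \<mu> by (intro powr_mono) auto
      then show "1 / 2 \<le> (2::real) powr (\<mu> - 1)" by (simp add: powr_minus)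
    qed simp
    ultimately show ?thesis by linarith
  qed
  have "K * (q * R powr (q - 1) * (G 1 + G \<i>)) \<le> K * (q * R powr (q - 1) * (16 * F\<^sup>2))"
    using G_le KA(1) \<mu> by (intro mult_left_mono mult_nonneg_nonneg) (auto simp: q_def)
  also have "\<dots> = (16 * K) * ((1 + \<mu>) * (r powr (\<mu> - 1) / 2) * F\<^sup>2)" unfolding Rq by (simp add: q_def)
  also have "\<dots> \<le> (A * \<mu> * (1 - k)\<^sup>2) * ((1 + \<mu>) * (r powr (\<mu> - 1) / 2) * F\<^sup>2)"
    using KA(2) \<mu> by (intro mult_right_mono) auto
  also have "\<dots> = A * ((1 + \<mu>) * \<mu> * (r powr (\<mu> - 1) / 2) * ((1 - k)\<^sup>2 * F\<^sup>2))" by simp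
  also have "\<dots> \<le> A * ((1 + \<mu>) * \<mu> * S z powr (\<mu> - 1) * (norm (lin' a z))\<^sup>2)"
    using A \<mu> S_le lin_ge by (intro mult_left_mono mult_mono) auto
  finally have main: "K * (q * R powr (q - 1) * (G 1 + G \<i>)) \<le> A * ((1 + \<mu>) * \<mu> * S z powr (\<mu> - 1) * (norm (lin' a z))\<^sup>2)" .
  \<comment> \<open>Since \<open>q < 1\<close>, the gradient part of the power with coefficient
    \<open>- K\<close> has the helpful sign. Strictness of \<open>0 < T\<close> comes from
    \<open>s12\<close> alone, as \<open>f' z\<close> might vanish here.\<close>
  have "0 \<le> (q * (1 - q)) * (K * (R powr (q - 2) * ((H 1)\<^sup>2 + (H \<i>)\<^sup>2)))"
    using \<mu> KA(1) by (intro mult_nonneg_nonneg) (auto simp: q_def)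
  also have "\<dots> = - K * (q * (q - 1) * R powr (q - 2) * ((H 1)\<^sup>2 + (H \<i>)\<^sup>2))" by (simp add: algebra_simps)
  finally have "0 < T" using main s12 by (simp add: T_def algebra_simps)
  then show False using \<open>T \<le> 0\<close> by simp
qed

section \<open>Distance to the frontier and properness of \<open>h\<close>\<close>

lemma D_nonempty: "D \<noteq> {}" using h_in_D[of 0] by auto

lemma frontier_nonempty: "frontier D \<noteq> {}"
  using D_nonempty D(2) by (metis frontier_eq_empty not_bounded_UNIV)

lemma bdist_attained:
  obtains p where "p \<in> frontier D" "norm (w - p) = bdist w"
  using infdist_attains_inf[OF frontier_closed frontier_nonempty, of w] by (metis dist_norm)

lemma bdist_pos:
  assumes "w \<in> D" shows "0 < bdist w"
proof -
  have "w \<notin> frontier D" using assms D(1) by (simp add: frontier_def interior_open)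
  then show ?thesis using infdist_pos_not_in_closed[OF frontier_closed frontier_nonempty] by blast
qed

lemma ball_bdist_subset:
  assumes "w \<in> D" shows "ball w (bdist w) \<subseteq> D"
proof (rule connected_disjoint_frontier)
  have "x \<notin> frontier D" if "dist w x < bdist w" for x
    using infdist_le[of x "frontier D" w] that by auto
  then show "ball w (bdist w) \<inter> frontier D = {}" by auto
  show "ball w (bdist w) \<inter> D \<noteq> {}" using assms bdist_pos[OF assms] by force
qed simp

text \<open>The points of \<open>D\<close> at distance at least \<open>\<eta>\<close> from the
  frontier form a compact set, and its image under \<open>hinv\<close> is compact in the open
  disc.\<close>

lemma bdist_ge_imp_away:
  assumes "0 < \<eta>"
  shows "\<exists>\<sigma>>0. \<forall>z. norm z < 1 \<longrightarrow> \<eta> \<le> bdist (h z) \<longrightarrow> norm z \<le> 1 - \<sigma>"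
proof -
  define Q where "Q = closure D \<inter> {w. \<eta> \<le> bdist w}"
  have "compact Q" unfolding Q_def
    by (intro compact_Int_closed closed_Collect_le continuous_intros) (use D(2) in \<open>simp add: compact_closure\<close>)
  have QD: "Q \<subseteq> D"
  proof
    fix w assume w: "w \<in> Q"
    then have "w \<notin> frontier D" using assms infdist_zero[of w "frontier D"] by (auto simp: Q_def)
    then show "w \<in> D" using w interior_subset by (auto simp: Q_def frontier_def)
  qed
  have comp: "compact (hinv ` Q)"
    using \<open>compact Q\<close> QD by (intro compact_continuous_image continuous_on_subset[OF hinv_continuous])
  have inQ: "z \<in> hinv ` Q" if "norm z < 1" "\<eta> \<le> bdist (h z)" for z
    using hinv_h[OF that(1)] h_in_D[OF that(1)] that(2) closure_subset
    by (intro image_eqI[of _ _ "h z"]) (auto simp: Q_def)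
  show ?thesis
  proof (cases "Q = {}")
    case True
    then show ?thesis using inQ by (intro exI[of _ 1]) auto
  next
    case False
    then obtain x where x: "x \<in> hinv ` Q" "\<And>y. y \<in> hinv ` Q \<Longrightarrow> norm y \<le> norm x"
      using continuous_attains_sup[OF comp, of norm] by (auto intro: continuous_intros)
    have "norm x < 1" using x(1) QD h_hinv(2) by auto
    then show ?thesis using x(2) inQ by (intro exI[of _ "1 - norm x"]) auto
  qed
qed

end

locale planar_hqc_flat = planar_hqc +
  fixes \<mu> M r :: real
  assumes \<mu>: "0 < \<mu>" "\<mu> < 1" and M: "0 < M" and r: "0 < r"
    and flat: "\<And>p. p \<in> frontier D \<Longrightarrow> \<exists>n. Holder_flat \<mu> M r D p n"
begin

text \<open>The disc about \<open>w\<close> of radius \<open>bdist w\<close> lies in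
  \<open>D\<close> and touches the frontier at a nearest point \<open>p\<close>, so uniqueness of
  the normal applies. Barriers at \<open>p\<close> are thus evaluated exactly on the normal
  axis.\<close>

lemma nearest_frontier_normal:
  assumes w: "w \<in> D"
  obtains p n where "p \<in> frontier D" "Holder_flat \<mu> M r D p n" "norm n = 1"
    "w - p = bdist w *\<^sub>R n" "norm (w - p) = bdist w"
proof -
  define d where "d = bdist w"
  have d: "d > 0" using bdist_pos[OF w] by (simp add: d_def)
  obtain p where p: "p \<in> frontier D" "norm (w - p) = d" using bdist_attained d_def by metis
  obtain n where n: "Holder_flat \<mu> M r D p n" using flat[OF p(1)] by blast
  define e where "e = (w - p) /\<^sub>R d"
  have e: "norm e = 1" "w - p = d *\<^sub>R e" "p + d *\<^sub>R e = w" using d p(2) by (simp_all add: e_def)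
  have "ball (p + d *\<^sub>R e) d \<subseteq> D" unfolding e(3) using ball_bdist_subset[OF w] by (simp only: d_def)
  then have "n = e" by (rule Holder_flat_normal_unique[OF n \<mu>(1) M e(1) d])
  then show thesis using that[OF p(1) n] e(1,2) p(2) unfolding d_def by metis
qed

lemma barrier_coefficient:
  assumes K: "0 < K"
  obtains A where "0 < A" "K \<le> A" "16 * K \<le> A * \<mu> * (1 - k)\<^sup>2"
proof
  have k2: "0 < (1 - k)\<^sup>2" "(1 - k)\<^sup>2 \<le> 1" using k by (auto intro: power_le_one)
  have muk: "0 < \<mu> * (1 - k)\<^sup>2" "\<mu> * (1 - k)\<^sup>2 \<le> 1" using \<mu> k2 by (auto intro!: mult_le_one)
  have "c / x * x = c" if "0 < x" for c x :: real using that by simp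
  from this[OF muk(1), of "16 * K"] show "16 * K \<le> 16 * K / (\<mu> * (1 - k)\<^sup>2) * \<mu> * (1 - k)\<^sup>2"
    unfolding mult.assoc by linarith
  show "0 < 16 * K / (\<mu> * (1 - k)\<^sup>2)" using K muk(1) by simp
  have "K * (\<mu> * (1 - k)\<^sup>2) \<le> K * 16" using muk K by (intro mult_left_mono) auto
  then show "K \<le> 16 * K / (\<mu> * (1 - k)\<^sup>2)" unfolding pos_le_divide_eq[OF muk(1)] by linarith
qed

text \<open>Upper barrier: in the coordinate \<open>y\<close> along the inner normal, \<open>y - K |w|^(1 + \<mu>) + A y^(1 + \<mu>)\<close> is nonpositive
  on \<open>frontier D\<close> and at least \<open>y\<close> on the normal itself.\<close>

lemma dist_frontier_upper:
  "\<exists>C>0. \<forall>z. norm z < 1 \<longrightarrow> bdist (h z) \<le> C * (1 - norm z)"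
proof -
  \<comment> \<open>\<open>M\<close> from flatness, 1 as slack on the side boundary, and 1 for the
    term with \<open>A\<close>, which is at most \<open>|w - p|^(1 + \<mu>)\<close> within radius
    \<open>r1\<close>.\<close>
  define K where "K = M + 2"
  have K: "0 < K" using M by (simp add: K_def)
  obtain A where A0: "0 < A" and KA: "K \<le> A" and A: "16 * K \<le> A * \<mu> * (1 - k)\<^sup>2"
    by (rule barrier_coefficient[OF K])
  obtain r1 where r1: "0 < r1" "r1 \<le> r / 2" "\<And>x. 0 \<le> x \<Longrightarrow> x \<le> r1 \<Longrightarrow> x powr \<mu> \<le> 1 / (A * (M + 1))"
    using exists_small_powr[OF \<mu>(1), of "1 / (A * (M + 1))" "r / 2"] A0 M r by auto
  \<comment> \<open>The slack between \<open>M\<close> and \<open>M + 1\<close>: a point at radius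
    \<open>r1\<close> from \<open>p\<close> that lies above the cusp with constant
    \<open>M + 1\<close> cannot be within \<open>\<eta>\<close> of the frontier.\<close>
  have "\<exists>\<eta>>0. \<eta> < r / 2 \<and> M * (r1 + \<eta>) powr (1 + \<mu>) + \<eta> < (M + 1) * r1 powr (1 + \<mu>)"
  proof -
    have "((\<lambda>\<eta>. M * (r1 + \<eta>) powr (1 + \<mu>) + \<eta>) \<longlongrightarrow> M * (r1 + 0) powr (1 + \<mu>) + 0) (at_right 0)"
      using r1(1) by (intro tendsto_intros) auto
    moreover have "M * (r1 + 0) powr (1 + \<mu>) + 0 < (M + 1) * r1 powr (1 + \<mu>)" using r1(1) by (simp add: algebra_simps)
    ultimately have "\<forall>\<^sub>F \<eta> in at_right 0. M * (r1 + \<eta>) powr (1 + \<mu>) + \<eta> < (M + 1) * r1 powr (1 + \<mu>)"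
      by (rule order_tendstoD(2))
    moreover have "\<forall>\<^sub>F \<eta> in at_right (0::real). 0 < \<eta> \<and> \<eta> < r / 2"
      using r eventually_at_right_real[of 0 "r/2"] by simp
    ultimately have "\<forall>\<^sub>F \<eta> in at_right 0. 0 < \<eta> \<and> \<eta> < r / 2 \<and> M * (r1 + \<eta>) powr (1 + \<mu>) + \<eta> < (M + 1) * r1 powr (1 + \<mu>)"
      by eventually_elim simp
    then show ?thesis using eventually_happens'[of "at_right (0::real)"] by (auto simp: trivial_limit_at_right_real)
  qed
  then obtain \<eta> where \<eta>: "0 < \<eta>" "\<eta> < r / 2" "M * (r1 + \<eta>) powr (1 + \<mu>) + \<eta> < (M + 1) * r1 powr (1 + \<mu>)"
    by blast
  obtain \<sigma> where \<sigma>: "0 < \<sigma>" "\<And>z. norm z < 1 \<Longrightarrow> \<eta> \<le> bdist (h z) \<Longrightarrow> norm z \<le> 1 - \<sigma>"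
    using bdist_ge_imp_away[OF \<eta>(1)] by blast
  obtain \<sigma>' where \<sigma>': "0 < \<sigma>'" "\<And>z. norm z < 1 \<Longrightarrow> r1 \<le> bdist (h z) \<Longrightarrow> norm z \<le> 1 - \<sigma>'"
    using bdist_ge_imp_away[OF r1(1)] by blast
  define P where "P = r1 + A * r1 powr (1 + \<mu>)"
  have P: "0 < P" using r1 A0 by (simp add: P_def add_pos_nonneg)
  \<comment> \<open>On the part of the side boundary where \<open>\<Phi>\<close> may be positive,
    \<open>\<Phi> \<le> P\<close> while \<open>1 - |x|^2 \<ge> \<sigma>\<close>.\<close>
  define C where "C = P / \<sigma>"
  have C: "0 < C" using P \<sigma> by (simp add: C_def)
  have near: "bdist (h z) \<le> C * (1 - (norm z)\<^sup>2)"
    if z: "norm z < 1" and zd: "bdist (h z) < r1" for z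
  proof -
    define d where "d = bdist (h z)"
    have d: "0 < d" using bdist_pos[OF h_in_D[OF z]] by (simp add: d_def)
    obtain p n where pn: "p \<in> frontier D" "Holder_flat \<mu> M r D p n" "norm n = 1"
      "h z - p = d *\<^sub>R n" "norm (h z - p) = d"
      by (rule nearest_frontier_normal[OF h_in_D[OF z], folded d_def])
    define y where "y w = Re (cnj n * (w - p))" for w
    define \<Phi> where "\<Phi> w = y w - K * norm (w - p) powr (1 + \<mu>) + A * (max 0 (y w)) powr (1 + \<mu>)" for w
    define W where "W = {w. 0 < y w} \<inter> ball p r1"
    have y_cont: "continuous_on UNIV y" unfolding y_def by (intro continuous_intros)
    have y_le: "\<bar>y w\<bar> \<le> norm (w - p)" for w
      using abs_Re_cnj_mult_le[of n "w - p"] pn(3) by (simp add: y_def)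
    have \<Phi>_nonpos: "\<Phi> w \<le> 0" if w: "norm (w - p) \<le> r1" "y w \<le> (M + 1) * norm (w - p) powr (1 + \<mu>)" for w
    proof -
      define \<rho> where "\<rho> = norm (w - p)"
      have \<rho>: "0 \<le> \<rho>" "\<rho> \<le> r1" using w(1) by (auto simp: \<rho>_def)
      have m1: "max 0 (y w) \<le> (M + 1) * \<rho> powr (1 + \<mu>)" using w(2) M by (simp add: \<rho>_def)
      have m2: "max 0 (y w) \<le> \<rho>" using y_le[of w] by (simp add: \<rho>_def)
      have "A * (max 0 (y w)) powr (1 + \<mu>) = A * (max 0 (y w) * (max 0 (y w)) powr \<mu>)"
        by (cases "max 0 (y w) = 0") (simp_all add: powr_add)
      also have "\<dots> \<le> A * (((M + 1) * \<rho> powr (1 + \<mu>)) * \<rho> powr \<mu>)"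
        using A0 m1 m2 \<mu> M by (intro mult_left_mono mult_mono powr_mono2) auto
      also have "\<dots> = (A * (M + 1) * \<rho> powr \<mu>) * \<rho> powr (1 + \<mu>)" by simp
      also have "\<dots> \<le> 1 * \<rho> powr (1 + \<mu>)"
      proof (rule mult_right_mono)
        have "A * (M + 1) * \<rho> powr \<mu> \<le> A * (M + 1) * (1 / (A * (M + 1)))"
          using r1(3)[OF \<rho>] A0 M by (intro mult_left_mono) auto
        also have "\<dots> = 1" using A0 M by simp
        finally show "A * (M + 1) * \<rho> powr \<mu> \<le> 1" .
      qed simp
      finally have "A * (max 0 (y w)) powr (1 + \<mu>) \<le> \<rho> powr (1 + \<mu>)" by simp
      moreover have "y w \<le> (M + 1) * \<rho> powr (1 + \<mu>)" using w(2) by (simp add: \<rho>_def)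
      ultimately show ?thesis by (simp add: \<Phi>_def K_def \<rho>_def[symmetric] algebra_simps)
    qed
    have clW: "y w \<ge> 0" "norm (w - p) \<le> r1" if "w \<in> closure W" for w
    proof -
      have "closed ({w. 0 \<le> y w} \<inter> cball p r1)"
        using y_cont by (intro closed_Int closed_Collect_le continuous_intros) auto
      then have "closure W \<subseteq> {w. 0 \<le> y w} \<inter> cball p r1"
        by (intro closure_minimal) (auto simp: W_def)
      then show "y w \<ge> 0" "norm (w - p) \<le> r1" using that by (auto simp: dist_norm norm_minus_commute)
    qed
    have Cb: "0 \<le> C * (1 - (norm x)\<^sup>2)" if "norm x \<le> 1" for x
      using C that by (simp add: power_le_one)
    \<comment> \<open>The majorant vanishes on the unit circle and is strictly superharmonic, which
      supplies the strictness in \<open>barrier_no_local_max\<close>. Taking R = -1 removes the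
      inner circle.\<close>
    have "\<Phi> (h z) \<le> C * (1 - (norm z)\<^sup>2)"
    proof (rule comparison_principle[where W=W and R="-1"])
      show "continuous_on UNIV \<Phi>" unfolding \<Phi>_def
        using y_cont \<mu> by (intro continuous_intros continuous_on_powr' continuous_on_max) auto
      show "continuous_on {z. -1 \<le> norm z \<and> norm z \<le> 1} (\<lambda>z. C * (1 - (norm z)\<^sup>2))" by (intro continuous_intros)
      show "open W" unfolding W_def using y_cont by (intro open_Int open_Collect_less continuous_intros) auto
      show "norm z < 1" "-1 < norm z" using z by (auto intro: less_le_trans[of _ 0])
      have "y (h z) = d" unfolding y_def pn(4) using Re_cnj_mult_self[of n] pn(3) by (simp add: algebra_simps)
      then show "h z \<in> W" using d zd pn(5) by (simp add: W_def d_def dist_norm norm_minus_commute)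
    next
      fix q x assume q: "q \<in> frontier D" "q \<in> closure W" and x: "norm x = (1::real)"
      have "y q \<le> M * norm (q - p) powr (1 + \<mu>)"
        unfolding y_def using Holder_flat_frontier[OF pn(2) D(1) q(1)] clW(2)[OF q(2)] r1 by simp
      also have "\<dots> \<le> (M + 1) * norm (q - p) powr (1 + \<mu>)" by (intro mult_right_mono) auto
      finally have "\<Phi> q \<le> 0" by (intro \<Phi>_nonpos clW(2) q(2))
      then show "\<Phi> q \<le> C * (1 - (norm x)\<^sup>2)" using x by simp
    next
      fix x :: complex assume x: "norm x < 1" "h x \<in> closure W" "norm x = -1 \<or> h x \<notin> W"
      then have nW: "h x \<notin> W" using norm_ge_zero[of x] by linarith
      note cl = clW[OF x(2)]
      show "\<Phi> (h x) \<le> C * (1 - (norm x)\<^sup>2)"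
      proof (cases "y (h x) \<le> (M + 1) * norm (h x - p) powr (1 + \<mu>)")
        case True
        then show ?thesis using \<Phi>_nonpos[OF cl(2)] Cb[of x] x(1) by simp
      next
        case False
        have "y (h x) > 0" using False M by (smt (verit) mult_nonneg_nonneg powr_ge_zero)
        then have rho: "norm (h x - p) = r1" using nW cl by (simp add: W_def dist_norm norm_minus_commute)
        have "\<eta> \<le> bdist (h x)"
        proof (rule ccontr)
          assume less: "\<not> \<eta> \<le> bdist (h x)"
          obtain q where q: "q \<in> frontier D" "norm (h x - q) < \<eta>"
            using less bdist_attained[of "h x"] by (metis not_le)
          have qp: "norm (q - p) \<le> r1 + \<eta>"
            using norm_triangle_ineq[of "q - h x" "h x - p"] q(2) rho by (simp add: norm_minus_commute)
          have "y (h x) = y q + Re (cnj n * (h x - q))" by (simp add: y_def algebra_simps)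
          also have "\<dots> \<le> M * norm (q - p) powr (1 + \<mu>) + \<eta>"
            using Holder_flat_frontier[OF pn(2) D(1) q(1)] qp \<eta>(2) r1(2) abs_Re_cnj_mult_le[of n "h x - q"] pn(3) q(2)
            by (simp add: y_def)
          also have "\<dots> \<le> M * (r1 + \<eta>) powr (1 + \<mu>) + \<eta>"
            using qp M \<mu> by (intro add_right_mono mult_left_mono powr_mono2) auto
          also have "\<dots> < (M + 1) * r1 powr (1 + \<mu>)" by (rule \<eta>(3))
          finally show False using False rho by simp
        qed
        then have "norm x \<le> 1 - \<sigma>" by (rule \<sigma>(2)[OF x(1)])
        then have "\<sigma> \<le> 1 - norm x" by simp
        also have "\<dots> \<le> 1 - (norm x)\<^sup>2" using x(1) by (simp add: power2_eq_square mult_left_le)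
        finally have "C * \<sigma> \<le> C * (1 - (norm x)\<^sup>2)" using C by (intro mult_left_mono) auto
        moreover have "C * \<sigma> = P" using \<sigma>(1) by (simp add: C_def)
        moreover have "\<Phi> (h x) \<le> P"
        proof -
          have y1: "y (h x) \<le> r1" using y_le[of "h x"] rho by simp
          have "(max 0 (y (h x))) powr (1 + \<mu>) \<le> r1 powr (1 + \<mu>)" using y1 r1(1) \<mu> by (intro powr_mono2) auto
          then have "A * (max 0 (y (h x))) powr (1 + \<mu>) \<le> A * r1 powr (1 + \<mu>)" using A0 by (intro mult_left_mono) auto
          moreover have "0 \<le> K * norm (h x - p) powr (1 + \<mu>)" using K by simp
          ultimately show ?thesis using y1 by (simp add: \<Phi>_def P_def)
        qed
        ultimately show ?thesis by simp
      qed
    next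
      fix x :: complex assume x: "norm x < 1" "h x \<in> W"
      have j: "jet2 (\<lambda>t. C * (norm (x + of_real t * v))\<^sup>2 + (- C)) (C * (2 * Re (cnj x * v)) + 0) (C * (2 * (norm v)\<^sup>2) + 0)" for v
        by (intro jet2_add jet2_cmult jet2_norm_power2 jet2_const)
      have "\<not> (\<forall>\<^sub>F x' in nhds x. Re (cnj n * (h x' - p)) - K * norm (h x' - p) powr (1 + \<mu>)
          + A * (max 0 (Re (cnj n * (h x' - p)))) powr (1 + \<mu>) + (C * (norm x')\<^sup>2 + (- C))
        \<le> Re (cnj n * (h x - p)) - K * norm (h x - p) powr (1 + \<mu>)
          + A * (max 0 (Re (cnj n * (h x - p)))) powr (1 + \<mu>) + (C * (norm x)\<^sup>2 + (- C)))"
        by (rule barrier_no_local_max[OF x(1) \<mu> _ _ _ A _ _ j j])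
          (use pn(3) K A0 x(2) C in \<open>auto simp: W_def y_def\<close>)
      then show "\<not> (\<forall>\<^sub>F x' in nhds x. \<Phi> (h x') - C * (1 - (norm x')\<^sup>2) \<le> \<Phi> (h x) - C * (1 - (norm x)\<^sup>2))"
        by (simp add: \<Phi>_def y_def algebra_simps)
    qed
    moreover have "d \<le> \<Phi> (h z)"
    proof -
      have "y (h z) = d" unfolding y_def pn(4) using Re_cnj_mult_self[of n] pn(3) by (simp add: algebra_simps)
      \<comment> \<open>On the axis \<open>y\<close> and \<open>|w - p|\<close> both equal
        \<open>d\<close>, so \<open>K \<le> A\<close> makes the two powers harmless.\<close>
      moreover have "K * d powr (1 + \<mu>) \<le> A * d powr (1 + \<mu>)" using KA by (intro mult_right_mono) auto
      ultimately show ?thesis using d pn(5) by (simp add: \<Phi>_def)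
    qed
    ultimately show ?thesis by (simp add: d_def)
  qed
  obtain B where B: "\<And>w. w \<in> D \<Longrightarrow> bdist w \<le> B" "0 < B"
  proof -
    obtain p where p: "p \<in> frontier D" using frontier_nonempty by blast
    obtain B0 where B0: "\<And>w. w \<in> D \<Longrightarrow> norm w \<le> B0" "0 < B0" using D(2) bounded_pos by metis
    show thesis
    proof (rule that[of "B0 + norm p"])
      show "bdist w \<le> B0 + norm p" if "w \<in> D" for w
        using infdist_le[OF p, of w] norm_triangle_ineq4[of w p] B0(1)[OF that] by (simp add: dist_norm)
    qed (use B0(2) in \<open>simp add: add_pos_nonneg\<close>)
  qed
  show ?thesis
  proof (intro exI[of _ "max (2 * C) (B / \<sigma>')"] conjI allI impI)
    show "0 < max (2 * C) (B / \<sigma>')" using C by simp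
    fix z :: complex assume z: "norm z < 1"
    show "bdist (h z) \<le> max (2 * C) (B / \<sigma>') * (1 - norm z)"
    proof (cases "bdist (h z) < r1")
      case True
      have "bdist (h z) \<le> C * (1 - (norm z)\<^sup>2)" by (rule near[OF z True])
      also have "\<dots> = C * (1 + norm z) * (1 - norm z)" by (simp add: power2_eq_square algebra_simps)
      also have "\<dots> \<le> max (2 * C) (B / \<sigma>') * (1 - norm z)"
        using z C by (intro mult_right_mono) (auto intro: max.coboundedI1)
      finally show ?thesis .
    next
      case False
      then have "\<sigma>' \<le> 1 - norm z" using \<sigma>'(2)[OF z] by simp
      have "bdist (h z) \<le> B / \<sigma>' * \<sigma>'" using B(1)[OF h_in_D[OF z]] \<sigma>'(1) by simp
      also have "\<dots> \<le> max (2 * C) (B / \<sigma>') * (1 - norm z)"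
        using \<open>\<sigma>' \<le> 1 - norm z\<close> \<sigma>'(1) B(2) C by (intro mult_mono) (auto simp: le_max_iff_disj)
      finally show ?thesis .
    qed
  qed
qed

end

context planar_hqc_flat
begin

text \<open>Lower barrier \<open>y + K |w|^(1 + \<mu>) - A (y + \<epsilon> |x|)^(1 + \<mu>)\<close>, with \<open>x\<close> the tangential coordinate. The term \<open>\<epsilon> |x|\<close>
  keeps the base of the last power positive on the part of \<open>D\<close> below the tangent line; the barrier is the
  minimum of the two smooth functions obtained by replacing \<open>|x|\<close> with \<open>x\<close> and \<open>- x\<close>.\<close>

lemma dist_frontier_lower:
  "\<exists>c>0. \<forall>z. norm z < 1 \<longrightarrow> c * (1 - norm z) \<le> bdist (h z)"
proof -
  \<comment> \<open>Near the tangent, flatness and the term with \<open>A\<close> cost at most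
    \<open>M |w - p|^(1 + \<mu>)\<close> each; 4 M leaves 2 M, the coefficient in
    \<open>\<beta>\<close>.\<close>
  define K where "K = 4 * M"
  have K: "0 < K" using M by (simp add: K_def)
  obtain A where A0: "0 < A" and A: "16 * K \<le> A * \<mu> * (1 - k)\<^sup>2"
    by (rule barrier_coefficient[OF K])
  \<comment> \<open>\<open>2 A \<epsilon> \<le> M\<close> limits the cost of the last power where
    its base is at most \<open>2 \<epsilon> |w - p|\<close>; \<open>\<epsilon> \<le> 1/2\<close>
    keeps the slanted direction \<open>a\<close> below norm 2.\<close>
  define \<epsilon> where "\<epsilon> = min (1/2) (M / (2 * A))"
  have \<epsilon>: "0 < \<epsilon>" "\<epsilon> \<le> 1/2" "2 * A * \<epsilon> \<le> M"
  proof -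
    show "0 < \<epsilon>" "\<epsilon> \<le> 1/2" using M A0 by (auto simp: \<epsilon>_def)
    have "2 * A * \<epsilon> \<le> 2 * A * (M / (2 * A))" using A0 by (intro mult_left_mono) (auto simp: \<epsilon>_def)
    then show "2 * A * \<epsilon> \<le> M" using A0 by simp
  qed
  obtain r2 where r2: "0 < r2" "r2 \<le> min r 1" "\<And>x. 0 \<le> x \<Longrightarrow> x \<le> r2 \<Longrightarrow> x powr \<mu> \<le> min (\<epsilon> / (4 * M)) (\<epsilon> / (4 * A))"
    using exists_small_powr[OF \<mu>(1), of "min (\<epsilon> / (4 * M)) (\<epsilon> / (4 * A))" "min r 1"] A0 M r \<epsilon> by auto
  \<comment> \<open>Halved because the base of the last power can reach
    \<open>2 |w - p|\<close>.\<close>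
  define r1 where "r1 = r2 / 2"
  have r1: "0 < r1" "r1 \<le> r / 2" "r1 \<le> 1" using r2 by (auto simp: r1_def)
  have r1M: "M * x powr \<mu> \<le> \<epsilon> / 4" "A * x powr \<mu> \<le> \<epsilon> / 4" if "0 \<le> x" "x \<le> 2 * r1" for x
  proof -
    have "x powr \<mu> \<le> \<epsilon> / (4 * M)" "x powr \<mu> \<le> \<epsilon> / (4 * A)" using r2(3)[of x] that by (auto simp: r1_def)
    then show "M * x powr \<mu> \<le> \<epsilon> / 4" "A * x powr \<mu> \<le> \<epsilon> / 4"
      using M A0 by (simp_all add: field_simps)
  qed
  have contd: "continuous_on (cball 0 (1/2)) (\<lambda>z. bdist (h z))"
    by (intro continuous_intros continuous_on_subset[OF h_continuous]) auto
  have "\<exists>x\<in>cball 0 (1/2). \<forall>y\<in>cball 0 (1/2). bdist (h x) \<le> bdist (h y)"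
    by (rule continuous_attains_inf[OF _ _ contd]) auto
  then obtain x0 where x0: "x0 \<in> cball 0 (1/2)" "\<And>y. norm y \<le> 1/2 \<Longrightarrow> bdist (h x0) \<le> bdist (h y)"
    by force
  define \<eta> where "\<eta> = bdist (h x0)"
  have \<eta>: "0 < \<eta>" using bdist_pos[OF h_in_D[of x0]] x0(1) by (simp add: \<eta>_def)
  \<comment> \<open>On the remaining boundary \<open>h x\<close> is at distance at least
    \<open>\<rho>0\<close> from \<open>p\<close>: either it lies on the circle of radius
    \<open>r1\<close>, or \<open>|x| = 1/2\<close> and its distance to the frontier is at least
    \<open>\<eta>\<close>.\<close>
  define \<rho>0 where "\<rho>0 = min r1 \<eta>"
  have \<rho>0: "0 < \<rho>0" using r1 \<eta> by (simp add: \<rho>0_def)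
  \<comment> \<open>The two entries are the lower bounds for the barrier near the tangent and well
    above it.\<close>
  define \<beta> where "\<beta> \<rho> = min (2 * M * \<rho> powr (1 + \<mu>)) (\<epsilon> * \<rho> / 2)" for \<rho>
  have \<beta>_mono: "\<beta> x \<le> \<beta> y" if "0 \<le> x" "x \<le> y" for x y
    unfolding \<beta>_def using that M \<epsilon> \<mu> by (intro min.mono mult_left_mono powr_mono2 divide_right_mono) auto
  define c where "c = \<beta> \<rho>0 / 3"
  have c: "0 < c" using \<rho>0 M \<epsilon> by (simp add: c_def \<beta>_def)
  have near: "c * (1 - norm z) \<le> (1 + K) * bdist (h z)"
    if z: "norm z < 1" "1/2 < norm z" and zd: "bdist (h z) < r1" for z
  proof -
    define d where "d = bdist (h z)"
    have d: "0 < d" using bdist_pos[OF h_in_D[OF z(1)]] by (simp add: d_def)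
    obtain p n where pn: "p \<in> frontier D" "Holder_flat \<mu> M r D p n" "norm n = 1"
      "h z - p = d *\<^sub>R n" "norm (h z - p) = d"
      by (rule nearest_frontier_normal[OF h_in_D[OF z(1)], folded d_def])
    define y where "y w = Re (cnj n * (w - p))" for w
    define x where "x w = Im (cnj n * (w - p))" for w
    define \<Phi> where "\<Phi> w = y w + K * norm (w - p) powr (1 + \<mu>) - A * (max 0 (y w + \<epsilon> * \<bar>x w\<bar>)) powr (1 + \<mu>)" for w
    have cont: "continuous_on UNIV y" "continuous_on UNIV x" unfolding y_def x_def by (intro continuous_intros)+
    have norm_xy: "norm (w - p) = norm (Complex (y w) (x w))" for w
    proof -
      have "Complex (y w) (x w) = cnj n * (w - p)" by (simp only: y_def x_def complex.collapse)
      then show ?thesis using pn(3) by (simp add: norm_mult)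
    qed
    have xy_le: "\<bar>y w\<bar> \<le> norm (w - p)" "\<bar>x w\<bar> \<le> norm (w - p)" "norm (w - p) \<le> \<bar>y w\<bar> + \<bar>x w\<bar>" for w
      unfolding norm_xy using abs_Re_le_cmod[of "Complex (y w) (x w)"] abs_Im_le_cmod[of "Complex (y w) (x w)"]
        cmod_le[of "Complex (y w) (x w)"] by auto
    have y_ge: "- (\<epsilon> / 4) * norm (w - p) \<le> y w" "- M * norm (w - p) powr (1 + \<mu>) \<le> y w"
      if w: "w \<in> closure D" "norm (w - p) \<le> r1" for w
    proof -
      have "- M * norm (w - p) powr (1 + \<mu>) \<le> y w"
        unfolding y_def by (rule Holder_flat_closure[OF pn(2) \<mu>(1) w(1)])
      moreover have "M * norm (w - p) powr (1 + \<mu>) = norm (w - p) * (M * norm (w - p) powr \<mu>)"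
        by (cases "w = p") (simp_all add: powr_add)
      moreover have "norm (w - p) * (M * norm (w - p) powr \<mu>) \<le> norm (w - p) * (\<epsilon> / 4)"
        using r1M(1)[of "norm (w - p)"] w(2) r1(1) by (intro mult_left_mono) auto
      ultimately show "- M * norm (w - p) powr (1 + \<mu>) \<le> y w" "- (\<epsilon> / 4) * norm (w - p) \<le> y w"
        by (linarith, simp add: mult.commute)
    qed
    have \<Phi>_ge: "\<beta> (norm (w - p)) \<le> \<Phi> w" if w: "w \<in> closure D" "norm (w - p) \<le> r1" for w
    proof -
      define \<rho> where "\<rho> = norm (w - p)"
      define S where "S = max 0 (y w + \<epsilon> * \<bar>x w\<bar>)"
      have \<rho>: "0 \<le> \<rho>" "\<rho> \<le> r1" using w by (auto simp: \<rho>_def)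
      have x1: "\<epsilon> * \<bar>x w\<bar> \<le> \<epsilon> * \<rho>" using xy_le(2)[of w] \<epsilon>(1) by (intro mult_left_mono) (auto simp: \<rho>_def)
      have S_powr: "A * S powr (1 + \<mu>) = S * (A * S powr \<mu>)"
        by (cases "S = 0") (simp_all add: powr_add S_def)
      have S0: "0 \<le> S" by (simp add: S_def)
      have K\<rho>: "0 \<le> K * \<rho> powr (1 + \<mu>)" using K by simp
      show ?thesis
      proof (cases "y w \<le> \<epsilon> * \<rho>")
        case True
        have S1: "S \<le> 2 * \<epsilon> * \<rho>" 
        proof -
          have "0 \<le> 2 * \<epsilon> * \<rho>" using \<epsilon> \<rho> by simp
          moreover have "y w + \<epsilon> * \<bar>x w\<bar> \<le> 2 * \<epsilon> * \<rho>" using True x1 by linarith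
          ultimately show ?thesis by (simp add: S_def)
        qed
        also have "\<dots> \<le> 1 * \<rho>" using \<epsilon> \<rho> by (intro mult_right_mono) auto
        finally have S2: "S \<le> \<rho>" by simp
        have "S * (A * S powr \<mu>) \<le> (2 * \<epsilon> * \<rho>) * (A * \<rho> powr \<mu>)"
          using S1 S2 S0 A0 \<mu> \<epsilon> \<rho> by (intro mult_mono powr_mono2) auto
        also have "\<dots> = (2 * A * \<epsilon>) * (\<rho> * \<rho> powr \<mu>)" by simp
        also have "\<dots> \<le> M * (\<rho> * \<rho> powr \<mu>)" using \<epsilon>(3) \<rho> by (intro mult_right_mono) auto
        also have "\<rho> * \<rho> powr \<mu> = \<rho> powr (1 + \<mu>)" using \<rho>(1) by (cases "\<rho> = 0") (simp_all add: powr_add)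
        finally have "A * S powr (1 + \<mu>) \<le> M * \<rho> powr (1 + \<mu>)" using S_powr by linarith
        moreover have "- (M * \<rho> powr (1 + \<mu>)) \<le> y w" using y_ge(2)[OF w] by (simp add: \<rho>_def)
        ultimately have "2 * (M * \<rho> powr (1 + \<mu>)) \<le> \<Phi> w"
          unfolding \<Phi>_def S_def[symmetric] \<rho>_def[symmetric] K_def by linarith
        then show ?thesis by (simp add: \<beta>_def \<rho>_def min.coboundedI1)
      next
        case False
        have "S \<le> \<rho> + \<epsilon> * \<rho>" 
        proof -
          have "0 \<le> \<rho> + \<epsilon> * \<rho>" using \<epsilon> \<rho> by simp
          moreover have "y w + \<epsilon> * \<bar>x w\<bar> \<le> \<rho> + \<epsilon> * \<rho>" using xy_le(1)[of w] x1 unfolding \<rho>_def by linarith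
          ultimately show ?thesis by (simp add: S_def)
        qed
        also have "\<dots> \<le> \<rho> + 1 * \<rho>" using \<epsilon> \<rho> by (intro add_left_mono mult_right_mono) auto
        finally have S1: "S \<le> 2 * \<rho>" by simp
        have "S * (A * S powr \<mu>) \<le> (2 * \<rho>) * (\<epsilon> / 4)"
          using S1 S0 A0 \<rho> r1M(2)[of S] by (intro mult_mono) auto
        moreover have "(2 * \<rho>) * (\<epsilon> / 4) = \<epsilon> * \<rho> / 2" by simp
        ultimately have "A * S powr (1 + \<mu>) \<le> \<epsilon> * \<rho> / 2" using S_powr by linarith
        then have "\<epsilon> * \<rho> / 2 \<le> \<Phi> w" unfolding \<Phi>_def S_def[symmetric] \<rho>_def[symmetric] using False K\<rho> by linarith
        then show ?thesis by (simp add: \<beta>_def \<rho>_def min.coboundedI2)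
      qed
    qed
    have b0: "0 \<le> \<beta> \<rho>" if "0 \<le> \<rho>" for \<rho> using M \<epsilon> that by (simp add: \<beta>_def)
    \<comment> \<open>\<open>- b\<close> vanishes on the unit circle, is subharmonic away from 0
      (whence the annulus R = 1/2), and is at most 3 c for \<open>|x| \<ge> 1/2\<close>; this
      explains the third in \<open>c\<close>.\<close>
    define b where "b x = - (c * ((norm x)\<^sup>2 powr (-1)) + (- c))" for x :: complex
    have "- \<Phi> (h z) \<le> b z"
    proof (rule comparison_principle[where W="ball p r1" and R="1/2" and \<Phi>="\<lambda>w. - \<Phi> w"])
      show "continuous_on UNIV (\<lambda>w. - \<Phi> w)" unfolding \<Phi>_def
        using cont \<mu> by (intro continuous_intros continuous_on_powr' continuous_on_max) auto
      show "continuous_on {z. 1/2 \<le> norm z \<and> norm z \<le> 1} b" unfolding b_def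
        by (intro continuous_intros continuous_on_powr) auto
      show "h z \<in> ball p r1" using zd pn(5) by (simp add: d_def dist_norm norm_minus_commute)
    next
      fix q x :: complex assume q: "q \<in> frontier D" "q \<in> closure (ball p r1)" and x: "norm x = 1"
      have "q \<in> closure D" "norm (q - p) \<le> r1"
        using q r1(1) by (auto simp: frontier_def dist_norm norm_minus_commute)
      then have "0 \<le> \<Phi> q" using \<Phi>_ge[of q] b0[of "norm (q - p)"] by simp
      then show "- \<Phi> q \<le> b x" using x by (simp add: b_def)
    next
      fix x :: complex assume x: "norm x < 1" "1/2 \<le> norm x" "h x \<in> closure (ball p r1)" "norm x = 1/2 \<or> h x \<notin> ball p r1"
      have le: "norm (h x - p) \<le> r1" using x(3) r1(1) by (simp add: dist_norm norm_minus_commute)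
      have ge: "\<rho>0 \<le> norm (h x - p)"
      proof (cases "norm x = 1/2")
        case True
        then have "\<eta> \<le> bdist (h x)" using x0(2)[of x] by (simp add: \<eta>_def)
        also have "\<dots> \<le> norm (h x - p)" using infdist_le[OF pn(1), of "h x"] by (simp add: dist_norm)
        finally show ?thesis by (simp add: \<rho>0_def)
      next
        case False
        then show ?thesis using x(4) by (simp add: \<rho>0_def dist_norm norm_minus_commute)
      qed
      have "3 * c = \<beta> \<rho>0" by (simp add: c_def)
      also have "\<dots> \<le> \<beta> (norm (h x - p))" using ge \<rho>0 by (intro \<beta>_mono) auto
      also have "\<dots> \<le> \<Phi> (h x)" using h_in_D[OF x(1)] closure_subset le by (intro \<Phi>_ge) auto
      finally have "3 * c \<le> \<Phi> (h x)" .
      moreover have "c * ((norm x)\<^sup>2 powr (-1)) \<le> c * 4"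
      proof (rule mult_left_mono)
        have "(1/2)\<^sup>2 \<le> (norm x)\<^sup>2" using x(2) by (intro power_mono) auto
        then have "1/4 \<le> (norm x)\<^sup>2" by (simp add: power2_eq_square)
        then have "(norm x)\<^sup>2 powr (-1) \<le> (1/4) powr (-1)" by (intro powr_mono2') auto
        also have "(1/4::real) powr (-1) = 4" by (simp add: powr_minus)
        finally show "(norm x)\<^sup>2 powr (-1) \<le> 4" .
      qed (use c in simp)
      ultimately show "- \<Phi> (h x) \<le> b x" by (simp add: b_def)
    next
      fix x' assume x': "norm x' < 1" "1/2 < norm x'" "h x' \<in> ball p r1"
      define w where "w = h x'"
      have w: "w \<in> D" "w \<in> closure D" "norm (w - p) \<le> r1" "norm (w - p) > 0"
      proof -
        show "w \<in> D" using h_in_D[OF x'(1)] by (simp add: w_def)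
        then show "w \<in> closure D" using closure_subset by blast
        show "norm (w - p) \<le> r1" using x'(3) by (simp add: w_def dist_norm norm_minus_commute)
        have "p \<notin> D" using pn(1) D(1) by (simp add: frontier_def interior_open)
        then show "norm (w - p) > 0" using \<open>w \<in> D\<close> by auto
      qed
      \<comment> \<open>The branch of \<open>|x|\<close> active at the tested point. The smooth
        function \<open>m\<close> built from it lies below \<open>- \<Phi> \<circ> h - b\<close> and
        touches it there, so it inherits a local maximum, which the barrier lemma excludes.\<close>
      define s where "s = (if 0 \<le> x w then 1 else - 1 :: real)"
      have s: "s = 1 \<or> s = -1" "\<bar>x w\<bar> = s * x w" by (auto simp: s_def)
      define a where "a = n * (1 + \<i> * of_real (\<epsilon> * s))"
      have a_eq: "Re (cnj a * (v - p)) = y v + \<epsilon> * (s * x v)" for v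
        by (simp add: a_def y_def x_def algebra_simps)
      have na: "1 \<le> norm a" "norm a \<le> 2"
      proof -
        have na: "norm a = norm (1 + \<i> * of_real (\<epsilon> * s))" using pn(3) by (simp add: a_def norm_mult)
        show "1 \<le> norm a" unfolding na using abs_Re_le_cmod[of "1 + \<i> * of_real (\<epsilon> * s)"] by simp
        have "norm a \<le> 1 + norm (\<i> * of_real (\<epsilon> * s) :: complex)" unfolding na using norm_triangle_ineq[of 1] by (metis norm_one)
        also have "\<dots> \<le> 2" using s(1) \<epsilon> by (auto simp: norm_mult)
        finally show "norm a \<le> 2" .
      qed
      have pos: "0 < Re (cnj a * (w - p))"
      proof -
        \<comment> \<open>Below the tangent, \<open>|y|\<close> is at most
          \<open>\<epsilon> / 4\<close> times the distance to \<open>p\<close>, so the tangential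
          coordinate exceeds half of that distance and its contribution dominates.\<close>
        have "0 < y w + \<epsilon> * \<bar>x w\<bar>"
        proof (cases "0 < y w")
          case True
          then show ?thesis using \<epsilon>(1) by (simp add: add_pos_nonneg)
        next
          case False
          have yw: "- (\<epsilon> / 4) * norm (w - p) \<le> y w" by (rule y_ge(1)[OF w(2,3)])
          have "\<epsilon> / 4 * norm (w - p) \<le> 1/8 * norm (w - p)" using \<epsilon>(2) by (intro mult_right_mono) auto
          then have "norm (w - p) / 2 < \<bar>x w\<bar>" using xy_le(3)[of w] yw False w(4) by (simp only: minus_mult_left[symmetric])
          then have "\<epsilon> * (norm (w - p) / 2) < \<epsilon> * \<bar>x w\<bar>" using \<epsilon>(1) by (intro mult_strict_left_mono) auto
          moreover have "0 < \<epsilon> * norm (w - p)" using \<epsilon>(1) w(4) by simp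
          ultimately show ?thesis using yw by simp
        qed
        then show ?thesis unfolding a_eq using s(2) by simp
      qed
      define m where "m x = Re (cnj (- n) * (h x - p)) - K * norm (h x - p) powr (1 + \<mu>)
          + A * (max 0 (Re (cnj a * (h x - p)))) powr (1 + \<mu>) + (c * ((norm x)\<^sup>2 powr (-1)) + (- c))" for x
      have N: "0 < (norm (x' + of_real 0 * v))\<^sup>2" for v using x'(2) by auto
      define N where "N = (norm x')\<^sup>2"
      have N0: "0 < N" using x'(2) by (auto simp: N_def)
      define sec where "sec v = - 1 * N powr (-2) * (2 * (norm v)\<^sup>2) + (-1) * (-2) * N powr (-3) * (2 * Re (cnj x' * v))\<^sup>2" for v
      have jet: "jet2 (\<lambda>t. c * ((norm (x' + of_real t * v))\<^sup>2 powr (-1)) + (- c))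
          (c * (- 1 * N powr (-2) * (2 * Re (cnj x' * v))) + 0) (c * sec v + 0)" for v
        using jet2_add[OF jet2_cmult[OF jet2_powr[where q="-1", OF jet2_norm_power2[of x' v] N[of v]], of c] jet2_const[of "-c"]]
        by (simp add: N_def sec_def)
      have secsum: "sec 1 + sec \<i> = 4 * N powr (-2)"
      proof -
        define Q where "Q v = (2 * Re (cnj x' * v))\<^sup>2" for v
        have "Q 1 + Q \<i> = 4 * N"
          by (simp add: Q_def N_def cmod_power2 power_mult_distrib)
        moreover have "sec 1 + sec \<i> = - 4 * N powr (-2) + 2 * N powr (-3) * (Q 1 + Q \<i>)"
          unfolding sec_def Q_def[symmetric] by (simp add: algebra_simps)
        ultimately have "sec 1 + sec \<i> = - 4 * N powr (-2) + 8 * (N powr (-3) * N)" by simp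
        moreover have "N powr (-3) * N = N powr (-2)" using N0 powr_add[of N "-3" 1] by simp
        ultimately show ?thesis by simp
      qed
      have "\<not> (\<forall>\<^sub>F v in nhds x'. m v \<le> m x')"
        unfolding m_def
      proof (rule barrier_no_local_max[OF x'(1) \<mu> na _ A _ _ jet jet])
        show "0 \<le> K" "0 \<le> A" using K A0 by auto
        show "0 < Re (cnj a * (h x' - p))" using pos by (simp add: w_def)
        show "0 < c * sec 1 + 0 + (c * sec \<i> + 0)"
          using c N0 secsum by (simp add: distrib_left[symmetric])
      qed
      moreover have m_le: "m v \<le> - \<Phi> (h v) - b v" for v
      proof -
        have "Re (cnj a * (h v - p)) \<le> y (h v) + \<epsilon> * \<bar>x (h v)\<bar>"
          unfolding a_eq using s(1) \<epsilon>(1) by (auto intro!: mult_left_mono)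
        then have "A * (max 0 (Re (cnj a * (h v - p)))) powr (1 + \<mu>) \<le> A * (max 0 (y (h v) + \<epsilon> * \<bar>x (h v)\<bar>)) powr (1 + \<mu>)"
          using A0 \<mu> by (intro mult_left_mono powr_mono2 max.mono) auto
        moreover have "Re (cnj (- n) * (h v - p)) = - y (h v)" by (simp add: y_def)
        ultimately show ?thesis unfolding m_def \<Phi>_def b_def by linarith
      qed
      moreover have m_eq: "m x' = - \<Phi> (h x') - b x'"
      proof -
        have e1: "Re (cnj a * (h x' - p)) = y (h x') + \<epsilon> * \<bar>x (h x')\<bar>"
          unfolding a_eq using s(2) by (simp add: w_def)
        have e2: "Re (cnj (- n) * (h x' - p)) = - y (h x')" by (simp add: y_def)
        show ?thesis unfolding m_def \<Phi>_def b_def e1 e2 by simp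
      qed
      ultimately show "\<not> (\<forall>\<^sub>F v in nhds x'. - \<Phi> (h v) - b v \<le> - \<Phi> (h x') - b x')"
        by (metis (mono_tags, lifting) eventually_mono order_trans)
    qed (use z in auto)
    moreover have "\<Phi> (h z) \<le> (1 + K) * d"
    proof -
      have cn: "cnj n * (h z - p) = of_real d"
        unfolding pn(4) using pn(3) complex_norm_square[of n] by (simp add: scaleR_conv_of_real mult.commute mult.left_commute)
      have "d powr (1 + \<mu>) = d * d powr \<mu>" using d by (simp add: powr_add)
      also have "\<dots> \<le> d * 1" using d zd r1(3) \<mu> by (intro mult_left_mono) (auto simp: d_def intro: powr_le1)
      finally have "K * d powr (1 + \<mu>) \<le> K * d" using K by simp
      moreover have "0 \<le> A * (max 0 (y (h z) + \<epsilon> * \<bar>x (h z)\<bar>)) powr (1 + \<mu>)" using A0 by simp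
      moreover have yz: "y (h z) = d" unfolding y_def cn by simp
      ultimately show ?thesis unfolding \<Phi>_def pn(5) yz distrib_right by linarith
    qed
    moreover have "c * (1 - norm z) \<le> - b z"
    proof -
      have nz: "0 < norm z" using z by auto
      have "1 - norm z \<le> (norm z)\<^sup>2 powr (-1) - 1"
      proof -
        have "(norm z)\<^sup>2 \<le> 1" using z(1) by (simp add: power_le_one)
        then have "1 \<le> (norm z)\<^sup>2 powr (-1)" using nz by (simp add: powr_minus one_le_inverse)
        moreover have "(2 - norm z) * (norm z)\<^sup>2 \<le> 1"
        proof -
          have "1 - (2 - norm z) * (norm z)\<^sup>2 = (1 - norm z) * (1 + norm z * (1 - norm z))"
            by (simp add: power2_eq_square algebra_simps)
          moreover have "0 \<le> (1 - norm z) * (1 + norm z * (1 - norm z))" using z nz by auto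
          ultimately show ?thesis by simp
        qed
        then have "2 - norm z \<le> (norm z)\<^sup>2 powr (-1)" using nz by (simp add: powr_minus field_simps)
        ultimately show ?thesis by simp
      qed
      then have "c * (1 - norm z) \<le> c * ((norm z)\<^sup>2 powr (-1) - 1)" using c by (intro mult_left_mono) auto
      then show ?thesis by (simp add: b_def right_diff_distrib)
    qed
    ultimately show ?thesis unfolding d_def by linarith
  qed
  show ?thesis
  proof (intro exI[of _ "min (c / (1 + K)) (min r1 \<eta>)"] conjI allI impI)
    show "0 < min (c / (1 + K)) (min r1 \<eta>)" using c K r1 \<eta> by simp
    fix z :: complex assume z: "norm z < 1"
    let ?d = "bdist (h z)" and ?c = "min (c / (1 + K)) (min r1 \<eta>)"
    consider "norm z \<le> 1/2" | "r1 \<le> ?d" | "1/2 < norm z" "?d < r1" by linarith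
    then show "?c * (1 - norm z) \<le> ?d"
    proof cases
      case 1
      have "?c * (1 - norm z) \<le> \<eta> * 1" using z \<eta> by (intro mult_mono) auto
      then show ?thesis using x0(2)[OF 1] by (simp add: \<eta>_def)
    next
      case 2
      have "?c * (1 - norm z) \<le> r1 * 1" using z r1 by (intro mult_mono) auto
      then show ?thesis using 2 by simp
    next
      case 3
      have "?c * (1 - norm z) \<le> c / (1 + K) * (1 - norm z)" using z by (intro mult_right_mono) auto
      also have "\<dots> \<le> ?d" using near[OF z 3] K by (simp add: field_simps)
      finally show ?thesis .
    qed
  qed
qed

end

section \<open>Two-sided bounds for the derivative\<close>

text \<open>The Cayley transform of the right half-plane turns the Schwarz lemma into a gradient bound and a
  (non-sharp) Harnack inequality.\<close>

lemma positive_Re_Schwarz: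
  assumes F: "F holomorphic_on ball z s" and s: "0 < s" and pos: "\<And>w. w \<in> ball z s \<Longrightarrow> 0 < Re (F w)"
  shows "norm (deriv F z) * s \<le> 2 * Re (F z)"
    and "\<And>w \<rho>. norm (w - z) \<le> \<rho> * s \<Longrightarrow> \<rho> < 1 \<Longrightarrow> (1 - \<rho>) / 4 * Re (F z) \<le> Re (F w)"
proof -
  define b where "b = F z"
  have b: "0 < Re b" using pos[of z] s by (simp add: b_def)
  define T where "T \<zeta> = z + of_real s * \<zeta>" for \<zeta> :: complex
  have T: "T \<zeta> \<in> ball z s" if "norm \<zeta> < 1" for \<zeta>
    using that s by (simp add: T_def dist_norm norm_mult)
  define G where "G \<zeta> = (F (T \<zeta>) - b) / (F (T \<zeta>) + cnj b)" for \<zeta>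
  have den: "F (T \<zeta>) + cnj b \<noteq> 0" if "norm \<zeta> < 1" for \<zeta>
  proof -
    have "0 < Re (F (T \<zeta>) + cnj b)" using pos[OF T[OF that]] b by simp
    then show ?thesis by (metis less_irrefl zero_complex.sel(1))
  qed
  \<comment> \<open>This identity yields both \<open>|G| < 1\<close> and, read backwards, the
    Harnack bound.\<close>
  have sq: "(norm (a + cnj b))\<^sup>2 = (norm (a - b))\<^sup>2 + 4 * Re a * Re b" for a
    by (simp only: cmod_power2) (simp add: power2_eq_square algebra_simps)
  have G1: "norm (G \<zeta>) < 1" if "norm \<zeta> < 1" for \<zeta>
  proof -
    have "(norm (F (T \<zeta>) - b))\<^sup>2 < (norm (F (T \<zeta>) + cnj b))\<^sup>2"
      unfolding sq using pos[OF T[OF that]] b by simp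
    then have "norm (F (T \<zeta>) - b) < norm (F (T \<zeta>) + cnj b)" by (rule power_less_imp_less_base) simp
    then show ?thesis using den[OF that] by (simp add: G_def norm_divide divide_less_eq)
  qed
  have holT: "(\<lambda>\<zeta>. F (T \<zeta>)) holomorphic_on ball 0 1"
    using holomorphic_on_compose_gen[of T "ball 0 1" F "ball z s"] F T
    by (force simp: o_def T_def[abs_def] intro!: holomorphic_intros)
  have holG: "G holomorphic_on ball 0 1"
    unfolding G_def[abs_def] using den by (intro holomorphic_intros holT) auto
  have G0: "G 0 = 0" by (simp add: G_def T_def b_def)
  note Schwarz = Schwarz_Lemma[OF holG G0 G1]
  have dF: "(F has_field_derivative deriv F z) (at z)"
    using F s by (intro holomorphic_derivI[of F "ball z s"]) auto
  have dT: "(T has_field_derivative of_real s) (at 0)"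
    unfolding T_def[abs_def] by (auto intro!: derivative_eq_intros)
  have dFT: "((\<lambda>\<zeta>. F (T \<zeta>)) has_field_derivative deriv F z * of_real s) (at 0)"
    using DERIV_chain2[of F "deriv F z" T 0 "of_real s" UNIV] dF dT by (simp add: T_def)
  have bb: "b + cnj b \<noteq> 0" using den[of 0] by (simp add: T_def b_def)
  have "(G has_field_derivative (deriv F z * of_real s) / (b + cnj b)) (at 0)"
  proof -
    have "(G has_field_derivative ((deriv F z * of_real s - 0) * (F (T 0) + cnj b) - (F (T 0) - b) * (deriv F z * of_real s + 0))
        / ((F (T 0) + cnj b) * (F (T 0) + cnj b))) (at 0)"
      unfolding G_def[abs_def]
      by (intro DERIV_divide DERIV_diff DERIV_add dFT DERIV_const) (use den[of 0] in simp)
    then show ?thesis using bb by (simp add: T_def b_def)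
  qed
  then have "deriv G 0 = (deriv F z * of_real s) / (b + cnj b)" by (rule DERIV_imp_deriv)
  moreover have "b + cnj b = of_real (2 * Re b)" by (simp add: complex_add_cnj)
  ultimately have "norm (deriv G 0) = norm (deriv F z) * s / (2 * Re b)"
    using s b by (simp add: norm_divide norm_mult)
  moreover have "norm (deriv G 0) \<le> 1" by (rule Schwarz(2)[of 0]) simp_all
  ultimately show "norm (deriv F z) * s \<le> 2 * Re (F z)" using b by (simp add: b_def)
  fix w \<rho> assume w: "norm (w - z) \<le> \<rho> * s" and \<rho>: "\<rho> < (1::real)"
  define \<zeta> where "\<zeta> = (w - z) / of_real s"
  have n\<zeta>: "norm \<zeta> \<le> \<rho>" using w s by (simp add: \<zeta>_def norm_divide divide_le_eq)
  then have \<zeta>1: "norm \<zeta> < 1" "0 \<le> \<rho>" using \<rho> norm_ge_zero[of \<zeta>] by linarith+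
  have Tw: "T \<zeta> = w" using s by (simp add: T_def \<zeta>_def)
  define a where "a = F w"
  have a: "0 < Re a" using pos[OF T[OF \<zeta>1(1)]] by (simp add: a_def Tw)
  have "norm (G \<zeta>) \<le> \<rho>" using Schwarz(1)[OF _ \<zeta>1(1)] n\<zeta> by simp
  then have "norm (a - b) \<le> \<rho> * norm (a + cnj b)"
    using den[OF \<zeta>1(1)] by (simp add: G_def Tw a_def norm_divide divide_le_eq)
  then have "(norm (a - b))\<^sup>2 \<le> (\<rho> * norm (a + cnj b))\<^sup>2" by (intro power_mono) auto
  then have "(1 - \<rho>\<^sup>2) * (norm (a + cnj b))\<^sup>2 \<le> 4 * Re a * Re b"
    using sq[of a] by (simp add: power_mult_distrib algebra_simps)
  \<comment> \<open>The estimate \<open>Re b \<le> |a + cnj b|\<close> loses sharpness but allows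
    cancelling one factor \<open>Re b\<close>.\<close>
  moreover have "(1 - \<rho>) * (Re b * Re b) \<le> (1 - \<rho>\<^sup>2) * (norm (a + cnj b))\<^sup>2"
  proof (rule mult_mono)
    have "\<rho> * \<rho> \<le> 1 * \<rho>" using \<zeta>1(2) \<rho> by (intro mult_right_mono) auto
    then show "1 - \<rho> \<le> 1 - \<rho>\<^sup>2" by (simp add: power2_eq_square)
    have "Re b \<le> norm (a + cnj b)" using complex_Re_le_cmod[of "a + cnj b"] a by simp
    then have "(Re b)\<^sup>2 \<le> (norm (a + cnj b))\<^sup>2" using b by (intro power_mono) auto
    then show "Re b * Re b \<le> (norm (a + cnj b))\<^sup>2" by (simp add: power2_eq_square)
    have "\<rho>\<^sup>2 \<le> 1" using \<zeta>1(2) \<rho> by (intro power_le_one) auto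
    then show "0 \<le> 1 - \<rho>\<^sup>2" by simp
  qed simp
  ultimately have "((1 - \<rho>) / 4 * Re b) * Re b \<le> Re a * Re b" by simp
  then show "(1 - \<rho>) / 4 * Re (F z) \<le> Re (F w)" using b unfolding a_def b_def by (rule mult_right_le_imp_le)
qed

text \<open>Integration along the ray gains the factor \<open>1 / (n + 1)\<close>. A plain mean
  value bound would lose it, and it is needed for comparison with the leading term
  \<open>c / N * u ^ N\<close>.\<close>

lemma norm_diff_le_radial_bound:
  fixes F F' :: "complex \<Rightarrow> complex"
  assumes F: "\<And>w. norm (w - z) \<le> \<delta> \<Longrightarrow> (F has_field_derivative F' w) (at w)"
    and bound: "\<And>w. norm (w - z) \<le> \<delta> \<Longrightarrow> norm (F' w) \<le> B * norm (w - z) ^ n"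
    and u: "norm u \<le> \<delta>"
  shows "norm (F (z + u) - F z) \<le> B * norm u ^ Suc n / Suc n"
proof -
  have le: "norm (z + of_real t * u - z) \<le> \<delta>" if "0 \<le> t" "t \<le> 1" for t :: real
    using that u mult_right_mono[of t 1 "norm u"] by (simp add: norm_mult)
  have der: "((\<lambda>t. F (z + of_real t * u)) has_vector_derivative u * F' (z + of_real t * u)) (at t)"
    if "0 \<le> t" "t \<le> 1" for t :: real
  proof -
    have "((\<lambda>t::real. z + of_real t * u) has_vector_derivative u) (at t)"
      by (auto intro!: derivative_eq_intros)
    from field_vector_diff_chain_at[OF this F[OF le[OF that]]] show ?thesis by (simp add: o_def)
  qed
  have "norm (F (z + of_real 1 * u) - F (z + of_real 0 * u))
      \<le> B * norm u ^ Suc n / Suc n * 1 ^ Suc n - B * norm u ^ Suc n / Suc n * 0 ^ Suc n"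
  proof (rule differentiable_bound_general[of 0 1 "\<lambda>t. F (z + of_real t * u)" "\<lambda>t. B * norm u ^ Suc n / Suc n * t ^ Suc n"
        "\<lambda>t. u * F' (z + of_real t * u)" "\<lambda>t. B * norm u ^ Suc n * t ^ n"])
    show "continuous_on {0..1} (\<lambda>t. F (z + of_real t * u))"
      using der by (intro continuous_at_imp_continuous_on ballI) (auto intro: has_vector_derivative_continuous)
    show "continuous_on {0..1} (\<lambda>t. B * norm u ^ Suc n / Suc n * t ^ Suc n)" by (intro continuous_intros)
    fix t :: real assume t: "0 < t" "t < 1"
    show "((\<lambda>t. F (z + of_real t * u)) has_vector_derivative u * F' (z + of_real t * u)) (at t)" using der t by simp
    have "((\<lambda>t. B * norm u ^ Suc n / Suc n * t ^ Suc n) has_real_derivative B * norm u ^ Suc n / Suc n * (Suc n * t ^ n)) (at t)"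
      by (intro DERIV_cmult) (use DERIV_pow[of "Suc n" t] in simp)
    then show "((\<lambda>t. B * norm u ^ Suc n / Suc n * t ^ Suc n) has_vector_derivative B * norm u ^ Suc n * t ^ n) (at t)"
      by (simp add: has_real_derivative_iff_has_vector_derivative mult.assoc del: power_Suc of_nat_Suc)
    have "norm (u * F' (z + of_real t * u)) \<le> norm u * (B * norm (z + of_real t * u - z) ^ n)"
      unfolding norm_mult using t by (intro mult_left_mono bound le) auto
    also have "\<dots> = B * norm u ^ Suc n * t ^ n" using t by (simp add: norm_mult power_mult_distrib)
    finally show "norm (u * F' (z + of_real t * u)) \<le> B * norm u ^ Suc n * t ^ n" .
  qed simp
  then show ?thesis by simp
qed

section \<open>Lipschitz bound for \<open>h\<close> and absence of zeros of
  \<open>f'\<close>\<close>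

context planar_hqc
begin

lemma h_Lipschitz_on_convex:
  assumes S: "convex S" "S \<subseteq> ball 0 1" and L: "\<And>z. z \<in> S \<Longrightarrow> norm (f' z) \<le> L" and ab: "a \<in> S" "b \<in> S"
  shows "norm (h a - h b) \<le> 2 * L * norm (a - b)"
proof -
  have in1: "norm z < 1" if "z \<in> S" for z using that S(2) by auto
  have gL: "norm (g' z) \<le> L" if "z \<in> S" for z
  proof -
    have "norm (g' z) \<le> 1 * norm (f' z)" using order_trans[OF dil[OF in1[OF that]] mult_right_mono[of k 1]] k by simp
    then show ?thesis using L[OF that] by simp
  qed
  have "norm (g a - g b) \<le> L * norm (a - b)"
    by (rule field_differentiable_bound[OF S(1) has_field_derivative_at_within[OF g_deriv[OF in1]] gL ab])
  moreover have "norm (f a - f b) \<le> L * norm (a - b)"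
    by (rule field_differentiable_bound[OF S(1) has_field_derivative_at_within[OF f_deriv[OF in1]] L ab])
  moreover have "h a - h b = (f a - f b) + cnj (g a - g b)" using ab in1 by (simp add: h_eq)
  then have "norm (h a - h b) \<le> norm (f a - f b) + norm (g a - g b)"
    by (metis complex_mod_cnj norm_triangle_ineq)
  ultimately show ?thesis by simp
qed

text \<open>At a zero of \<open>f'\<close> of order \<open>n\<close> the map winds \<open>n + 1\<close> times around its value.\<close>

lemma deriv_nonzero:
  assumes z0: "norm z0 < 1" shows "f' z0 \<noteq> 0"
proof
  assume zero: "f' z0 = 0"
  have "\<not> f' constant_on ball 0 1"
  proof
    assume "f' constant_on ball 0 1"
    then have "f' z = 0" if "norm z < 1" for z
      using zero z0 that unfolding constant_on_def by (metis mem_ball_0)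
    then have "norm (h 0 - h (1/2)) \<le> 2 * 0 * norm (0 - 1/2 :: complex)"
      by (intro h_Lipschitz_on_convex[of "ball 0 1"]) auto
    then have "h 0 = h (1/2)" by simp
    then have "hinv (h 0) = hinv (h (1/2))" by simp
    then show False by (simp add: hinv_h)
  qed
  then obtain \<phi> r n where \<phi>: "0 < n" "0 < r" "ball z0 r \<subseteq> ball 0 1" "\<phi> holomorphic_on ball z0 r"
    "\<And>w. w \<in> ball z0 r \<Longrightarrow> f' w = (w - z0) ^ n * \<phi> w" "\<And>w. w \<in> ball z0 r \<Longrightarrow> \<phi> w \<noteq> 0"
    using holomorphic_factor_zero_nonconstant[OF derivs_holomorphic(1) open_ball connected_ball _ zero] z0
    by (metis mem_ball_0)
  define c where "c = \<phi> z0"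
  have c: "0 < norm c" using \<phi>(2,6) by (simp add: c_def)
  \<comment> \<open>Relative error of \<open>f\<close> plus relative size of \<open>cnj g\<close> on
    a small circle: \<open>\<eta> + k (1 + \<eta>) < 1\<close> leaves the leading term of
    \<open>f\<close> dominant.\<close>
  define \<eta> where "\<eta> = (1 - k) / 4"
  have \<eta>: "0 < \<eta>" "\<eta> + k * (1 + \<eta>) < 1"
  proof -
    show "0 < \<eta>" using k by (simp add: \<eta>_def)
    have "\<eta> + k * (1 + \<eta>) \<le> \<eta> + (k + 1 * \<eta>)"
      using k \<open>0 < \<eta>\<close> by (simp add: distrib_left mult_right_mono)
    also have "\<dots> < 1" using k by (simp add: \<eta>_def field_simps)
    finally show "\<eta> + k * (1 + \<eta>) < 1" .
  qed
  have "isCont \<phi> z0" using \<phi>(2,4) holomorphic_on_imp_continuous_on continuous_on_interior by (metis centre_in_ball interior_ball)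
  then obtain \<delta>1 where \<delta>1: "\<delta>1 > 0" "\<And>w. dist w z0 < \<delta>1 \<Longrightarrow> dist (\<phi> w) c < \<eta> * norm c"
    unfolding continuous_at_eps_delta c_def using \<eta>(1) c c_def by (metis mult_pos_pos)
  define \<delta> where "\<delta> = min \<delta>1 r / 2"
  have \<delta>: "0 < \<delta>" "\<delta> < \<delta>1" "\<delta> < r" using \<delta>1(1) \<phi>(2) by (auto simp: \<delta>_def)
  have in_ball: "w \<in> ball z0 r" "norm w < 1" if "norm (w - z0) \<le> \<delta>" for w
  proof -
    show "w \<in> ball z0 r" using that \<delta>(3) by (simp add: dist_norm norm_minus_commute)
    then show "norm w < 1" using \<phi>(3) by auto
  qed
  have \<phi>c: "norm (\<phi> w - c) \<le> \<eta> * norm c" if "norm (w - z0) \<le> \<delta>" for w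
    using \<delta>1(2)[of w] that \<delta>(2) by (simp add: dist_norm)
  define N where "N = Suc n"
  define q where "q w = f w - c / of_nat N * (w - z0) ^ N" for w
  have q_le: "norm (q (z0 + u) - q z0) \<le> \<eta> * norm c * norm u ^ Suc n / Suc n" if "norm u \<le> \<delta>" for u
  proof (rule norm_diff_le_radial_bound[OF _ _ that])
    fix w assume w: "norm (w - z0) \<le> \<delta>"
    have pw: "((\<lambda>w. (w - z0) ^ N) has_field_derivative of_nat N * (w - z0) ^ n) (at w)"
      unfolding N_def by (auto intro!: derivative_eq_intros simp del: power_Suc of_nat_Suc)
    show "(q has_field_derivative f' w - c / of_nat N * (of_nat N * (w - z0) ^ n)) (at w)"
      unfolding q_def[abs_def] by (intro DERIV_diff DERIV_cmult pw f_deriv in_ball(2) w)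
    have "f' w - c / of_nat N * (of_nat N * (w - z0) ^ n) = (w - z0) ^ n * (\<phi> w - c)"
      using \<phi>(5)[OF in_ball(1)[OF w]] by (simp add: N_def algebra_simps del: of_nat_Suc)
    then show "norm (f' w - c / of_nat N * (of_nat N * (w - z0) ^ n)) \<le> \<eta> * norm c * norm (w - z0) ^ n"
      using mult_left_mono[OF \<phi>c[OF w], of "norm (w - z0) ^ n"] by (simp add: norm_mult norm_power mult.commute)
  qed
  have g_le: "norm (g (z0 + u) - g z0) \<le> k * (1 + \<eta>) * norm c * norm u ^ Suc n / Suc n" if "norm u \<le> \<delta>" for u
  proof (rule norm_diff_le_radial_bound[OF _ _ that])
    fix w assume w: "norm (w - z0) \<le> \<delta>"
    show "(g has_field_derivative g' w) (at w)" by (rule g_deriv[OF in_ball(2)[OF w]])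
    have "norm (\<phi> w) \<le> norm c + norm (\<phi> w - c)" using norm_triangle_sub[of "\<phi> w" c] by simp
    also have "\<dots> \<le> (1 + \<eta>) * norm c" using \<phi>c[OF w] by (simp add: algebra_simps)
    finally have "norm (f' w) \<le> norm (w - z0) ^ n * ((1 + \<eta>) * norm c)"
      unfolding \<phi>(5)[OF in_ball(1)[OF w]] norm_mult norm_power by (intro mult_left_mono) auto
    then have "k * norm (f' w) \<le> k * (norm (w - z0) ^ n * ((1 + \<eta>) * norm c))" using k(1) by (rule mult_left_mono)
    then show "norm (g' w) \<le> k * (1 + \<eta>) * norm c * norm (w - z0) ^ n"
      using dil[OF in_ball(2)[OF w]] by (simp add: mult_ac)
  qed
  have diff_less: "norm (h (z0 + u) - (h z0 + c / of_nat N * u ^ N)) < norm (c / of_nat N * u ^ N)"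
    if u: "norm u = \<delta>" for u
  proof -
    have in1: "norm (z0 + u) < 1" using in_ball(2)[of "z0 + u"] u by simp
    define E where "E = norm c * \<delta> ^ Suc n / Suc n"
    have E: "0 < E" using c \<delta>(1) by (simp add: E_def)
    have "h (z0 + u) - (h z0 + c / of_nat N * u ^ N) = (q (z0 + u) - q z0) + cnj (g (z0 + u) - g z0)"
      using in1 z0 by (simp add: h_eq q_def N_def)
    then have "norm (h (z0 + u) - (h z0 + c / of_nat N * u ^ N)) \<le> norm (q (z0 + u) - q z0) + norm (g (z0 + u) - g z0)"
      by (metis complex_mod_cnj norm_triangle_ineq)
    also have "\<dots> \<le> \<eta> * E + k * (1 + \<eta>) * E"
      using q_le[of u] g_le[of u] u by (simp add: E_def mult.assoc)
    also have "\<dots> = (\<eta> + k * (1 + \<eta>)) * E" by (simp add: algebra_simps)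
    also have "\<dots> < 1 * E" using \<eta>(2) E by (intro mult_strict_right_mono) auto
    also have "1 * E = norm (c / of_nat N * u ^ N)"
      using u by (simp add: E_def N_def norm_mult norm_divide norm_power del: of_nat_Suc)
    finally show ?thesis .
  qed
  define \<gamma> where "\<gamma> = h \<circ> circlepath z0 \<delta>"
  \<comment> \<open>The model loop: \<open>h z0\<close> plus the leading term, of winding number
    \<open>N\<close> about \<open>h z0\<close>. By \<open>diff_less\<close> the image loop stays
    closer to it than \<open>h z0\<close> does, so the winding numbers agree.\<close>
  define P where "P t = h z0 + c / of_nat N * (of_real \<delta> * exp (2 * of_real pi * \<i> * of_real t)) ^ N" for t :: real
  have sphere: "w \<in> sphere z0 \<delta> \<Longrightarrow> norm w < 1" for w
    using in_ball(2)[of w] by (simp add: dist_norm norm_minus_commute)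
  have simple: "simple_path \<gamma>"
    unfolding \<gamma>_def
  proof (rule simple_path_continuous_image)
    show "simple_path (circlepath z0 \<delta>)" using \<delta>(1) by (simp add: simple_path_circlepath)
    show "continuous_on (path_image (circlepath z0 \<delta>)) h"
      by (rule continuous_on_subset[OF h_continuous]) (use \<delta>(1) sphere in auto)
    show "inj_on h (path_image (circlepath z0 \<delta>))"
      by (rule inj_on_inverseI[of _ hinv]) (use \<delta>(1) sphere hinv_h in auto)
  qed
  have closed: "pathfinish \<gamma> = pathstart \<gamma>"
    by (simp add: \<gamma>_def pathfinish_compose pathstart_compose)
  have not_in: "h z0 \<notin> path_image \<gamma>"
  proof
    assume "h z0 \<in> path_image \<gamma>"
    then obtain w where w: "w \<in> sphere z0 \<delta>" "h z0 = h w"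
      using \<delta>(1) by (auto simp: \<gamma>_def path_image_compose)
    have "z0 = w" using hinv_h[OF z0] hinv_h[OF sphere[OF w(1)]] w(2) by metis
    then show False using w(1) \<delta>(1) by simp
  qed
  have "winding_number \<gamma> (h z0) = winding_number P (h z0)"
  proof (rule winding_number_nearby_loops_eq)
    show "path P" unfolding P_def path_def by (intro continuous_intros)
    show "path \<gamma>" using simple by (rule simple_path_imp_path)
    show "pathfinish P = pathstart P" by (simp add: P_def pathfinish_def pathstart_def)
    show "pathfinish \<gamma> = pathstart \<gamma>" by (rule closed)
    fix t :: real
    have "norm (of_real \<delta> * exp (2 * of_real pi * \<i> * of_real t)) = \<delta>" using \<delta>(1) by (simp add: norm_mult)
    from diff_less[OF this] show "norm (\<gamma> t - P t) < norm (P t - h z0)"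
      by (simp add: \<gamma>_def P_def circlepath)
  qed
  also have "\<dots> = of_nat N"
  proof -
    define C where "C = c / of_nat N * of_real \<delta> ^ N"
    have C: "C \<noteq> 0" using c \<delta>(1) by (simp add: C_def N_def del: of_nat_Suc)
    define p where "p t = Ln C + of_nat N * (2 * of_real pi * \<i> * of_real t)" for t :: real
    have "exp (p t) = C * exp (2 * of_real pi * \<i> * of_real t) ^ N" for t
      by (simp only: p_def exp_add exp_of_nat_mult exp_Ln[OF C])
    then have "P t - h z0 = (exp \<circ> p) t" for t
      by (simp add: P_def power_mult_distrib C_def)
    then have "winding_number P (h z0) = winding_number (exp \<circ> p) 0"
      by (subst winding_number_offset) presburger
    also have "\<dots> = (pathfinish p - pathstart p) / (2 * of_real pi * \<i>)"
      by (rule winding_number_compose_exp) (unfold p_def path_def, intro continuous_intros)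
    also have "\<dots> = of_nat N" by (simp add: p_def pathfinish_def pathstart_def)
    finally show ?thesis .
  qed
  finally have "winding_number \<gamma> (h z0) = of_nat N" .
  \<comment> \<open>Injectivity makes the image loop a simple closed curve, whereas
    \<open>N = n + 1\<close> is at least 2.\<close>
  moreover have "winding_number \<gamma> (h z0) \<in> {-1, 0, 1}"
    by (rule simple_closed_path_winding_number_cases[OF simple closed not_in])
  ultimately have "of_nat N \<in> {-1, 0, 1 :: complex}" by simp
  then have "real N \<in> {-1, 0, 1}" by (auto simp: complex_eq_iff)
  then show False using \<phi>(1) by (auto simp: N_def)
qed

end

section \<open>Bounds for \<open>f'\<close> up to the unit circle\<close>

context planar_hqc_flat
begin

text \<open>On a disc of radius \<open>\<theta> (1 - |z|)\<close> the normal coordinate of \<open>h\<close> plus a constant of order \<open>osc^(1 + \<mu>)\<close> is positive.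
  The resulting gradient estimate bounds \<open>|f' z| (1 - |z|)\<close> by itself with a factor that is small with \<open>\<theta>\<close>;
  the parameter \<open>\<tau>\<close> only makes the supremum finite, so that this term can be absorbed.\<close>

lemma deriv_bounded: "\<exists>C>0. \<forall>z. norm z < 1 \<longrightarrow> norm (f' z) \<le> C"
proof -
  obtain C1 where C1: "0 < C1" "\<And>z. norm z < 1 \<Longrightarrow> bdist (h z) \<le> C1 * (1 - norm z)"
    using dist_frontier_upper by blast
  obtain B where B: "0 < B" "\<And>w. w \<in> D \<Longrightarrow> norm w < B"
    using D(2) unfolding bounded_pos by (metis less_add_one le_less_trans less_trans zero_less_one add_pos_pos)
  have lin_hol: "lin a holomorphic_on ball 0 1" for a
    unfolding holomorphic_on_open[OF open_ball] using lin_deriv by (metis mem_ball_0)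
  have sub: "ball z s \<subseteq> ball 0 1" if "s \<le> 1 - norm z" for z :: complex and s
    using that by (simp add: ball_subset_ball_iff)
  have grad: "norm (lin' a z) * s \<le> 2 * (Re (lin a z) + c)"
    if "0 < s" "s \<le> 1 - norm z" "\<And>w. w \<in> ball z s \<Longrightarrow> 0 < Re (lin a w) + c" for a z c s
  proof -
    have z: "norm z < 1" using that(1,2) by simp
    have "norm (deriv (\<lambda>w. lin a w + of_real c) z) * s \<le> 2 * Re (lin a z + of_real c)"
      by (rule positive_Re_Schwarz(1)[OF _ that(1)])
        (use that(3) in \<open>auto intro!: holomorphic_intros holomorphic_on_subset[OF lin_hol sub[OF that(2)]]\<close>)
    moreover have "deriv (\<lambda>w. lin a w + of_real c) z = lin' a z"
      using DERIV_add[OF lin_deriv[OF z, of a] DERIV_const[of "of_real c"]] by (intro DERIV_imp_deriv) simp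
    ultimately show ?thesis by simp
  qed
  \<comment> \<open>The crude bound from boundedness of \<open>D\<close>, applied on the disc of
    radius \<open>1 - |z|\<close>.\<close>
  define P0 where "P0 = 4 * B / (1 - k)"
  have P0: "0 < P0" using B k by (simp add: P0_def)
  have P0_bound: "norm (f' z) * (1 - norm z) \<le> P0" if z: "norm z < 1" for z
  proof -
    have Re_lt: "\<bar>Re (lin 1 w)\<bar> < B" if "norm w < 1" for w
      using Re_lin[OF that, of 1] abs_Re_le_cmod[of "h w"] B(2)[OF h_in_D[OF that]] by simp
    have "norm (lin' 1 z) * (1 - norm z) \<le> 2 * (Re (lin 1 z) + B)"
    proof (rule grad)
      fix w assume "w \<in> ball z (1 - norm z)"
      then have "norm w < 1" using sub[of "1 - norm z" z] by auto
      then show "0 < Re (lin 1 w) + B" using Re_lt[of w] by simp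
    qed (use z in auto)
    also have "\<dots> \<le> 4 * B" using Re_lt[OF z] by simp
    finally have "norm (lin' 1 z) * (1 - norm z) \<le> 4 * B" .
    moreover have "(1 - k) * norm (f' z) * (1 - norm z) \<le> norm (lin' 1 z) * (1 - norm z)"
      using norm_lin'_ge[OF z, of 1] z by (intro mult_right_mono) auto
    ultimately show ?thesis using k by (simp add: P0_def pos_le_divide_eq mult_ac)
  qed
  \<comment> \<open>Chosen so that \<open>64 (M + 1) e0 = (1 - k) / 2\<close>, which produces the
    factor 1/2 of \<open>S\<close> in \<open>improve\<close>.\<close>
  define e0 where "e0 = (1 - k) / (128 * (M + 1))"
  have e0: "0 < e0" using k M by (simp add: e0_def)
  obtain \<delta> where \<delta>: "0 < \<delta>" "\<And>x. 0 \<le> x \<Longrightarrow> x \<le> \<delta> \<Longrightarrow> x powr \<mu> \<le> e0"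
    using exists_small_powr[OF \<mu>(1) e0, of 1] by auto
  define \<theta> where "\<theta> = min (1/2) (\<delta> / (4 * P0))"
  have \<theta>: "0 < \<theta>" "\<theta> \<le> 1/2" "4 * \<theta> * P0 \<le> \<delta>"
  proof -
    show "0 < \<theta>" "\<theta> \<le> 1/2" using \<delta>(1) P0 by (auto simp: \<theta>_def)
    have "4 * \<theta> * P0 \<le> 4 * (\<delta> / (4 * P0)) * P0" using P0 by (intro mult_right_mono mult_left_mono) (auto simp: \<theta>_def)
    then show "4 * \<theta> * P0 \<le> \<delta>" using P0 by simp
  qed
  define CT where "CT = (2 * C1 + 8 * (M + 1) * C1 powr (1 + \<mu>)) / (\<theta> * (1 - k))"
  have CT: "0 < CT" using C1(1) M \<theta> k by (auto simp: CT_def intro!: divide_pos_pos add_pos_nonneg)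
  have improve: "norm (f' z) * (1 - norm z) \<le> (CT + S / 2) * ((1 - norm z) + \<tau>)"
    if \<tau>: "0 < \<tau>" and S: "0 \<le> S" "\<And>z. norm z < 1 \<Longrightarrow> norm (f' z) * (1 - norm z) \<le> S * ((1 - norm z) + \<tau>)"
      and z: "norm z < 1" for \<tau> S z
  proof -
    define \<rho> where "\<rho> = 1 - norm z"
    have \<rho>: "0 < \<rho>" "\<rho> \<le> 1" using z by (auto simp: \<rho>_def)
    define s where "s = \<theta> * \<rho>"
    have s: "0 < s" "s \<le> \<rho> / 2" using \<theta> \<rho> by (auto simp: s_def)
    \<comment> \<open>Both bounds for \<open>f'\<close> on the disc are kept. In
      \<open>b^(1 + \<mu>) = b * b^\<mu>\<close> the one with \<open>S\<close> makes the first
      factor linear in \<open>S\<close>, and the one with \<open>P0\<close> makes the second factor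
      at most \<open>e0\<close>.\<close>
    define L where "L = min (2 * P0 / \<rho>) (4 * S * (\<rho> + \<tau>) / \<rho>)"
    have f'_le: "norm (f' \<zeta>) \<le> L" if \<zeta>: "\<zeta> \<in> ball z s" for \<zeta>
    proof -
      define \<rho>' where "\<rho>' = 1 - norm \<zeta>"
      have dz: "norm (\<zeta> - z) < s" using \<zeta> by (simp add: dist_norm norm_minus_commute)
      have "\<bar>norm \<zeta> - norm z\<bar> < s" using norm_triangle_ineq3[of \<zeta> z] dz by linarith
      then have \<rho>': "\<rho> / 2 \<le> \<rho>'" "\<rho>' \<le> 2 * \<rho>" using s by (auto simp: \<rho>'_def \<rho>_def)
      have n\<zeta>: "norm \<zeta> < 1" using \<rho>' \<rho> by (simp add: \<rho>'_def)
      have "norm (f' \<zeta>) * (\<rho> / 2) \<le> norm (f' \<zeta>) * \<rho>'" using \<rho>' by (intro mult_left_mono) auto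
      moreover have "norm (f' \<zeta>) * \<rho>' \<le> P0" using P0_bound[OF n\<zeta>] by (simp add: \<rho>'_def)
      moreover have "norm (f' \<zeta>) * \<rho>' \<le> S * (\<rho>' + \<tau>)" using S(2)[OF n\<zeta>] by (simp add: \<rho>'_def)
      moreover have "S * (\<rho>' + \<tau>) \<le> S * (2 * (\<rho> + \<tau>))" using \<rho>' \<tau> S(1) by (intro mult_left_mono) auto
      ultimately have "norm (f' \<zeta>) * \<rho> \<le> 2 * P0" "norm (f' \<zeta>) * \<rho> \<le> 2 * (S * (2 * (\<rho> + \<tau>)))" by linarith+
      then have "norm (f' \<zeta>) * \<rho> \<le> 2 * P0" "norm (f' \<zeta>) * \<rho> \<le> 4 * S * (\<rho> + \<tau>)" by (simp_all only: mult_ac)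
      then show ?thesis using \<rho>(1) by (simp add: L_def pos_le_divide_eq)
    qed
    have L0: "0 \<le> L" using P0 S(1) \<rho> \<tau> by (auto simp: L_def)
    define b where "b = 2 * s * L"
    have b0: "0 \<le> b" using s L0 by (simp add: b_def)
    have b1: "b \<le> 4 * \<theta> * P0"
    proof -
      have "b \<le> 2 * s * (2 * P0 / \<rho>)" unfolding b_def using s by (intro mult_left_mono) (auto simp: L_def)
      also have "\<dots> = 4 * \<theta> * P0" using \<rho> by (simp add: s_def)
      finally show ?thesis .
    qed
    have b2': "b \<le> \<theta> * (8 * S * (\<rho> + \<tau>))"
    proof -
      have "b \<le> 2 * s * (4 * S * (\<rho> + \<tau>) / \<rho>)" unfolding b_def using s by (intro mult_left_mono) (auto simp: L_def)
      also have "\<dots> = \<theta> * (8 * S * (\<rho> + \<tau>))" using \<rho> by (simp add: s_def)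
      finally show ?thesis .
    qed
    define d where "d = bdist (h z)"
    have d: "0 < d" "d \<le> C1 * \<rho>"
      using bdist_pos[OF h_in_D[OF z]] C1(2)[OF z] by (auto simp: d_def \<rho>_def)
    obtain p n where pn: "p \<in> frontier D" "Holder_flat \<mu> M r D p n" "norm n = 1"
      "h z - p = d *\<^sub>R n" "norm (h z - p) = d"
      by (rule nearest_frontier_normal[OF h_in_D[OF z], folded d_def])
    define osc where "osc = C1 * \<rho> + b"
    have osc: "norm (h \<zeta> - p) \<le> osc" "norm \<zeta> < 1" if \<zeta>: "\<zeta> \<in> ball z s" for \<zeta>
    proof -
      have subz: "ball z s \<subseteq> ball 0 1" using s \<rho> by (intro sub) (simp add: \<rho>_def)
      then show "norm \<zeta> < 1" using \<zeta> by auto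
      have "norm (h \<zeta> - h z) \<le> 2 * L * norm (\<zeta> - z)"
        using f'_le \<zeta> s subz by (intro h_Lipschitz_on_convex[of "ball z s"]) auto
      also have "\<dots> \<le> 2 * L * s" using \<zeta> L0 by (intro mult_left_mono) (auto simp: dist_norm norm_minus_commute)
      also have "\<dots> = b" by (simp add: b_def)
      finally show "norm (h \<zeta> - p) \<le> osc"
        using norm_triangle_ineq[of "h \<zeta> - h z" "h z - p"] pn(5) d by (simp add: osc_def)
    qed
    have osc0: "0 < osc" using C1(1) \<rho> b0 by (simp add: osc_def add_pos_nonneg)
    \<comment> \<open>Flatness at \<open>p\<close> bounds the normal coordinate below by
      \<open>- M osc^(1 + \<mu>)\<close> on the disc; the extra 1 makes the shifted function
      strictly positive.\<close>
    define c where "c = - Re (cnj n * p) + (M + 1) * osc powr (1 + \<mu>)"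
    have y_eq: "Re (lin n \<zeta>) + c = Re (cnj n * (h \<zeta> - p)) + (M + 1) * osc powr (1 + \<mu>)" if "norm \<zeta> < 1" for \<zeta>
      using Re_lin[OF that, of n] by (simp add: c_def right_diff_distrib)
    have "norm (lin' n z) * s \<le> 2 * (Re (lin n z) + c)"
    proof (rule grad[OF s(1)])
      show "s \<le> 1 - norm z" using s \<rho> by (simp add: \<rho>_def)
      fix \<zeta> assume \<zeta>: "\<zeta> \<in> ball z s"
      have "- M * norm (h \<zeta> - p) powr (1 + \<mu>) \<le> Re (cnj n * (h \<zeta> - p))"
        using pn(2) h_in_D[OF osc(2)[OF \<zeta>]] unfolding Holder_flat_def by blast
      moreover have "M * norm (h \<zeta> - p) powr (1 + \<mu>) \<le> M * osc powr (1 + \<mu>)"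
        using osc(1)[OF \<zeta>] M \<mu> by (intro mult_left_mono powr_mono2) auto
      moreover have "0 < osc powr (1 + \<mu>)" using osc0 by simp
      ultimately show "0 < Re (lin n \<zeta>) + c" unfolding y_eq[OF osc(2)[OF \<zeta>]] distrib_right by linarith
    qed
    also have "Re (lin n z) + c = d + (M + 1) * osc powr (1 + \<mu>)"
    proof -
      have "Re (cnj n * (h z - p)) = d" unfolding pn(4) using Re_cnj_mult_self[of n] pn(3) by (simp add: algebra_simps)
      then show ?thesis using y_eq[OF z] by simp
    qed
    finally have main: "norm (lin' n z) * s \<le> 2 * d + 2 * (M + 1) * osc powr (1 + \<mu>)"
      by (simp only: distrib_left[of 2 d] mult.assoc)
    have osc_le: "osc powr (1 + \<mu>) \<le> 4 * (C1 powr (1 + \<mu>) * \<rho> + \<theta> * (8 * S * (\<rho> + \<tau>)) * e0)"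
    proof -
      define m where "m = max (C1 * \<rho>) b"
      have m: "0 \<le> m" "osc \<le> 2 * m" using C1(1) \<rho> b0 by (auto simp: m_def osc_def)
      have "osc powr (1 + \<mu>) \<le> (2 * m) powr (1 + \<mu>)" using m osc0 \<mu> by (intro powr_mono2) auto
      also have "\<dots> = 2 powr (1 + \<mu>) * m powr (1 + \<mu>)" using m by (simp add: powr_mult)
      also have "\<dots> \<le> 2 powr 2 * m powr (1 + \<mu>)" using \<mu> by (intro mult_right_mono powr_mono) auto
      also have "\<dots> = 4 * m powr (1 + \<mu>)" by simp
      also have "m powr (1 + \<mu>) \<le> (C1 * \<rho>) powr (1 + \<mu>) + b powr (1 + \<mu>)" by (auto simp: m_def max_def)
      also have "(C1 * \<rho>) powr (1 + \<mu>) \<le> C1 powr (1 + \<mu>) * \<rho>"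
      proof -
        have "\<rho> powr (1 + \<mu>) \<le> \<rho> powr 1" using \<rho> \<mu> by (intro powr_mono') auto
        then show ?thesis using C1(1) \<rho> by (simp add: powr_mult mult_left_mono)
      qed
      also have "b powr (1 + \<mu>) \<le> \<theta> * (8 * S * (\<rho> + \<tau>)) * e0"
      proof -
        have "b powr (1 + \<mu>) = b * b powr \<mu>" using b0 by (cases "b = 0") (simp_all add: powr_add)
        also have "\<dots> \<le> (\<theta> * (8 * S * (\<rho> + \<tau>))) * e0"
          using b0 b2' b1 \<theta>(3) \<delta>(2)[of b] e0 order_trans[OF b0 b2'] by (intro mult_mono) auto
        finally show ?thesis .
      qed
      finally show ?thesis by simp
    qed
    have "1 * (1 - k) * norm (f' z) * s \<le> norm (lin' n z) * s"
      using norm_lin'_ge[OF z, of n] pn(3) s by (intro mult_right_mono) auto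
    also have "\<dots> \<le> 2 * (C1 * \<rho>) + 2 * (M + 1) * (4 * (C1 powr (1 + \<mu>) * \<rho> + \<theta> * (8 * S * (\<rho> + \<tau>)) * e0))"
      by (rule order_trans[OF main]) (use d osc_le M in \<open>auto intro!: add_mono mult_left_mono\<close>)
    also have "\<dots> = (2 * C1 + 8 * (M + 1) * C1 powr (1 + \<mu>)) * \<rho> + \<theta> * (64 * (M + 1) * e0) * (S * (\<rho> + \<tau>))"
      by (simp add: algebra_simps)
    also have "64 * (M + 1) * e0 = (1 - k) / 2"
    proof -
      have "64 * m * (x / (128 * m)) = x / 2" if "m \<noteq> 0" for m x :: real using that by simp
      from this[of "M + 1" "1 - k"] show ?thesis using M unfolding e0_def by linarith
    qed
    also have "(2 * C1 + 8 * (M + 1) * C1 powr (1 + \<mu>)) = CT * (\<theta> * (1 - k))"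
      using \<theta>(1) k by (simp add: CT_def)
    finally have "(\<theta> * (1 - k)) * (norm (f' z) * \<rho>) \<le> (\<theta> * (1 - k)) * (CT * \<rho> + S / 2 * (\<rho> + \<tau>))"
      by (simp add: s_def algebra_simps)
    then have "norm (f' z) * \<rho> \<le> CT * \<rho> + S / 2 * (\<rho> + \<tau>)" using \<theta>(1) k by simp
    also have "\<dots> \<le> (CT + S / 2) * (\<rho> + \<tau>)" using CT \<tau> by (simp add: algebra_simps)
    finally show ?thesis by (simp add: \<rho>_def)
  qed
  have bound: "norm (f' z) * (1 - norm z) \<le> 2 * CT * ((1 - norm z) + \<tau>)" if \<tau>: "0 < \<tau>" and z: "norm z < 1" for \<tau> z
  proof -
    \<comment> \<open>The supremum is finite because \<open>P0 / \<tau>\<close> bounds the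
      quotients, so \<open>S \<le> CT + S / 2\<close> can be solved for \<open>S\<close>.\<close>
    define Q where "Q = (\<lambda>z. norm (f' z) * (1 - norm z) / ((1 - norm z) + \<tau>)) ` ball 0 1"
    have bdd: "bdd_above Q"
    proof (rule bdd_aboveI)
      fix x assume "x \<in> Q"
      then obtain w where w: "norm w < 1" "x = norm (f' w) * (1 - norm w) / ((1 - norm w) + \<tau>)" by (auto simp: Q_def)
      have "x \<le> P0 / \<tau>" unfolding w(2) using P0_bound[OF w(1)] P0 \<tau> w(1) by (intro frac_le) auto
      then show "x \<le> P0 / \<tau>" .
    qed
    have pos: "0 < (1 - norm w) + \<tau>" if "norm w < 1" for w :: complex using that \<tau> by simp
    define S where "S = Sup Q"
    have S_ge: "norm (f' w) * (1 - norm w) / ((1 - norm w) + \<tau>) \<le> S" if "norm w < 1" for w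
      unfolding S_def by (rule cSup_upper[OF _ bdd]) (use that in \<open>auto simp: Q_def\<close>)
    have S0: "0 \<le> S" using S_ge[of 0] \<tau> by (smt (verit) divide_nonneg_pos norm_ge_zero norm_zero mult_nonneg_nonneg)
    have S_le: "norm (f' w) * (1 - norm w) \<le> S * ((1 - norm w) + \<tau>)" if "norm w < 1" for w
      using S_ge[OF that] pos[OF that] by (simp add: pos_divide_le_eq)
    have "S \<le> CT + S / 2"
      unfolding S_def
    proof (rule cSup_least)
      show "Q \<noteq> {}" by (simp add: Q_def)
      fix x assume "x \<in> Q"
      then obtain w where w: "norm w < 1" "x = norm (f' w) * (1 - norm w) / ((1 - norm w) + \<tau>)" by (auto simp: Q_def)
      show "x \<le> CT + Sup Q / 2"
        using improve[OF \<tau> S0 S_le w(1)] pos[OF w(1)] by (simp add: w(2) pos_divide_le_eq S_def)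
    qed
    then have "S \<le> 2 * CT" by simp
    then show ?thesis using S_le[OF z] pos[OF z] by (meson mult_right_mono less_imp_le order_trans)
  qed
  show ?thesis
  proof (intro exI[of _ "4 * CT"] conjI allI impI)
    show "0 < 4 * CT" using CT by simp
    fix z :: complex assume z: "norm z < 1"
    \<comment> \<open>The bound is uniform in \<open>\<tau>\<close>, so instead of letting it tend
      to 0 one may take \<open>\<tau> = 1 - |z|\<close>.\<close>
    have "norm (f' z) * (1 - norm z) \<le> 2 * CT * ((1 - norm z) + (1 - norm z))"
      by (rule bound) (use z in auto)
    also have "\<dots> = 4 * CT * (1 - norm z)" by (simp add: algebra_simps)
    finally show "norm (f' z) \<le> 4 * CT" using z by (intro mult_right_le_imp_le[of "norm (f' z)" "1 - norm z"]) auto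
  qed
qed

text \<open>If \<open>|f' z|\<close> were tiny, Harnack's inequality for \<open>ln (C / |f'|)\<close> would make \<open>h\<close> nearly constant on the way from
  \<open>z\<close> to a point much closer to the unit circle, which contradicts the two-sided bound for \<open>bdist\<close>.\<close>

lemma deriv_bounded_below: "\<exists>c>0. \<forall>z. norm z < 1 \<longrightarrow> c \<le> norm (f' z)"
proof -
  obtain C1 where C1: "0 < C1" "\<And>z. norm z < 1 \<Longrightarrow> bdist (h z) \<le> C1 * (1 - norm z)"
    using dist_frontier_upper by blast
  obtain c1 where c1: "0 < c1" "\<And>z. norm z < 1 \<Longrightarrow> c1 * (1 - norm z) \<le> bdist (h z)"
    using dist_frontier_lower by blast
  obtain C0 where C0: "0 < C0" "\<And>z. norm z < 1 \<Longrightarrow> norm (f' z) \<le> C0"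
    using deriv_bounded by blast
  define C where "C = C0 + 1"
  have C: "0 < C" using C0(1) by (simp add: C_def)
  have f'_less: "norm (f' z) < C" if "norm z < 1" for z using C0(2)[OF that] by (simp add: C_def)
  have "c1 \<le> C1" using c1(2)[of 0] C1(2)[of 0] by simp
  \<comment> \<open>A point at depth \<open>\<tau> \<rho>\<close> has image within
    \<open>C1 \<tau> \<rho> = c1 \<rho> / 2\<close> of the frontier, half of the guaranteed distance
    at depth \<open>\<rho>\<close>; so \<open>h\<close> must move by at least
    \<open>c1 \<rho> / 2\<close> in between.\<close>
  define \<tau> where "\<tau> = c1 / (2 * C1)"
  have \<tau>: "0 < \<tau>" "\<tau> \<le> 1/2" "C1 * \<tau> = c1 / 2" using c1(1) C1(1) \<open>c1 \<le> C1\<close> by (auto simp: \<tau>_def)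
  obtain lg where lg: "lg holomorphic_on ball 0 1" "\<And>z. z \<in> ball 0 1 \<Longrightarrow> exp (lg z) = f' z"
    by (rule holomorphic_logarithm_exists[OF convex_ball open_ball derivs_holomorphic(1), of 0])
      (use deriv_nonzero in auto)
  define F where "F z = of_real (ln C) - lg z" for z
  have norm_f': "norm (f' z) = C * exp (- Re (F z))" if "norm z < 1" for z
  proof -
    have "norm (f' z) = exp (Re (lg z))" using lg(2)[of z] that by (metis mem_ball_0 norm_exp_eq_Re)
    then show ?thesis using C by (simp add: F_def exp_diff)
  qed
  have F_pos: "0 < Re (F z)" if "norm z < 1" for z
    using norm_f'[OF that] f'_less[OF that] C by (simp add: mult_less_cancel_left1)
  \<comment> \<open>The value of \<open>Re (F z)\<close> at which \<open>L\<close> drops to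
    \<open>c1 / 4\<close>; beyond it \<open>h\<close> could not cover the required distance.\<close>
  define X where "X = 4 / \<tau> * ln (4 * C / c1)"
  show ?thesis
  proof (intro exI[of _ "C * exp (- X)"] conjI allI impI)
    show "0 < C * exp (- X)" using C by simp
    fix z :: complex assume z: "norm z < 1"
    define \<rho> where "\<rho> = 1 - norm z"
    have \<rho>: "0 < \<rho>" using z by (simp add: \<rho>_def)
    have sub: "ball z \<rho> \<subseteq> ball 0 1" by (simp add: ball_subset_ball_iff \<rho>_def)
    define L where "L = C * exp (- (\<tau> / 4 * Re (F z)))"
    define B where "B = cball z ((1 - \<tau>) * \<rho>)"
    have Bsub: "B \<subseteq> ball 0 1"
    proof -
      have "(1 - \<tau>) * \<rho> < 1 * \<rho>" using \<tau>(1) \<rho> by (intro mult_strict_right_mono) auto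
      then have "B \<subseteq> ball z \<rho>" by (auto simp: B_def)
      then show ?thesis using sub by blast
    qed
    have f'_le: "norm (f' w) \<le> L" if w: "w \<in> B" for w
    proof -
      have "(1 - (1 - \<tau>)) / 4 * Re (F z) \<le> Re (F w)"
      proof (rule positive_Re_Schwarz(2)[where s=\<rho> and F=F and z=z and w=w and \<rho>="1 - \<tau>"])
        show "F holomorphic_on ball z \<rho>"
          unfolding F_def[abs_def] by (intro holomorphic_intros holomorphic_on_subset[OF lg(1) sub])
        show "0 < Re (F x)" if "x \<in> ball z \<rho>" for x using F_pos that sub by auto
        show "norm (w - z) \<le> (1 - \<tau>) * \<rho>" using w by (simp add: B_def dist_norm norm_minus_commute)
      qed (use \<rho> \<tau> in auto)
      then have "norm (f' w) \<le> C * exp (- (\<tau> / 4 * Re (F z)))"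
        using norm_f'[of w] w Bsub C by (auto intro!: mult_left_mono)
      then show ?thesis by (simp add: L_def)
    qed
    define u where "u = (if z = 0 then 1 else sgn z)"
    have u: "norm u = 1" "z = of_real (norm z) * u"
      by (simp add: u_def norm_sgn) (simp add: u_def sgn_div_norm scaleR_conv_of_real)
    define w where "w = z + of_real ((1 - \<tau>) * \<rho>) * u"
    have r1: "0 \<le> (1 - \<tau>) * \<rho>" using \<tau> \<rho> by simp
    have wz: "norm (w - z) = (1 - \<tau>) * \<rho>" unfolding w_def using u(1) r1 by (simp add: norm_mult del: of_real_mult)
    then have wB: "w \<in> B" by (simp add: B_def dist_norm norm_minus_commute)
    then have w1: "norm w < 1" using Bsub by auto
    have nw: "1 - norm w = \<tau> * \<rho>"
    proof -
      have "w = of_real (norm z + (1 - \<tau>) * \<rho>) * u"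
        unfolding w_def by (subst u(2)) (simp add: algebra_simps)
      then have "norm w = norm z + (1 - \<tau>) * \<rho>" using u(1) r1 by (simp add: norm_mult del: of_real_add of_real_mult)
      then show ?thesis by (simp add: \<rho>_def algebra_simps)
    qed
    have L0: "0 < L" using C by (simp add: L_def)
    have "norm (h z - h w) \<le> 2 * L * norm (z - w)"
      using f'_le Bsub wB r1 by (intro h_Lipschitz_on_convex[of B]) (auto simp: B_def)
    also have "norm (z - w) \<le> \<rho>" using wz \<tau>(1) \<rho> by (simp add: norm_minus_commute)
    finally have hzw: "norm (h z - h w) \<le> 2 * L * \<rho>" using L0 by (simp add: mult_left_mono)
    have "c1 * \<rho> \<le> bdist (h z)" using c1(2)[OF z] by (simp add: \<rho>_def)
    also have "\<dots> \<le> bdist (h w) + dist (h z) (h w)" by (rule infdist_triangle)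
    also have "\<dots> \<le> C1 * (\<tau> * \<rho>) + 2 * L * \<rho>"
      using C1(2)[OF w1] hzw unfolding nw dist_norm by (rule add_mono)
    also have "\<dots> = (c1 / 2 + 2 * L) * \<rho>" unfolding \<tau>(3)[symmetric] by (simp add: algebra_simps)
    finally have "c1 \<le> c1 / 2 + 2 * L" using \<rho> by simp
    then have "c1 / (4 * C) \<le> exp (- (\<tau> / 4 * Re (F z)))" using C by (simp add: L_def field_simps)
    then have "ln (c1 / (4 * C)) \<le> - (\<tau> / 4 * Re (F z))"
      using c1(1) C by (subst ln_exp[symmetric], intro ln_mono) auto
    moreover have "ln (c1 / (4 * C)) = - ln (4 * C / c1)" using c1(1) C by (simp add: ln_div)
    ultimately have "\<tau> / 4 * Re (F z) \<le> ln (4 * C / c1)" by simp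
    then have "Re (F z) \<le> X" using \<tau>(1) by (simp add: X_def field_simps)
    then show "C * exp (- X) \<le> norm (f' z)" unfolding norm_f'[OF z] using C by (intro mult_left_mono) auto
  qed
qed

end

section \<open>Quasiconvexity of the image and the co-Lipschitz bound\<close>

context planar_hqc
begin

lemma h_has_derivative:
  assumes z: "norm z < 1"
  shows "(h has_derivative (\<lambda>v. f' z * v + cnj (g' z * v))) (at z)"
proof (rule has_derivative_transform_within_open)
  show "((\<lambda>z. f z + cnj (g z)) has_derivative (\<lambda>v. f' z * v + cnj (g' z * v))) (at z)"
    using f_deriv[OF z] g_deriv[OF z] unfolding has_field_derivative_def
    by (intro has_derivative_add has_derivative_cnj)
  show "z \<in> ball 0 1" using z by simp
  show "f w + cnj (g w) = h w" if "w \<in> ball 0 1" for w using that by (simp add: h_eq)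
qed simp

text \<open>The differential of \<open>h\<close> shrinks no vector by more than
  \<open>|f'| - |g'|\<close>, which is at least \<open>(1 - k) c\<close>.\<close>

lemma hinv_Lipschitz_on_convex:
  assumes S: "convex S" "S \<subseteq> D" and c: "0 < c" "\<And>z. norm z < 1 \<Longrightarrow> c \<le> norm (f' z)"
    and ab: "a \<in> S" "b \<in> S"
  shows "norm (hinv a - hinv b) \<le> 1 / ((1 - k) * c) * norm (a - b)"
proof -
  \<comment> \<open>The inverse of the real-linear map \<open>v \<mapsto> A v + cnj (B v)\<close>;
    the denominator is the Jacobian \<open>|A|^2 - |B|^2\<close>.\<close>
  define T where "T w v = (cnj (f' (hinv w)) * v - cnj (g' (hinv w)) * cnj v)
      / of_real ((norm (f' (hinv w)))\<^sup>2 - (norm (g' (hinv w)))\<^sup>2)" for w v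
  show ?thesis
  proof (rule differentiable_bound[OF S(1), of hinv T])
    fix w assume "w \<in> S"
    then have w: "w \<in> D" using S(2) by blast
    define A where "A = f' (hinv w)"
    define B where "B = g' (hinv w)"
    have nz: "norm (hinv w) < 1" by (rule h_hinv(2)[OF w])
    have BA: "norm B \<le> k * norm A" using dil[OF nz] by (simp add: A_def B_def)
    have cA: "c \<le> norm A" using c(2)[OF nz] by (simp add: A_def)
    have gap: "(1 - k) * c \<le> norm A - norm B"
      using mult_left_mono[OF cA, of "1 - k"] BA k by (simp add: algebra_simps)
    have gap0: "0 < (1 - k) * c" using k c(1) by simp
    have den: "(norm A)\<^sup>2 - (norm B)\<^sup>2 = (norm A - norm B) * (norm A + norm B)"
      by (simp add: power2_eq_square algebra_simps)
    have pos: "0 < norm A - norm B" "0 < norm A + norm B"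
      using gap gap0 c(1) cA norm_ge_zero[of B] by linarith+
    then have den0: "0 < (norm A)\<^sup>2 - (norm B)\<^sup>2" unfolding den by (rule mult_pos_pos)
    have T_eq: "T w v = (cnj A * v - cnj B * cnj v) / of_real ((norm A)\<^sup>2 - (norm B)\<^sup>2)" for v
      by (simp add: T_def A_def B_def)
    have lin: "bounded_linear (T w)"
      unfolding T_def[abs_def] divide_inverse
      by (intro bounded_linear_mult_const bounded_linear_sub bounded_linear_mult_right
          bounded_linear_compose[OF bounded_linear_mult_right bounded_linear_cnj])
    have "(hinv has_derivative T w) (at w)"
    proof (rule has_derivative_inverse_basic[where g=hinv and y=w and f=h, OF h_has_derivative[OF nz] lin _ _ D(1) w])
      show "T w \<circ> (\<lambda>v. f' (hinv w) * v + cnj (g' (hinv w) * v)) = id"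
      proof
        fix v
        have "cnj A * (A * v + cnj (B * v)) - cnj B * cnj (A * v + cnj (B * v)) = (A * cnj A - B * cnj B) * v"
          by (simp add: algebra_simps)
        also have "\<dots> = of_real ((norm A)\<^sup>2 - (norm B)\<^sup>2) * v"
          by (simp add: complex_norm_square[symmetric] flip: of_real_power)
        finally have e: "cnj A * (A * v + cnj (B * v)) - cnj B * cnj (A * v + cnj (B * v)) = of_real ((norm A)\<^sup>2 - (norm B)\<^sup>2) * v" .
        have "T w (A * v + cnj (B * v)) = v" unfolding T_eq e
          using den0 by (intro nonzero_mult_div_cancel_left) (metis less_irrefl of_real_eq_0_iff)
        then show "(T w \<circ> (\<lambda>v. f' (hinv w) * v + cnj (g' (hinv w) * v))) v = id v"
          by (simp add: A_def B_def)
      qed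
      show "continuous (at w) hinv"
        using hinv_continuous D(1) w by (simp add: continuous_on_eq_continuous_at)
      show "h (hinv x) = x" if "x \<in> D" for x by (rule h_hinv(1)[OF that])
    qed
    then show "(hinv has_derivative T w) (at w within S)" by (rule has_derivative_at_withinI)
    show "onorm (T w) \<le> 1 / ((1 - k) * c)"
    proof (rule onorm_bound)
      fix v
      have "norm (T w v) \<le> (norm A * norm v + norm B * norm v) / ((norm A)\<^sup>2 - (norm B)\<^sup>2)"
        unfolding T_eq norm_divide norm_of_real abs_of_pos[OF den0]
        using norm_triangle_ineq4[of "cnj A * v" "cnj B * cnj v"] den0 pos
        by (intro divide_right_mono) (simp_all add: norm_mult)
      also have "\<dots> = norm v / (norm A - norm B)"
      proof -
        have "norm A * norm v + norm B * norm v = norm v * (norm A + norm B)" by (simp add: algebra_simps)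
        then show ?thesis unfolding den using pos by simp
      qed
      also have "\<dots> \<le> norm v / ((1 - k) * c)" using gap gap0 by (intro divide_left_mono) auto
      finally show "norm (T w v) \<le> 1 / ((1 - k) * c) * norm v" by simp
    qed (use gap0 in simp)
  qed (use ab in auto)
qed

end

context planar_hqc_flat
begin

text \<open>Points of \<open>D\<close> that are close to each other and to the boundary are joined inside \<open>D\<close> by moving
  three times their distance along the inner normal, then across, then back.\<close>

lemma hinv_locally_Lipschitz:
  assumes c: "0 < c" "\<And>z. norm z < 1 \<Longrightarrow> c \<le> norm (f' z)"
  shows "\<exists>\<delta>0>0. \<forall>w1\<in>D. \<forall>w2\<in>D. norm (w1 - w2) \<le> \<delta>0 \<longrightarrow>
    norm (hinv w1 - hinv w2) \<le> 7 * (1 / ((1 - k) * c)) * norm (w1 - w2)"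
proof -
  define \<Lambda> where "\<Lambda> = 1 / ((1 - k) * c)"
  have \<Lambda>: "0 < \<Lambda>" using k c by (simp add: \<Lambda>_def)
  note Lip = hinv_Lipschitz_on_convex[OF _ _ c, folded \<Lambda>_def]
  obtain r1 where r1: "0 < r1" "r1 \<le> r" "\<And>x. 0 \<le> x \<Longrightarrow> x \<le> r1 \<Longrightarrow> x powr \<mu> \<le> 1 / (16 * M)"
    using exists_small_powr[OF \<mu>(1), of "1 / (16 * M)" r] M r by auto
  have Mx: "M * x powr \<mu> \<le> 1 / 16" if "0 \<le> x" "x \<le> r1" for x
    using mult_left_mono[OF r1(3)[OF that], of M] M by simp
  define s where "s = r1 / 2"
  have s: "0 < s" "2 * s \<le> r" "2 * s \<le> r1" using r1 by (auto simp: s_def)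
  have "norm (hinv w1 - hinv w2) \<le> 7 * \<Lambda> * norm (w1 - w2)"
    if w: "w1 \<in> D" "w2 \<in> D" and near: "norm (w1 - w2) \<le> s / 20" for w1 w2
  proof (cases "norm (w1 - w2) < bdist w1")
    case True
    have "norm (hinv w1 - hinv w2) \<le> \<Lambda> * norm (w1 - w2)"
      by (rule Lip[of "ball w1 (bdist w1)"])
        (use True ball_bdist_subset[OF w(1)] bdist_pos[OF w(1)] in \<open>auto simp: dist_norm\<close>)
    also have "\<dots> \<le> 7 * \<Lambda> * norm (w1 - w2)" using \<Lambda> by (intro mult_right_mono) auto
    finally show ?thesis .
  next
    case False
    define \<delta> where "\<delta> = norm (w1 - w2)"
    have "w1 \<noteq> w2" using False bdist_pos[OF w(1)] by auto
    \<comment> \<open>The whole detour stays within \<open>2 \<delta> + 3 \<delta>\<close> of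
      \<open>p\<close>; the threshold \<open>s / 20\<close> keeps this below the
      \<open>s / 4\<close> required for comparing normals.\<close>
    then have \<delta>: "0 < \<delta>" "5 * \<delta> \<le> s / 4" using near by (auto simp: \<delta>_def)
    obtain p where p: "p \<in> frontier D" "norm (w1 - p) = bdist w1"
      by (rule bdist_attained)
    have wp: "norm (w1 - p) \<le> \<delta>" "norm (w2 - p) \<le> 2 * \<delta>"
    proof -
      show "norm (w1 - p) \<le> \<delta>" using False p(2) by (simp add: \<delta>_def)
      then show "norm (w2 - p) \<le> 2 * \<delta>"
        using norm_triangle_ineq[of "w2 - w1" "w1 - p"] by (simp add: \<delta>_def norm_minus_commute)
    qed
    obtain n where n: "Holder_flat \<mu> M r D p n" using flat[OF p(1)] by blast
    have nn: "norm n = 1" using n by (simp add: Holder_flat_def)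
    define e where "e = (3 * \<delta>) *\<^sub>R n"
    \<comment> \<open>A boundary point \<open>q\<close> hit on the way up would have a normal close
      to \<open>n\<close>, yet the starting point in \<open>D\<close> lies below \<open>q\<close>
      along \<open>n\<close>, deeper than flatness at \<open>q\<close> allows.\<close>
    have up: "closed_segment x (x + e) \<subseteq> D" if x: "x \<in> D" "norm (x - p) \<le> 2 * \<delta>" for x
    proof (rule connected_disjoint_frontier)
      show "closed_segment x (x + e) \<inter> frontier D = {}"
      proof (rule ccontr)
        assume "closed_segment x (x + e) \<inter> frontier D \<noteq> {}"
        then obtain q where q: "q \<in> closed_segment x (x + e)" "q \<in> frontier D" by blast
        obtain u where u: "0 \<le> u" "u \<le> 1" "q = (1 - u) *\<^sub>R x + u *\<^sub>R (x + e)"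
          using q(1) unfolding closed_segment_def by blast
        define t where "t = u * (3 * \<delta>)"
        have q_eq: "q = x + t *\<^sub>R n" unfolding u(3) by (simp add: t_def e_def algebra_simps)
        have "x \<notin> frontier D" using x(1) D(1) by (simp add: frontier_def interior_open)
        then have "t \<noteq> 0" using q(2) q_eq by auto
        then have t: "0 < t" "t \<le> 3 * \<delta>" using u \<delta>(1) by (auto simp: t_def mult_left_le_one_le)
        have "norm (p - q) \<le> norm (p - x) + norm (t *\<^sub>R n)"
          unfolding q_eq using norm_triangle_ineq4[of "p - x" "t *\<^sub>R n"] by (simp add: algebra_simps)
        then have pq: "norm (p - q) \<le> s / 4" using x(2) t nn \<delta>(2) by (simp add: norm_minus_commute)
        obtain m where m: "Holder_flat \<mu> M r D q m" using flat[OF q(2)] by blast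
        have mn: "1 / 2 \<le> Re (cnj m * n)"
          by (rule Holder_flat_normals_close[OF n m \<mu>(1) M s(1,2) Mx pq]) (use s in auto)
        have "- M * norm (x - q) powr (1 + \<mu>) \<le> Re (cnj m * (x - q))"
          using m x(1) by (simp add: Holder_flat_def)
        moreover have "norm (x - q) = t" using t nn by (simp add: q_eq)
        moreover have "Re (cnj m * (x - q)) = - t * Re (cnj m * n)" by (simp add: q_eq algebra_simps)
        ultimately have "t * Re (cnj m * n) \<le> M * t powr (1 + \<mu>)" by simp
        also have "\<dots> = t * (M * t powr \<mu>)" using t by (simp add: powr_add)
        also have "\<dots> \<le> t * (1 / 16)" using t \<delta> s by (intro mult_left_mono Mx) auto
        finally have "Re (cnj m * n) \<le> 1 / 16" using t by simp
        then show False using mn by simp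
      qed
    qed (use x in auto)
    \<comment> \<open>The lifted segment has height at least \<open>3 \<delta> - 2 \<delta>\<close>
      above the tangent at \<open>p\<close> and stays within \<open>5 \<delta>\<close> of
      \<open>p\<close>, hence inside the inner cusp.\<close>
    have across: "closed_segment (w1 + e) (w2 + e) \<subseteq> D"
    proof
      fix v assume v: "v \<in> closed_segment (w1 + e) (w2 + e)"
      have sub: "closed_segment w1 w2 \<subseteq> cball p (2 * \<delta>)"
        using wp \<delta>(1) by (intro closed_segment_subset) (auto simp: dist_norm norm_minus_commute)
      have "v - e \<in> closed_segment w1 w2"
      proof -
        obtain u where "0 \<le> u" "u \<le> 1" "v = (1 - u) *\<^sub>R (w1 + e) + u *\<^sub>R (w2 + e)"
          using v unfolding closed_segment_def by blast
        then show ?thesis unfolding closed_segment_def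
          by (intro CollectI exI[of _ u]) (simp add: algebra_simps)
      qed
      then have "v - e \<in> cball p (2 * \<delta>)" using sub by blast
      then have xp: "norm ((v - e) - p) \<le> 2 * \<delta>" by (simp only: mem_cball dist_norm norm_minus_commute)
      have "Re (cnj n * (v - p)) = Re (cnj n * ((v - e) - p)) + 3 * \<delta> * Re (cnj n * n)"
        by (simp add: e_def algebra_simps)
      moreover have "\<bar>Re (cnj n * ((v - e) - p))\<bar> \<le> 2 * \<delta>"
        using abs_Re_cnj_mult_le[of n "(v - e) - p"] nn xp by simp
      ultimately have y: "\<delta> \<le> Re (cnj n * (v - p))" using Re_cnj_mult_self[of n] nn by simp
      have "norm (v - p) \<le> norm ((v - e) - p) + norm e"
        using norm_triangle_ineq[of "(v - e) - p" e] by (simp add: algebra_simps)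
      then have vp: "norm (v - p) \<le> 5 * \<delta>" using xp \<delta>(1) nn by (simp add: e_def)
      have "M * norm (v - p) powr (1 + \<mu>) \<le> M * (5 * \<delta>) powr (1 + \<mu>)"
        using vp M \<mu> by (intro mult_left_mono powr_mono2) auto
      also have "\<dots> = 5 * \<delta> * (M * (5 * \<delta>) powr \<mu>)" using \<delta>(1) by (simp add: powr_add)
      also have "\<dots> \<le> 5 * \<delta> * (1 / 16)" using \<delta> s by (intro mult_left_mono Mx) auto
      also have "\<dots> < \<delta>" using \<delta>(1) by simp
      finally have "M * norm (v - p) powr (1 + \<mu>) < Re (cnj n * (v - p))" using y by simp
      moreover have "norm (v - p) < r" using vp \<delta> s by simp
      ultimately show "v \<in> D" using n by (simp add: Holder_flat_def)
    qed
    \<comment> \<open>Up, across and down: the lengths 3, 1 and 3 times \<open>\<delta>\<close> give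
      the factor 7.\<close>
    have ne: "norm e = 3 * \<delta>" using nn \<delta>(1) by (simp add: e_def)
    have "norm (hinv w1 - hinv (w1 + e)) \<le> \<Lambda> * norm (w1 - (w1 + e))"
      using up[OF w(1)] wp \<delta>(1) by (intro Lip[of "closed_segment w1 (w1 + e)"]) auto
    moreover have "norm (hinv (w1 + e) - hinv (w2 + e)) \<le> \<Lambda> * norm ((w1 + e) - (w2 + e))"
      by (intro Lip[OF _ across]) auto
    moreover have "norm (hinv (w2 + e) - hinv w2) \<le> \<Lambda> * norm ((w2 + e) - w2)"
      using up[OF w(2) wp(2)] by (intro Lip[of "closed_segment w2 (w2 + e)"]) auto
    moreover have "norm (hinv w1 - hinv w2) \<le> norm (hinv w1 - hinv (w1 + e))
        + norm (hinv (w1 + e) - hinv (w2 + e)) + norm (hinv (w2 + e) - hinv w2)"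
      using norm_triangle_ineq[of "hinv w1 - hinv (w1 + e)" "hinv (w1 + e) - hinv (w2 + e)"]
        norm_triangle_ineq[of "hinv w1 - hinv (w2 + e)" "hinv (w2 + e) - hinv w2"] by simp
    ultimately show ?thesis using ne by (simp add: \<delta>_def)
  qed
  then show ?thesis using s(1) unfolding \<Lambda>_def by (intro exI[of _ "s / 20"]) auto
qed

text \<open>The claim is a Lipschitz bound for \<open>hinv\<close>. Nearby images are covered by the
  local bound, distant ones by the diameter 2 of the disc.\<close>

lemma h_co_Lipschitz: "co_Lipschitz_on (ball 0 1) h"
proof -
  obtain c where c: "0 < c" "\<And>z. norm z < 1 \<Longrightarrow> c \<le> norm (f' z)" using deriv_bounded_below by blast
  define \<Lambda> where "\<Lambda> = 7 * (1 / ((1 - k) * c))"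
  have \<Lambda>: "0 < \<Lambda>" using c k by (simp add: \<Lambda>_def)
  obtain \<delta>0 where \<delta>0: "0 < \<delta>0" "\<And>w1 w2. w1 \<in> D \<Longrightarrow> w2 \<in> D \<Longrightarrow> norm (w1 - w2) \<le> \<delta>0
      \<Longrightarrow> norm (hinv w1 - hinv w2) \<le> \<Lambda> * norm (w1 - w2)"
    using hinv_locally_Lipschitz[OF c] unfolding \<Lambda>_def by blast
  define B where "B = \<Lambda> + 2 / \<delta>0"
  have B: "0 < B" using \<Lambda> \<delta>0(1) by (simp add: B_def add_pos_pos)
  have "norm (z1 - z2) \<le> B * norm (h z1 - h z2)" if z: "norm z1 < 1" "norm z2 < 1" for z1 z2
  proof (cases "norm (h z1 - h z2) \<le> \<delta>0")
    case True
    have "norm (z1 - z2) \<le> \<Lambda> * norm (h z1 - h z2)"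
      using \<delta>0(2)[OF h_in_D[OF z(1)] h_in_D[OF z(2)] True] hinv_h z by simp
    also have "\<dots> \<le> B * norm (h z1 - h z2)" using \<delta>0(1) by (intro mult_right_mono) (auto simp: B_def)
    finally show ?thesis .
  next
    case False
    have "norm (z1 - z2) \<le> 2" using norm_triangle_ineq4[of z1 z2] z by simp
    also have "\<dots> = 2 / \<delta>0 * \<delta>0" using \<delta>0(1) by simp
    also have "\<dots> \<le> B * norm (h z1 - h z2)"
      using False \<delta>0(1) \<Lambda> B by (intro mult_mono) (auto simp: B_def)
    finally show ?thesis .
  qed
  then have "1 / B * norm (z1 - z2) \<le> norm (h z1 - h z2)" if "norm z1 < 1" "norm z2 < 1" for z1 z2
    using that B by (simp add: divide_le_eq mult.commute)
  then show ?thesis unfolding co_Lipschitz_on_def using B by (intro exI[of _ "1 / B"]) auto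
qed

end

theorem theorem1p3:
  fixes \<mu> :: real and D :: "complex set" and h :: "complex \<Rightarrow> complex"
  assumes "0 < \<mu>" and "\<mu> < 1"
    and "Lyapunov_domain \<mu> D"
    and "quasiconformal (ball 0 1) D h"
    and "harmonic_on (ball 0 1) h"
  shows "co_Lipschitz_on (ball 0 1) h"
proof -
  obtain K hinv where K: "1 \<le> K" and hom: "homeomorphism (ball 0 1) D h hinv"
    and ae: "AE z in lebesgue. z \<in> ball 0 1 \<longrightarrow> norm (deriv_zbar h z) \<le> (K - 1) / (K + 1) * norm (deriv_z h z)"
    using assms(4) unfolding quasiconformal_def K_quasiconformal_def by blast
  define k where "k = (K - 1) / (K + 1)"
  have k: "0 \<le> k" "k < 1" using K by (auto simp: k_def)
  obtain f g f' g' where fg: "\<And>z. z \<in> ball 0 1 \<Longrightarrow> (f has_field_derivative f' z) (at z)"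
    "\<And>z. z \<in> ball 0 1 \<Longrightarrow> (g has_field_derivative g' z) (at z)"
    "\<And>z. z \<in> ball 0 1 \<Longrightarrow> h z = f z + cnj (g z)"
    "\<And>z. z \<in> ball 0 1 \<Longrightarrow> f' z = deriv_z h z" "\<And>z. z \<in> ball 0 1 \<Longrightarrow> g' z = cnj (deriv_zbar h z)"
    using harmonic_on_decomposition[OF assms(5) convex_ball] by metis
  have cont: "continuous_on (ball 0 1) (partial_x h)" "continuous_on (ball 0 1) (partial_y h)"
    using assms(5) by (auto simp: harmonic_on_def C1_on_def)
  \<comment> \<open>Both sides are continuous because \<open>h\<close> is of class C1, so the almost
    everywhere inequality holds everywhere.\<close>
  have dil: "norm (deriv_zbar h z) \<le> k * norm (deriv_z h z)" if "z \<in> ball 0 1" for z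
  proof (rule AE_lebesgue_imp_everywhere_le[OF open_ball _ _ ae[folded k_def] that])
    show "continuous_on (ball 0 1) (\<lambda>z. norm (deriv_zbar h z))"
      "continuous_on (ball 0 1) (\<lambda>z. k * norm (deriv_z h z))"
      unfolding deriv_z_def deriv_zbar_def by (intro continuous_intros cont; simp)+
  qed
  obtain M r where M: "0 < M" "0 < r" "\<And>p. p \<in> frontier D \<Longrightarrow> \<exists>n. Holder_flat \<mu> M r D p n"
    using Lyapunov_domain_Holder_flat[OF assms(1,3)] by blast
  interpret planar_hqc_flat f g f' g' h hinv k D \<mu> M r
  proof
    show "(f has_field_derivative f' z) (at z)" "(g has_field_derivative g' z) (at z)"
      "h z = f z + cnj (g z)" "norm (g' z) \<le> k * norm (f' z)" if "norm z < 1" for z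
      using fg[of z] dil[of z] that by auto
    show "open D" "bounded D" using assms(3) by (auto simp: Lyapunov_domain_def planar_domain_def)
  qed (use k hom assms(1,2) M in auto)
  show ?thesis by (rule h_co_Lipschitz)
qed

end
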